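(* Let $u$ be a weak solution of problem (P) on $[0,+\infty)$, let $t_1\ge 0$, and suppose $\sup_{s\ge t_1}\|u(s)\|_{L^2(\Omega)}<\infty$. Then for every $\tau>0$ there exists a constant $D(\tau)>0$ (depending on $\tau$ and on the data $\Omega,d,p,f,g$, but not on $u$ or $t_1$) such that for every $t\ge t_1+\tau$ we have $u(t)\in L^\infty(\Omega)$ and $$\|u(t)\|_{L^\infty(\Omega)}\le D(\tau)\Big(\sup_{s\ge t_1}\|u(s)\|_{L^2(\Omega)}+1\Big).$$
   Context: Standing setting: $d\ge 1$, $\Omega\subset\mathbb{R}^d$ is a bounded domain with Lipschitz boundary, $p\ge 2$ and $p'=p/(p-1)$. The function $f:\mathbb{R}\to\mathbb{R}$ is continuous and there are constants $C_1,C_2,\alpha>0$ with $|f(u)|\le C_1(1+|u|^{p-1})$ and $f(u)u\ge \alpha|u|^p-C_2$ for all $u\in\mathbb{R}$. The forcing term satisfies $g\in L^s(\Omega)$ for some $s>d/2$ if $d\ge 2$, and $g\in L^1(\Omega)$ if $d=1$. Problem (P) is: $u_t-\Delta u+f(u)=g$ in $\Omega\times(0,\infty)$, $u=0$ on $\partial\Omega$, $u(0)=u_0\in L^2(\Omega)$. A weak solution of (P) on $[0,+\infty)$ is a function $u\in L^2_{loc}(0,+\infty;H^1_0(\Omega))\cap L^p_{loc}(0,+\infty;L^p(\Omega))$ such that for all $T>0$, $v\in H^1_0(\Omega)\cap L^p(\Omega)$ and $\eta\in C_0^\infty(0,T)$, $$-\int_0^T (u,v)\eta_t\,dt+\int_0^T\big((\nabla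 u,\nabla v)+(f(u),v)-(g,v)\big)\eta\,dt=0,$$ where $(\cdot,\cdot)$ is the $L^2(\Omega)$ inner product (or the corresponding duality pairing). Such a solution satisfies $u_t\in L^2_{loc}(0,\infty;H^{-1}(\Omega))+L^{p'}_{loc}(0,\infty;L^{p'}(\Omega))$ and $u\in C([0,\infty);L^2(\Omega))$, so $u(t)$ is defined for every $t\ge0$. *)

theory Defs
  imports "HOL-Analysis.Analysis"
begin

definition Lp_on :: "real \<Rightarrow> (real^'n) set \<Rightarrow> (real^'n \<Rightarrow> real) \<Rightarrow> bool" where
  "Lp_on p \<Omega> v \<longleftrightarrow> v \<in> borel_measurable (lebesgue_on \<Omega>) \<and>
      integrable (lebesgue_on \<Omega>) (\<lambda>x. \<bar>v x\<bar> powr p)"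

definition Lp_norm :: "real \<Rightarrow> (real^'n) set \<Rightarrow> (real^'n \<Rightarrow> real) \<Rightarrow> real" where
  "Lp_norm p \<Omega> v = (\<integral>x. \<bar>v x\<bar> powr p \<partial>lebesgue_on \<Omega>) powr (1 / p)"

definition Linf_on :: "(real^'n) set \<Rightarrow> (real^'n \<Rightarrow> real) \<Rightarrow> bool" where
  "Linf_on \<Omega> v \<longleftrightarrow> v \<in> borel_measurable (lebesgue_on \<Omega>) \<and>
      (\<exists>C. AE x in lebesgue_on \<Omega>. \<bar>v x\<bar> \<le> C)"

definition Linf_norm :: "(real^'n) set \<Rightarrow> (real^'n \<Rightarrow> real) \<Rightarrow> real" where
  "Linf_norm \<Omega> v = Inf {C. AE x in lebesgue_on \<Omega>. \<bar>v x\<bar> \<le> C}"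

definition partial :: "'n::finite \<Rightarrow> (real^'n \<Rightarrow> real) \<Rightarrow> real^'n \<Rightarrow> real" where
  "partial i \<phi> x = (THE c. ((\<lambda>s. \<phi> (x + s *\<^sub>R axis i 1)) has_real_derivative c) (at 0))"

definition smooth_Rn :: "(real^'n::finite \<Rightarrow> real) \<Rightarrow> bool" where
  "smooth_Rn \<phi> \<longleftrightarrow> (\<forall>\<alpha>::'n list. \<forall>x. foldr partial \<alpha> \<phi> differentiable (at x))"

definition test_fun :: "(real^'n::finite) set \<Rightarrow> (real^'n \<Rightarrow> real) \<Rightarrow> bool" where
  "test_fun \<Omega> \<phi> \<longleftrightarrow> smooth_Rn \<phi> \<and> compact (closure {x. \<phi> x \<noteq> 0}) \<and>
      closure {x. \<phi> x \<noteq> 0} \<subseteq> \<Omega>"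

definition test_fun1 :: "real \<Rightarrow> real \<Rightarrow> (real \<Rightarrow> real) \<Rightarrow> bool" where
  "test_fun1 a b \<eta> \<longleftrightarrow> (\<forall>k x. (deriv ^^ k) \<eta> differentiable (at x)) \<and>
      compact (closure {t. \<eta> t \<noteq> 0}) \<and> closure {t. \<eta> t \<noteq> 0} \<subseteq> {a<..<b}"

definition weak_grad :: "(real^'n::finite) set \<Rightarrow> (real^'n \<Rightarrow> real) \<Rightarrow> (real^'n \<Rightarrow> real^'n) \<Rightarrow> bool" where
  "weak_grad \<Omega> v G \<longleftrightarrow> (\<forall>\<phi>. test_fun \<Omega> \<phi> \<longrightarrow> (\<forall>i.
      (\<integral>x. v x * partial i \<phi> x \<partial>lebesgue_on \<Omega>) = - (\<integral>x. G x $ i * \<phi> x \<partial>lebesgue_on \<Omega>)))"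

definition H1_on :: "(real^'n::finite) set \<Rightarrow> (real^'n \<Rightarrow> real) \<Rightarrow> (real^'n \<Rightarrow> real^'n) \<Rightarrow> bool" where
  "H1_on \<Omega> v G \<longleftrightarrow> Lp_on 2 \<Omega> v \<and> (\<forall>i. Lp_on 2 \<Omega> (\<lambda>x. G x $ i)) \<and> weak_grad \<Omega> v G"

definition H10_on :: "(real^'n::finite) set \<Rightarrow> (real^'n \<Rightarrow> real) \<Rightarrow> (real^'n \<Rightarrow> real^'n) \<Rightarrow> bool" where
  "H10_on \<Omega> v G \<longleftrightarrow> H1_on \<Omega> v G \<and>
     (\<exists>\<phi>s :: nat \<Rightarrow> real^'n \<Rightarrow> real. (\<forall>k. test_fun \<Omega> (\<phi>s k)) \<and>
        (\<lambda>k. \<integral>x. (\<phi>s k x - v x)\<^sup>2 + (\<Sum>i\<in>UNIV. (partial i (\<phi>s k) x - G x $ i)\<^sup>2) \<partial>lebesgue_on \<Omega>)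
          \<longlonglongrightarrow> 0)"

definition lipschitz_boundary :: "(real^'n::finite) set \<Rightarrow> bool" where
  "lipschitz_boundary \<Omega> \<longleftrightarrow> (\<forall>x0 \<in> frontier \<Omega>. \<exists>r>0. \<exists>(Q :: real^'n \<Rightarrow> real^'n) (k :: 'n)
      (\<gamma> :: real^'n \<Rightarrow> real) L. orthogonal_transformation Q \<and> L-lipschitz_on UNIV \<gamma> \<and>
      (\<forall>y z. (\<forall>j. j \<noteq> k \<longrightarrow> y $ j = z $ j) \<longrightarrow> \<gamma> y = \<gamma> z) \<and>
      \<Omega> \<inter> ball x0 r = {x \<in> ball x0 r. (Q (x - x0)) $ k < \<gamma> (Q (x - x0))})"

definition bounded_lipschitz_domain :: "(real^'n::finite) set \<Rightarrow> bool" where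
  "bounded_lipschitz_domain \<Omega> \<longleftrightarrow> open \<Omega> \<and> connected \<Omega> \<and> \<Omega> \<noteq> {} \<and> bounded \<Omega> \<and>
      lipschitz_boundary \<Omega>"

definition weak_solution ::
  "(real^'n::finite) set \<Rightarrow> real \<Rightarrow> (real \<Rightarrow> real) \<Rightarrow> (real^'n \<Rightarrow> real) \<Rightarrow> (real \<Rightarrow> real^'n \<Rightarrow> real) \<Rightarrow> bool" where
  "weak_solution \<Omega> p f g u \<longleftrightarrow>
    (\<exists>G :: real \<Rightarrow> real^'n \<Rightarrow> real^'n. \<forall>T>0.
       (\<lambda>(t,x). u t x) \<in> borel_measurable (lebesgue_on ({0<..<T} \<times> \<Omega>)) \<and>
       (\<lambda>(t,x). G t x) \<in> borel_measurable (lebesgue_on ({0<..<T} \<times> \<Omega>)) \<and>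
       integrable (lebesgue_on ({0<..<T} \<times> \<Omega>)) (\<lambda>(t,x). (u t x)\<^sup>2 + (norm (G t x))\<^sup>2) \<and>
       integrable (lebesgue_on ({0<..<T} \<times> \<Omega>)) (\<lambda>(t,x). \<bar>u t x\<bar> powr p) \<and>
       (AE t in lebesgue_on {0<..<T}. H10_on \<Omega> (u t) (G t)) \<and>
       (\<forall>v Gv \<eta>. H10_on \<Omega> v Gv \<and> Lp_on p \<Omega> v \<and> test_fun1 0 T \<eta> \<longrightarrow>
          - (\<integral>t. (\<integral>x. u t x * v x \<partial>lebesgue_on \<Omega>) * deriv \<eta> t \<partial>lebesgue_on {0<..<T})
          + (\<integral>t. ((\<integral>x. G t x \<bullet> Gv x \<partial>lebesgue_on \<Omega>)
                   + (\<integral>x. f (u t x) * v x \<partial>lebesgue_on \<Omega>)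
                   - (\<integral>x. g x * v x \<partial>lebesgue_on \<Omega>)) * \<eta> t \<partial>lebesgue_on {0<..<T}) = 0))"

text \<open>u is the representative continuous from [0,oo) into L^2(\<Omega>).\<close>
definition continuous_L2 :: "(real^'n::finite) set \<Rightarrow> (real \<Rightarrow> real^'n \<Rightarrow> real) \<Rightarrow> bool" where
  "continuous_L2 \<Omega> u \<longleftrightarrow> (\<forall>t\<ge>0. Lp_on 2 \<Omega> (u t)) \<and>
     (\<forall>t\<ge>0. ((\<lambda>s. Lp_norm 2 \<Omega> (\<lambda>x. u s x - u t x)) \<longlongrightarrow> 0) (at t within {0..}))"

end

theory Submission
  imports Defs "HOL-Probability.Distributions" "HOL-Real_Asymp.Real_Asymp"
begin

text \<open>
  Let \<open>B u = sqrt (1 + u\<^sup>2) - 1\<close>, a smooth convex function with \<open>B u \<le> \<bar>u\<bar> \<le> B u + 1\<close>. Because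
  \<open>f u * u \<ge> - C2\<close>, the function \<open>B (u t x)\<close>, extended by zero, is a subsolution of the heat equation
  on the whole space with right-hand side \<open>\<bar>g\<bar> + C2\<close>: formally one tests the equation with
  \<open>B' (u) * \<phi>\<close>. This is legitimate for every smooth \<open>\<phi> \<ge> 0\<close>, with no boundary condition, since
  \<open>B' (u t)\<close> lies in \<open>H10\<close>. Taking for \<open>\<phi>\<close> the Gaussian solution of the backward heat equation that
  ends at time \<open>t\<close> in a narrow peak at \<open>y\<close>, one gets a pointwise bound of \<open>B (u t y)\<close> by
  \<^item> the heat flow of \<open>B (u (t - \<tau>/2))\<close>, controlled by its \<open>L\<^sup>2\<close> norm, and
  \<^item> the heat potential of \<open>\<bar>g\<bar> + C2\<close>, which is bounded because
    \<open>\<bar>g\<bar> \<le> \<mu> powr (q - 1) * \<bar>g\<bar> powr q + 1 / \<mu>\<close> with \<open>\<mu> = s powr (n / (2 * q))\<close> leaves the singularity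
    \<open>s powr (- n / (2 * q))\<close> in the time variable, integrable exactly when \<open>q > n / 2\<close>.

  The chain rule in time is replaced by the convexity of \<open>B\<close> on backward time differences, followed
  by a limit that rests on the continuity of translations in \<open>L\<^sup>1\<close> and \<open>L\<^sup>2\<close>.
\<close>

section \<open>Smooth functions on Euclidean space\<close>

text \<open>The weak formulation only admits products of a fixed spatial function and a time
  cut-off, so it cannot be tested with a function of the solution itself. For a fixed spatial
  function it yields the increment between two times; this is used at almost every time
  \<open>r\<close> with \<open>dhyp (u r)\<close> frozen. The convexity inequality bounds the
  increment of \<open>hyp (u)\<close> from above only if the derivative is taken at the later time,
  hence backward differences, and hence gradients at times just before \<open>r\<close> paired with
  a test function of time \<open>r\<close>. Translation continuity removes this mismatch. The square
  root replaces the absolute value because \<open>dhyp\<close> is bounded (so the test function is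
  admissible whatever \<open>p\<close> is), vanishes at 0 (so zero boundary values survive) and is
  smooth (so test functions remain test functions after composition). The loss of 1 in passing back
  to the absolute value is absorbed by the \<open>+ 1\<close> of the claim. Starting at
  \<open>t - \<tau>/2\<close> keeps all times strictly positive even if \<open>t1 = 0\<close>. The
  peak keeps a positive width in every estimate; the bounds do not depend on the width, and a
  measure theoretic argument turns them into an almost everywhere bound.\<close>

text \<open>\<open>partial\<close> is a definite description, so its value must be pinned down by
  uniqueness of the one-variable derivative along the axis.\<close>

lemma partial_eqI:
  assumes "(f has_derivative f') (at x)"
  shows "partial i f x = f' (axis i 1)"
proof -
  have "((\<lambda>s::real. f (x + s *\<^sub>R axis i 1)) has_derivative (\<lambda>s. f' (s *\<^sub>R axis i 1))) (at 0)"
    by (rule has_derivative_compose[of "\<lambda>s. x + s *\<^sub>R axis i 1" _ _ _ f, simplified])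
      (auto intro!: derivative_eq_intros assms)
  moreover have "f' (s *\<^sub>R axis i 1) = f' (axis i 1) * s" for s
    using linear_scale[OF has_derivative_linear[OF assms]] by simp
  ultimately have "((\<lambda>s::real. f (x + s *\<^sub>R axis i 1)) has_real_derivative f' (axis i 1)) (at 0)"
    by (simp add: has_field_derivative_def)
  then show ?thesis
    unfolding partial_def by (intro the_equality) (auto intro: DERIV_unique)
qed

lemma partial_eq_frechet:
  "f differentiable (at x) \<Longrightarrow> partial i f x = frechet_derivative f (at x) (axis i 1)"
  by (rule partial_eqI) (simp add: frechet_derivative_works)

lemma partial_has_real_derivative:
  assumes "f differentiable (at x)"
  shows "((\<lambda>s. f (x + s *\<^sub>R axis i 1)) has_real_derivative partial i f x) (at 0)"
proof -
  obtain f' where f': "(f has_derivative f') (at x)" using assms by (auto simp: differentiable_def)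
  have "((\<lambda>s::real. f (x + s *\<^sub>R axis i 1)) has_derivative (\<lambda>s. f' (s *\<^sub>R axis i 1))) (at 0)"
    by (rule has_derivative_compose[of "\<lambda>s. x + s *\<^sub>R axis i 1" _ _ _ f, simplified])
      (auto intro!: derivative_eq_intros f')
  moreover have "f' (s *\<^sub>R axis i 1) = partial i f x * s" for s
    using linear_scale[OF has_derivative_linear[OF f']] by (simp add: partial_eqI[OF f'])
  ultimately show ?thesis by (simp add: has_field_derivative_def)
qed

lemma partial_const: "partial i (\<lambda>_. c) = (\<lambda>_. 0)"
  by (rule ext, rule partial_eqI[where f'="\<lambda>_. 0"]) simp

lemma partial_nth: "partial i (\<lambda>x. x $ j) = (\<lambda>_. if i = j then 1 else 0)"
  by (rule ext, subst partial_eqI[where f'="\<lambda>x. x $ j"])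
    (auto intro!: bounded_linear_imp_has_derivative bounded_linear_vec_nth simp: axis_def)

lemma partial_add:
  "f differentiable (at x) \<Longrightarrow> g differentiable (at x) \<Longrightarrow>
    partial i (\<lambda>x. f x + g x) x = partial i f x + partial i g x"
  by (subst partial_eqI[OF has_derivative_add[OF frechet_derivative_works[THEN iffD1] frechet_derivative_works[THEN iffD1]]])
    (auto simp: partial_eq_frechet)

lemma partial_mult:
  assumes "f differentiable (at x)" "g differentiable (at x)"
  shows "partial i (\<lambda>x. f x * g x) x = f x * partial i g x + partial i f x * g x"
  by (subst partial_eqI[OF has_derivative_mult[OF frechet_derivative_works[THEN iffD1] frechet_derivative_works[THEN iffD1]]])
    (auto simp: partial_eq_frechet assms)

lemma partial_compose:
  assumes "f differentiable (at x)" "(\<gamma> has_real_derivative d) (at (f x))"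
  shows "partial i (\<lambda>x. \<gamma> (f x)) x = d * partial i f x"
  using partial_eqI[OF has_derivative_compose[OF frechet_derivative_works[THEN iffD1, OF assms(1)]
    assms(2)[unfolded has_field_derivative_def]], of i]
  by (simp add: partial_eq_frechet assms)

lemma differentiable_compose_real:
  assumes "f differentiable (at x)" "(\<gamma> has_real_derivative d) (at (f x))"
  shows "(\<lambda>x. \<gamma> (f x)) differentiable (at x)"
  using has_derivative_compose[OF frechet_derivative_works[THEN iffD1, OF assms(1)]
    assms(2)[unfolded has_field_derivative_def]] by (auto simp: differentiable_def)

lemma smooth_Rn_differentiable: "smooth_Rn f \<Longrightarrow> f differentiable (at x)"
  unfolding smooth_Rn_def by (metis foldr_Nil id_apply)

lemma smooth_Rn_partial: "smooth_Rn f \<Longrightarrow> smooth_Rn (partial i f)"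
  unfolding smooth_Rn_def
proof (intro allI)
  fix \<alpha> x assume "\<forall>\<alpha> x. foldr partial \<alpha> f differentiable at x"
  from this[rule_format, of "\<alpha> @ [i]" x]
  show "foldr partial \<alpha> (partial i f) differentiable at x" by simp
qed

text \<open>A class of differentiable functions that is closed under \<open>partial\<close> contains
  all iterated partials of its members, so no formula for higher derivatives is ever written
  down.\<close>

lemma smooth_Rn_coinduct:
  assumes "F f" and "\<And>f x. F f \<Longrightarrow> f differentiable (at x)" and "\<And>f i. F f \<Longrightarrow> F (partial i f)"
  shows "smooth_Rn f"
proof -
  have "F (foldr partial \<alpha> f)" for \<alpha>
    by (induction \<alpha>) (auto intro: assms)
  then show ?thesis unfolding smooth_Rn_def using assms(2) by blast
qed

text \<open>All derivatives of \<open>sqrt (1 + u\<^sup>2)\<close> are polynomials in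
  \<open>u\<close> and this one function, which makes it the natural generator for a class closed
  under differentiation.\<close>

definition rsq :: "real \<Rightarrow> real" where "rsq u = 1 / sqrt (1 + u\<^sup>2)"

lemma one_plus_sq_pos: "0 < 1 + (u::real)\<^sup>2"
  by (simp add: add_pos_nonneg)

lemma rsq_pos: "0 < rsq u"
  using one_plus_sq_pos[of u] by (simp add: rsq_def)

lemma rsq_le_1: "rsq u \<le> 1"
  using one_plus_sq_pos[of u] by (simp add: rsq_def)

lemma rsq_sq: "rsq u ^ 2 * (1 + u\<^sup>2) = 1"
  using one_plus_sq_pos[of u] by (simp add: rsq_def power_divide)

lemma DERIV_rsq: "(rsq has_real_derivative - (u * rsq u ^ 3)) (at u)"
proof -
  have s: "sqrt (1 + u\<^sup>2) > 0" using one_plus_sq_pos[of u] by simp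
  have "((\<lambda>u. 1 / sqrt (1 + u\<^sup>2)) has_real_derivative - (u * rsq u ^ 3)) (at u)"
    unfolding rsq_def
    by (rule derivative_eq_intros refl | use one_plus_sq_pos[of u] s in \<open>simp; fail\<close>)+
      (use s in \<open>simp add: field_simps power3_eq_cube\<close>)
  then show ?thesis unfolding rsq_def[abs_def] .
qed

text \<open>
  The constructors are chosen so that each partial derivative of a term is again a term. Smoothness
  of products and compositions then needs no formula for higher derivatives.
\<close>

inductive smooth_term :: "(real^'n::finite \<Rightarrow> real) \<Rightarrow> bool" where
  base: "smooth_Rn f \<Longrightarrow> smooth_term f"
| const: "smooth_term (\<lambda>_. c)"
| nth: "smooth_term (\<lambda>x. x $ i)"
| add: "smooth_term f \<Longrightarrow> smooth_term g \<Longrightarrow> smooth_term (\<lambda>x. f x + g x)"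
| mult: "smooth_term f \<Longrightarrow> smooth_term g \<Longrightarrow> smooth_term (\<lambda>x. f x * g x)"
| exp: "smooth_term f \<Longrightarrow> smooth_term (\<lambda>x. exp (f x))"
| rsq: "smooth_term f \<Longrightarrow> smooth_term (\<lambda>x. rsq (f x))"

lemma smooth_term_partial:
  "smooth_term f \<Longrightarrow> (\<forall>x. f differentiable (at x)) \<and> (\<forall>i. smooth_term (partial i f))"
proof (induction rule: smooth_term.induct)
  case (base f)
  then show ?case by (auto intro: smooth_term.base smooth_Rn_partial smooth_Rn_differentiable)
next
  case (const c)
  then show ?case by (auto simp: partial_const intro: smooth_term.const)
next
  case (nth i)
  have "(\<lambda>x. x $ i) differentiable (at x)" for x
    by (metis bounded_linear_vec_nth bounded_linear_imp_differentiable)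
  then show ?case by (auto simp: partial_nth intro: smooth_term.const)
next
  case (add f g)
  then have "partial i (\<lambda>x. f x + g x) = (\<lambda>x. partial i f x + partial i g x)" for i
    by (auto simp: partial_add)
  with add show ?case by (auto intro!: smooth_term.add derivative_intros)
next
  case (mult f g)
  then have "partial i (\<lambda>x. f x * g x) = (\<lambda>x. f x * partial i g x + partial i f x * g x)" for i
    by (auto simp: partial_mult)
  with mult show ?case by (auto intro!: smooth_term.add smooth_term.mult derivative_intros)
next
  case (exp f)
  then have "partial i (\<lambda>x. exp (f x)) = (\<lambda>x. exp (f x) * partial i f x)" for i
    by (auto intro!: partial_compose ext DERIV_exp)
  with exp show ?case
    by (auto intro!: smooth_term.mult smooth_term.exp intro: differentiable_compose_real[OF _ DERIV_exp])
next
  case (rsq f)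
  have "smooth_term (partial i (\<lambda>x. rsq (f x)))" for i
  proof -
    \<comment> \<open>The derivative \<open>- u * rsq u ^ 3\<close> is spelled out as a product
      because the constructors offer products and constants but no powers.\<close>
    have eq: "partial i (\<lambda>x. rsq (f x)) =
       (\<lambda>x. (-1) * (f x * (rsq (f x) * (rsq (f x) * rsq (f x)))) * partial i f x)"
      using rsq by (auto intro!: ext simp: partial_compose[OF _ DERIV_rsq] power3_eq_cube)
    show ?thesis
      unfolding eq using rsq by (intro smooth_term.mult smooth_term.rsq smooth_term.const) auto
  qed
  with rsq show ?case
    by (auto intro: differentiable_compose_real[OF _ DERIV_rsq])
qed

lemma smooth_term_smooth: "smooth_term f \<Longrightarrow> smooth_Rn f"
  by (rule smooth_Rn_coinduct[of smooth_term]) (auto dest: smooth_term_partial)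

section \<open>Sobolev functions vanishing on the boundary\<close>

lemma smooth_Rn_mult: "smooth_Rn f \<Longrightarrow> smooth_Rn g \<Longrightarrow> smooth_Rn (\<lambda>x. f x * g x)"
  by (rule smooth_term_smooth[OF smooth_term.mult[OF smooth_term.base smooth_term.base]])

lemma smooth_Rn_continuous_on: "smooth_Rn f \<Longrightarrow> continuous_on S f"
  by (meson continuous_at_imp_continuous_on differentiable_imp_continuous_within smooth_Rn_differentiable)

lemma smooth_Rn_borel: "smooth_Rn f \<Longrightarrow> f \<in> borel_measurable borel"
  by (simp add: borel_measurable_continuous_onI smooth_Rn_continuous_on)

lemma partial_eq_0_outside:
  assumes "x \<notin> closure {x. f x \<noteq> 0}"
  shows "partial i f x = 0"
proof -
  have "(f has_derivative (\<lambda>_. 0)) (at x)"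
    by (rule has_derivative_transform_within_open[of "\<lambda>_. 0" _ _ _ "- closure {x. f x \<noteq> 0}"])
      (use assms closure_subset[of "{x. f x \<noteq> 0}"] in auto)
  from partial_eqI[OF this] show ?thesis by simp
qed

lemma smooth_Rn_bounded_on:
  assumes "smooth_Rn f" "bounded S"
  obtains C where "C \<ge> 0" "\<And>x. x \<in> S \<Longrightarrow> \<bar>f x\<bar> \<le> C"
proof -
  have "compact (closure S)" using assms by simp
  then have "bounded (f ` closure S)"
    using assms compact_continuous_image smooth_Rn_continuous_on compact_imp_bounded by blast
  then obtain C where "\<forall>y\<in>f ` closure S. norm y \<le> C" by (auto simp: bounded_iff)
  then have "\<bar>f x\<bar> \<le> max C 0" if "x \<in> S" for x
    using that closure_subset[of S] by fastforce
  then show ?thesis using that[of "max C 0"] by simp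
qed

lemma partial_has_real_derivative_line:
  assumes "\<And>x. f differentiable (at x)"
  shows "((\<lambda>s. f (x + s *\<^sub>R axis i 1)) has_real_derivative partial i f (x + s *\<^sub>R axis i 1)) (at s)"
proof -
  from partial_has_real_derivative[OF assms, of "x + s *\<^sub>R axis i 1" i]
  have "((\<lambda>r. f (x + (r + s) *\<^sub>R axis i 1)) has_real_derivative partial i f (x + s *\<^sub>R axis i 1)) (at 0)"
    by (simp add: algebra_simps)
  then show ?thesis
    using DERIV_shift[of "\<lambda>r. f (x + r *\<^sub>R axis i 1)" _ 0 s] by simp
qed

text \<open>Differentiate the translation invariance of Lebesgue measure.\<close>

lemma integral_partial_eq_0:
  fixes f :: "real^'n::finite \<Rightarrow> real"
  assumes f: "smooth_Rn f" and K: "compact (closure {x. f x \<noteq> 0})"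
  shows "integrable lborel (partial i f)" "(\<integral>x. partial i f x \<partial>lborel) = 0"
proof -
  obtain R where R: "R > 0" "\<And>x. x \<in> closure {x. f x \<noteq> 0} \<Longrightarrow> norm x \<le> R"
    using compact_imp_bounded[OF K] bounded_pos by blast
  have f0: "f x = 0" if "norm x > R" for x
    using R(2)[of x] closure_subset[of "{x. f x \<noteq> 0}"] that by fastforce
  have p0: "partial i f x = 0" if "norm x > R" for x
    by (rule partial_eq_0_outside) (use R(2)[of x] that in auto)
  obtain C where C: "C \<ge> 0" "\<And>x. x \<in> cball 0 R \<Longrightarrow> \<bar>partial i f x\<bar> \<le> C"
    using smooth_Rn_bounded_on[OF smooth_Rn_partial[OF f] bounded_cball] by blast
  have Cb: "\<bar>partial i f x\<bar> \<le> C" for x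
    using C p0[of x] by (cases "norm x \<le> R") auto
  define s where "s n = 1 / real (Suc n)" for n
  have s: "0 < s n" "s n \<le> 1" for n by (auto simp: s_def)
  have s0: "s \<longlonglongrightarrow> 0" unfolding s_def using LIMSEQ_Suc[OF lim_1_over_n] by simp
  define d where "d n x = (f (x + s n *\<^sub>R axis i 1) - f x) / s n" for n x
  have [measurable]: "f \<in> borel_measurable borel" "partial i f \<in> borel_measurable borel"
    by (auto intro: smooth_Rn_borel f smooth_Rn_partial)
  have [measurable]: "d n \<in> borel_measurable lborel" for n
    unfolding d_def by measurable
  have lim: "(\<lambda>n. d n x) \<longlonglongrightarrow> partial i f x" for x
  proof -
    have "((\<lambda>r. (f (x + r *\<^sub>R axis i 1) - f x) / r) \<longlongrightarrow> partial i f x) (at 0)"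
      using partial_has_real_derivative[OF smooth_Rn_differentiable[OF f], of x i]
      by (simp add: has_field_derivative_iff)
    show ?thesis
      unfolding d_def using s s0
      by (intro filterlim_compose[OF \<open>((\<lambda>r. (f (x + r *\<^sub>R axis i 1) - f x) / r) \<longlongrightarrow> partial i f x) (at 0)\<close>])
        (use s in \<open>auto simp: filterlim_at less_imp_neq[OF s(1), symmetric]\<close>)
  qed
  \<comment> \<open>The steps \<open>s n\<close> are at most 1, so every difference quotient
    vanishes outside the ball of radius \<open>R + 1\<close>; inside, the mean value theorem bounds
    it by the supremum of the partial derivative.\<close>
  have bd: "norm (d n x) \<le> C * indicator (cball 0 (R + 1)) x" for n x
  proof (cases "norm x \<le> R + 1")
    case True
    obtain z where "f (x + s n *\<^sub>R axis i 1) - f (x + 0 *\<^sub>R axis i 1) = (s n - 0) * partial i f (x + z *\<^sub>R axis i 1)"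
      using MVT2[OF s(1)[of n] partial_has_real_derivative_line[OF smooth_Rn_differentiable[OF f]], of x i] by auto
    then have "d n x = partial i f (x + z *\<^sub>R axis i 1)" using s[of n] by (simp add: d_def)
    with True Cb show ?thesis by simp
  next
    case False
    have "norm x \<le> norm (x + s n *\<^sub>R axis i 1) + norm (s n *\<^sub>R (axis i 1 :: real^'n))"
      using norm_triangle_ineq4[of "x + s n *\<^sub>R axis i 1" "s n *\<^sub>R axis i 1"] by simp
    also have "norm (s n *\<^sub>R (axis i 1 :: real^'n)) \<le> 1"
      using s[of n] by simp
    finally have "norm (x + s n *\<^sub>R axis i 1) > R" using False by simp
    with False f0 show ?thesis by (simp add: d_def)
  qed
  have ib: "integrable lborel (\<lambda>x::real^'n. C * indicator (cball 0 (R + 1)) x)"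
    using emeasure_bounded_finite[OF bounded_cball] by (intro integrable_mult_right integrable_real_indicator) auto
  have int_f: "integrable lborel f"
  proof -
    obtain C' where C': "C' \<ge> 0" "\<And>x. x \<in> cball 0 R \<Longrightarrow> \<bar>f x\<bar> \<le> C'"
      using smooth_Rn_bounded_on[OF f bounded_cball] by blast
    have "integrable lborel (\<lambda>x::real^'n. C' * indicator (cball 0 R) x)"
      using emeasure_bounded_finite[OF bounded_cball] by (intro integrable_mult_right integrable_real_indicator) auto
    then show ?thesis
    proof (rule Bochner_Integration.integrable_bound)
      show "AE x in lborel. norm (f x) \<le> norm (C' * indicator (cball 0 R) x)"
        using C' f0 by (intro always_eventually allI) (auto simp: indicator_def not_le)
    qed simp
  qed
  have shift: "integrable lborel (\<lambda>x. f (x + c)) \<and> (\<integral>x. f (x + c) \<partial>lborel) = (\<integral>x. f x \<partial>lborel)" for c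
  proof -
    have *: "distr lborel borel ((+) c) = (lborel :: (real^'n) measure)" by (rule lborel_distr_plus)
    have "integrable (distr lborel borel ((+) c)) f" unfolding * by (rule int_f)
    then have "integrable lborel (\<lambda>x. f (c + x))" by (subst (asm) integrable_distr_eq) auto
    moreover have "(\<integral>x. f x \<partial>distr lborel borel ((+) c)) = (\<integral>x. f (c + x) \<partial>lborel)"
      by (rule integral_distr) auto
    ultimately show ?thesis unfolding * by (simp add: add.commute)
  qed
  have d0: "(\<integral>x. d n x \<partial>lborel) = 0" for n
    using shift[of "s n *\<^sub>R axis i 1"] int_f by (simp add: d_def)
  show "integrable lborel (partial i f)"
    by (rule integrable_dominated_convergence[OF _ _ ib, of _ d]) (use lim bd in auto)
  have "(\<lambda>n. \<integral>x. d n x \<partial>lborel) \<longlonglongrightarrow> (\<integral>x. partial i f x \<partial>lborel)"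
    by (rule integral_dominated_convergence[OF _ _ ib]) (use lim bd in auto)
  then show "(\<integral>x. partial i f x \<partial>lborel) = 0"
    unfolding d0 by (simp add: LIMSEQ_const_iff)
qed

lemma test_funD:
  assumes "test_fun \<Omega> f"
  shows "smooth_Rn f" "compact (closure {x. f x \<noteq> 0})" "closure {x. f x \<noteq> 0} \<subseteq> \<Omega>"
  using assms by (auto simp: test_fun_def)

text \<open>Covers the two operations used on test functions: multiplication by any smooth function,
  and composition with a smooth function that vanishes at 0.\<close>

lemma test_fun_subset_support:
  assumes "test_fun \<Omega> f" "smooth_Rn h" "\<And>x. f x = 0 \<Longrightarrow> h x = 0"
  shows "test_fun \<Omega> h"
proof -
  have "closure {x. h x \<noteq> 0} \<subseteq> closure {x. f x \<noteq> 0}"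
    by (rule closure_mono) (use assms(3) in auto)
  moreover have "compact (closure {x. h x \<noteq> 0})"
    using calculation compact_Int_closed[OF test_funD(2)[OF assms(1)] closed_closure, of "{x. h x \<noteq> 0}"]
    by (simp add: Int_absorb1)
  ultimately show ?thesis
    using assms unfolding test_fun_def by blast
qed

section \<open>Cauchy-Schwarz and limits in the space of square integrable functions\<close>

lemma abs_mult_le_sum_squares: "\<bar>a * b\<bar> \<le> a\<^sup>2 + b\<^sup>2" for a b :: real
proof -
  have "2 * \<bar>a\<bar> * \<bar>b\<bar> \<le> a\<^sup>2 + b\<^sup>2" using sum_squares_bound[of "\<bar>a\<bar>" "\<bar>b\<bar>"] by simp
  moreover have "0 \<le> \<bar>a\<bar> * \<bar>b\<bar>" by simp
  ultimately show ?thesis unfolding abs_mult by linarith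
qed

text \<open>Cauchy-Schwarz, from the fact that the quadratic polynomial
  \<open>l \<mapsto> \<integral>(f + l * g)\<^sup>2\<close> is nonnegative for every
  \<open>l\<close>.\<close>

lemma integral_sq_le_mult:
  fixes f g :: "'a \<Rightarrow> real"
  assumes [measurable]: "f \<in> borel_measurable M" "g \<in> borel_measurable M"
    and f: "integrable M (\<lambda>x. (f x)\<^sup>2)" and g: "integrable M (\<lambda>x. (g x)\<^sup>2)"
  shows "integrable M (\<lambda>x. f x * g x)"
    "(\<integral>x. f x * g x \<partial>M)\<^sup>2 \<le> (\<integral>x. (f x)\<^sup>2 \<partial>M) * (\<integral>x. (g x)\<^sup>2 \<partial>M)"
proof -
  show i: "integrable M (\<lambda>x. f x * g x)"
  proof (rule Bochner_Integration.integrable_bound[OF Bochner_Integration.integrable_add[OF f g]])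
    show "AE x in M. norm (f x * g x) \<le> norm ((f x)\<^sup>2 + (g x)\<^sup>2)"
      using abs_mult_le_sum_squares by (intro always_eventually allI) simp
  qed simp
  define a b c where "a = (\<integral>x. (f x)\<^sup>2 \<partial>M)" and "b = (\<integral>x. f x * g x \<partial>M)" and "c = (\<integral>x. (g x)\<^sup>2 \<partial>M)"
  have q: "0 \<le> a + 2 * l * b + l\<^sup>2 * c" for l
  proof -
    have "0 \<le> (\<integral>x. (f x + l * g x)\<^sup>2 \<partial>M)" by (rule integral_nonneg_AE) simp
    also have "(\<integral>x. (f x + l * g x)\<^sup>2 \<partial>M) = (\<integral>x. (f x)\<^sup>2 + (2 * l) * (f x * g x) + l\<^sup>2 * (g x)\<^sup>2 \<partial>M)"
      by (intro Bochner_Integration.integral_cong refl) (simp add: power2_sum power_mult_distrib algebra_simps)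
    also have "\<dots> = a + 2 * l * b + l\<^sup>2 * c"
      using f g i by (simp add: a_def b_def c_def)
    finally show ?thesis .
  qed
  have c0: "c \<ge> 0" unfolding c_def by (rule integral_nonneg_AE) simp
  have "b\<^sup>2 \<le> a * c"
  proof (cases "c = 0")
    case True
    have "b = 0"
    proof (rule ccontr)
      assume "b \<noteq> 0"
      \<comment> \<open>If the quadratic coefficient \<open>c\<close> is 0, the polynomial is affine
        with slope \<open>2 * b\<close>; at this argument it would take the value -1.\<close>
      then have "2 * (- (a + 1) / (2 * b)) * b = - (a + 1)" by simp
      with q[of "- (a + 1) / (2 * b)"] True show False by simp
    qed
    with True show ?thesis by simp
  next
    case False
    with c0 have "c > 0" by simp
    then have "a + 2 * (- b / c) * b + (- b / c)\<^sup>2 * c = a - b\<^sup>2 / c"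
      by (simp add: power2_eq_square)
    with q[of "- b / c"] have "0 \<le> a - b\<^sup>2 / c" by simp
    with \<open>c > 0\<close> show ?thesis by (simp add: field_simps)
  qed
  then show "(\<integral>x. f x * g x \<partial>M)\<^sup>2 \<le> (\<integral>x. (f x)\<^sup>2 \<partial>M) * (\<integral>x. (g x)\<^sup>2 \<partial>M)"
    by (simp add: a_def b_def c_def)
qed

text \<open>Strong convergence implies weak convergence, by Cauchy-Schwarz. The filter is arbitrary
  because the lemma serves both sequences and limits at a point of time.\<close>

lemma tendsto_0_integral_mult:
  fixes w :: "'b \<Rightarrow> 'a \<Rightarrow> real"
  assumes [measurable]: "\<And>k. w k \<in> borel_measurable M" "h \<in> borel_measurable M"
    and w: "\<And>k. integrable M (\<lambda>x. (w k x)\<^sup>2)" and h: "integrable M (\<lambda>x. (h x)\<^sup>2)"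
    and lim: "((\<lambda>k. \<integral>x. (w k x)\<^sup>2 \<partial>M) \<longlongrightarrow> 0) F"
  shows "((\<lambda>k. \<integral>x. w k x * h x \<partial>M) \<longlongrightarrow> 0) F"
proof -
  have "((\<lambda>k. (\<integral>x. (w k x)\<^sup>2 \<partial>M) * (\<integral>x. (h x)\<^sup>2 \<partial>M)) \<longlongrightarrow> 0 * (\<integral>x. (h x)\<^sup>2 \<partial>M)) F"
    by (intro tendsto_intros lim)
  then have u: "((\<lambda>k. (\<integral>x. (w k x)\<^sup>2 \<partial>M) * (\<integral>x. (h x)\<^sup>2 \<partial>M)) \<longlongrightarrow> 0) F" by simp
  have "((\<lambda>k. (\<integral>x. w k x * h x \<partial>M)\<^sup>2) \<longlongrightarrow> 0) F"
    by (rule tendsto_sandwich[OF _ _ tendsto_const u]) (auto intro!: always_eventually integral_sq_le_mult(2) w h)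
  then have "((\<lambda>k. sqrt ((\<integral>x. w k x * h x \<partial>M)\<^sup>2)) \<longlongrightarrow> sqrt 0) F"
    by (rule tendsto_real_sqrt)
  then show ?thesis by (simp add: tendsto_rabs_zero_iff)
qed

lemma power2_sum3_le: "(a + b + c :: real)\<^sup>2 \<le> 3 * (a\<^sup>2 + b\<^sup>2 + c\<^sup>2)"
proof -
  have "3 * (a\<^sup>2 + b\<^sup>2 + c\<^sup>2) - (a + b + c)\<^sup>2 = (a - b)\<^sup>2 + (b - c)\<^sup>2 + (a - c)\<^sup>2"
    by (simp add: power2_eq_square algebra_simps)
  also have "\<dots> \<ge> 0" by simp
  finally show ?thesis by simp
qed

lemma power2_sum3_le':
  "a\<^sup>2 \<le> A \<Longrightarrow> b\<^sup>2 \<le> B \<Longrightarrow> c\<^sup>2 \<le> C \<Longrightarrow> (a + b + c :: real)\<^sup>2 \<le> 3 * (A + B + C)"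
  by (rule order_trans[OF power2_sum3_le]) (intro mult_left_mono add_mono; simp)

lemma Lp_on_2: "Lp_on 2 \<Omega> v \<longleftrightarrow> v \<in> borel_measurable (lebesgue_on \<Omega>) \<and> integrable (lebesgue_on \<Omega>) (\<lambda>x. (v x)\<^sup>2)"
  unfolding Lp_on_def by simp

lemma Lp_norm_2: "Lp_norm 2 \<Omega> v = sqrt (\<integral>x. (v x)\<^sup>2 \<partial>lebesgue_on \<Omega>)"
  unfolding Lp_norm_def by (simp add: powr_half_sqrt)

section \<open>Calculus on a bounded open set\<close>

locale bounded_open =
  fixes \<Omega> :: "(real^'n::finite) set"
  assumes open_dom: "open \<Omega>" and bounded_dom: "bounded \<Omega>"
begin

abbreviation N where "N \<equiv> lebesgue_on \<Omega>"

lemma dom_sets [measurable, simp]: "\<Omega> \<in> sets lebesgue" "\<Omega> \<in> sets borel"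
  using open_dom by auto

lemma space_N [simp]: "space N = \<Omega>"
  by (simp add: space_restrict_space)

lemma finite_measure_N: "finite_measure N"
proof
  have "emeasure N (space N) = emeasure lborel \<Omega>"
    by (simp add: emeasure_restrict_space)
  also have "\<dots> < \<infinity>" by (rule emeasure_bounded_finite[OF bounded_dom])
  finally show "emeasure N (space N) \<noteq> \<infinity>" by simp
qed

sublocale finite_measure N by (rule finite_measure_N)

lemma borel_imp_measurable_N: "f \<in> borel_measurable borel \<Longrightarrow> f \<in> borel_measurable N"
  by (simp add: measurable_completion measurable_restrict_space1)

lemma smooth_Rn_measurable_N: "smooth_Rn f \<Longrightarrow> f \<in> borel_measurable N"
  by (rule borel_imp_measurable_N[OF smooth_Rn_borel])

lemma integrable_bounded_N:
  fixes f :: "real^'n \<Rightarrow> real"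
  assumes "f \<in> borel_measurable N" "\<And>x. x \<in> \<Omega> \<Longrightarrow> \<bar>f x\<bar> \<le> C"
  shows "integrable N f"
  by (rule integrable_const_bound[of _ C]) (use assms in \<open>auto intro!: AE_I2\<close>)

lemma smooth_Rn_integrable_sq: "smooth_Rn f \<Longrightarrow> integrable N (\<lambda>x. (f x)\<^sup>2)"
proof -
  assume f: "smooth_Rn f"
  obtain C where "C \<ge> 0" "\<And>x. x \<in> \<Omega> \<Longrightarrow> \<bar>f x\<bar> \<le> C" using smooth_Rn_bounded_on[OF f bounded_dom] by blast
  then have "\<bar>(f x)\<^sup>2\<bar> \<le> C\<^sup>2" if "x \<in> \<Omega>" for x
    using that by (simp add: power2_le_iff_abs_le)
  then show ?thesis
    using smooth_Rn_measurable_N[OF f] by (intro integrable_bounded_N[of _ "C\<^sup>2"]) auto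
qed

text \<open>Bridges two measures: integrals over the domain use the completed Lebesgue measure,
  whereas the calculus on the whole space uses \<open>lborel\<close>.\<close>

lemma integral_N_vanishing:
  fixes f :: "real^'n \<Rightarrow> real"
  assumes [measurable]: "f \<in> borel_measurable borel" and "\<And>x. x \<notin> \<Omega> \<Longrightarrow> f x = 0"
  shows "(\<integral>x. f x \<partial>N) = (\<integral>x. f x \<partial>lborel)"
proof -
  have "(\<integral>x. f x \<partial>N) = (\<integral>x. indicator \<Omega> x *\<^sub>R f x \<partial>lebesgue)"
    by (subst integral_restrict_space) auto
  also have "\<dots> = (\<integral>x. f x \<partial>lebesgue)"
    by (intro Bochner_Integration.integral_cong refl) (use assms in \<open>auto simp: indicator_def\<close>)
  also have "\<dots> = (\<integral>x. f x \<partial>lborel)" by (rule integral_completion) simp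
  finally show ?thesis .
qed

lemma integral_N_partial_test_fun:
  assumes "test_fun \<Omega> f"
  shows "(\<integral>x. partial i f x \<partial>N) = 0"
proof -
  note f = test_funD[OF assms]
  have "(\<integral>x. partial i f x \<partial>N) = (\<integral>x. partial i f x \<partial>lborel)"
    by (rule integral_N_vanishing)
      (use f in \<open>auto intro!: smooth_Rn_borel smooth_Rn_partial partial_eq_0_outside\<close>)
  then show ?thesis using integral_partial_eq_0(2)[OF f(1,2)] by simp
qed

text \<open>Only one factor has to be a test function: the product is then again one, and the
  integral of its partial derivative vanishes.\<close>

lemma integral_N_by_parts:
  assumes f: "test_fun \<Omega> f" and h: "smooth_Rn h"
  shows "(\<integral>x. f x * partial i h x \<partial>N) = - (\<integral>x. partial i f x * h x \<partial>N)"
proof -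
  note sf = test_funD(1)[OF f]
  have s: "smooth_Rn (\<lambda>x. f x * h x)"
    by (rule smooth_Rn_mult[OF sf h])
  have t: "test_fun \<Omega> (\<lambda>x. f x * h x)"
    by (rule test_fun_subset_support[OF f s]) simp
  have i: "integrable N (\<lambda>x. f x * partial i h x)" "integrable N (\<lambda>x. partial i f x * h x)"
    by (auto intro!: integral_sq_le_mult(1) smooth_Rn_measurable_N smooth_Rn_integrable_sq smooth_Rn_partial sf h)
  have "0 = (\<integral>x. partial i (\<lambda>x. f x * h x) x \<partial>N)"
    using integral_N_partial_test_fun[OF t] by simp
  also have "\<dots> = (\<integral>x. f x * partial i h x + partial i f x * h x \<partial>N)"
    by (simp add: partial_mult smooth_Rn_differentiable sf h)
  also have "\<dots> = (\<integral>x. f x * partial i h x \<partial>N) + (\<integral>x. partial i f x * h x \<partial>N)"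
    using i by simp
  finally show ?thesis by simp
qed

section \<open>Approximation by test functions, and the operations under which \<open>H10_on\<close>
  is stable\<close>

lemma integrable_diff_sq:
  fixes f g :: "real^'n \<Rightarrow> real"
  assumes "f \<in> borel_measurable N" "g \<in> borel_measurable N"
    "integrable N (\<lambda>x. (f x)\<^sup>2)" "integrable N (\<lambda>x. (g x)\<^sup>2)"
  shows "integrable N (\<lambda>x. (f x - g x)\<^sup>2)"
proof -
  have "integrable N (\<lambda>x. (f x)\<^sup>2 + (g x)\<^sup>2 - 2 * (f x * g x))"
    using assms integral_sq_le_mult(1)[of f N g] by simp
  then show ?thesis by (simp add: power2_diff algebra_simps)
qed

text \<open>Convergence of test functions and of their partials already forces \<open>G\<close> to
  be the weak gradient of \<open>v\<close>, so \<open>weak_grad\<close> need not be checked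
  separately.\<close>

lemma H10_onI:
  fixes \<phi>s :: "nat \<Rightarrow> real^'n \<Rightarrow> real"
  assumes v: "Lp_on 2 \<Omega> v" and G: "\<And>i. Lp_on 2 \<Omega> (\<lambda>x. G x $ i)"
    and t: "\<And>k. test_fun \<Omega> (\<phi>s k)"
    and c1: "(\<lambda>k. \<integral>x. (\<phi>s k x - v x)\<^sup>2 \<partial>N) \<longlonglongrightarrow> 0"
    and c2: "\<And>i. (\<lambda>k. \<integral>x. (partial i (\<phi>s k) x - G x $ i)\<^sup>2 \<partial>N) \<longlonglongrightarrow> 0"
  shows "H10_on \<Omega> v G"
proof -
  note s = test_funD(1)[OF t]
  have m [measurable]: "v \<in> borel_measurable N" "\<And>i. (\<lambda>x. G x $ i) \<in> borel_measurable N"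
    "\<And>k. \<phi>s k \<in> borel_measurable N" "\<And>k i. partial i (\<phi>s k) \<in> borel_measurable N"
    using v G s by (auto simp: Lp_on_2 intro!: smooth_Rn_measurable_N smooth_Rn_partial)
  have d1: "integrable N (\<lambda>x. (\<phi>s k x - v x)\<^sup>2)" for k
    using v by (intro integrable_diff_sq) (auto simp: Lp_on_2 intro!: smooth_Rn_integrable_sq s)
  have d2: "integrable N (\<lambda>x. (partial i (\<phi>s k) x - G x $ i)\<^sup>2)" for k i
    using G by (intro integrable_diff_sq) (auto simp: Lp_on_2 intro!: smooth_Rn_integrable_sq smooth_Rn_partial s)
  have w: "weak_grad \<Omega> v G"
    unfolding weak_grad_def
  proof (intro allI impI)
    fix \<xi> i assume \<xi>: "test_fun \<Omega> \<xi>"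
    note s\<xi> = test_funD(1)[OF \<xi>]
    have [measurable]: "\<xi> \<in> borel_measurable N" "partial i \<xi> \<in> borel_measurable N"
      by (auto intro!: smooth_Rn_measurable_N smooth_Rn_partial s\<xi>)
    have I: "integrable N (\<lambda>x. (\<xi> x)\<^sup>2)" "integrable N (\<lambda>x. (partial i \<xi> x)\<^sup>2)"
      by (auto intro!: smooth_Rn_integrable_sq smooth_Rn_partial s\<xi>)
    have l1: "(\<lambda>k. \<integral>x. (\<phi>s k x - v x) * partial i \<xi> x \<partial>N) \<longlonglongrightarrow> 0"
      by (rule tendsto_0_integral_mult) (use d1 I c1 in auto)
    have l2: "(\<lambda>k. \<integral>x. (partial i (\<phi>s k) x - G x $ i) * \<xi> x \<partial>N) \<longlonglongrightarrow> 0"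
      by (rule tendsto_0_integral_mult) (use d2 I c2 in auto)
    have e1: "(\<integral>x. (\<phi>s k x - v x) * partial i \<xi> x \<partial>N) =
        (\<integral>x. \<phi>s k x * partial i \<xi> x \<partial>N) - (\<integral>x. v x * partial i \<xi> x \<partial>N)" for k
      unfolding left_diff_distrib
      by (intro Bochner_Integration.integral_diff integral_sq_le_mult(1) I)
        (use v in \<open>auto simp: Lp_on_2 intro!: smooth_Rn_integrable_sq s\<close>)
    have e2: "(\<integral>x. (partial i (\<phi>s k) x - G x $ i) * \<xi> x \<partial>N) =
        (\<integral>x. partial i (\<phi>s k) x * \<xi> x \<partial>N) - (\<integral>x. G x $ i * \<xi> x \<partial>N)" for k
      unfolding left_diff_distrib
      by (intro Bochner_Integration.integral_diff integral_sq_le_mult(1) I)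
        (use G in \<open>auto simp: Lp_on_2 intro!: smooth_Rn_integrable_sq smooth_Rn_partial s\<close>)
    have l: "(\<lambda>k. (\<integral>x. (\<phi>s k x - v x) * partial i \<xi> x \<partial>N) + (\<integral>x. (partial i (\<phi>s k) x - G x $ i) * \<xi> x \<partial>N))
       \<longlonglongrightarrow> 0 + 0" by (intro tendsto_add l1 l2)
    \<comment> \<open>Integration by parts cancels everything that depends on \<open>k\<close>; a
      constant sequence that tends to 0 is 0, which is the weak gradient identity.\<close>
    have "(\<lambda>k::nat. - (\<integral>x. v x * partial i \<xi> x \<partial>N) - (\<integral>x. G x $ i * \<xi> x \<partial>N)) \<longlonglongrightarrow> 0"
    proof -
      have "(\<integral>x. (\<phi>s k x - v x) * partial i \<xi> x \<partial>N) + (\<integral>x. (partial i (\<phi>s k) x - G x $ i) * \<xi> x \<partial>N)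
        = - (\<integral>x. v x * partial i \<xi> x \<partial>N) - (\<integral>x. G x $ i * \<xi> x \<partial>N)" for k
        unfolding e1 e2 using integral_N_by_parts[OF t s\<xi>, of k i] by simp
      with l show ?thesis by simp
    qed
    then show "(\<integral>x. v x * partial i \<xi> x \<partial>N) = - (\<integral>x. G x $ i * \<xi> x \<partial>N)"
      unfolding LIMSEQ_const_iff by simp
  qed
  have "(\<lambda>k. (\<integral>x. (\<phi>s k x - v x)\<^sup>2 \<partial>N) + (\<Sum>i\<in>UNIV. \<integral>x. (partial i (\<phi>s k) x - G x $ i)\<^sup>2 \<partial>N)) \<longlonglongrightarrow> 0 + (\<Sum>i\<in>(UNIV::'n set). 0)"
    by (intro tendsto_add tendsto_sum c1 c2)
  then have "(\<lambda>k. \<integral>x. (\<phi>s k x - v x)\<^sup>2 + (\<Sum>i\<in>UNIV. (partial i (\<phi>s k) x - G x $ i)\<^sup>2) \<partial>N) \<longlonglongrightarrow> 0"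
    using d1 d2 by simp
  with w v G t show ?thesis unfolding H10_on_def H1_on_def by blast
qed

text \<open>Splits the single limit in the definition into its components and passes to a
  subsequence. The pointwise convergence so gained is what allows limits inside nonlinear
  coefficients.\<close>

lemma H10_on_approx:
  assumes "H10_on \<Omega> v G"
  obtains \<phi>s :: "nat \<Rightarrow> real^'n \<Rightarrow> real" where "\<And>k. test_fun \<Omega> (\<phi>s k)"
    "(\<lambda>k. \<integral>x. (\<phi>s k x - v x)\<^sup>2 \<partial>N) \<longlonglongrightarrow> 0"
    "\<And>i. (\<lambda>k. \<integral>x. (partial i (\<phi>s k) x - G x $ i)\<^sup>2 \<partial>N) \<longlonglongrightarrow> 0"
    "AE x in N. (\<lambda>k. \<phi>s k x) \<longlonglongrightarrow> v x"
proof -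
  have v: "Lp_on 2 \<Omega> v" and G: "\<And>i. Lp_on 2 \<Omega> (\<lambda>x. G x $ i)"
    using assms by (auto simp: H10_on_def H1_on_def)
  obtain \<phi>s :: "nat \<Rightarrow> real^'n \<Rightarrow> real" where t: "\<And>k. test_fun \<Omega> (\<phi>s k)"
    and lim: "(\<lambda>k. \<integral>x. (\<phi>s k x - v x)\<^sup>2 + (\<Sum>i\<in>UNIV. (partial i (\<phi>s k) x - G x $ i)\<^sup>2) \<partial>N) \<longlonglongrightarrow> 0"
    using assms by (auto simp: H10_on_def)
  note s = test_funD(1)[OF t]
  have m [measurable]: "v \<in> borel_measurable N" "\<And>i. (\<lambda>x. G x $ i) \<in> borel_measurable N"
    "\<And>k. \<phi>s k \<in> borel_measurable N" "\<And>k i. partial i (\<phi>s k) \<in> borel_measurable N"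
    using v G s by (auto simp: Lp_on_2 intro!: smooth_Rn_measurable_N smooth_Rn_partial)
  have d1: "integrable N (\<lambda>x. (\<phi>s k x - v x)\<^sup>2)" for k
    using v by (intro integrable_diff_sq) (auto simp: Lp_on_2 intro!: smooth_Rn_integrable_sq s)
  have d2: "integrable N (\<lambda>x. (partial i (\<phi>s k) x - G x $ i)\<^sup>2)" for k i
    using G by (intro integrable_diff_sq) (auto simp: Lp_on_2 intro!: smooth_Rn_integrable_sq smooth_Rn_partial s)
  have c1: "(\<lambda>k. \<integral>x. (\<phi>s k x - v x)\<^sup>2 \<partial>N) \<longlonglongrightarrow> 0"
    by (rule tendsto_sandwich[OF _ _ tendsto_const lim])
      (auto intro!: always_eventually integral_mono d1 d2 sum_nonneg)
  have c2: "(\<lambda>k. \<integral>x. (partial i (\<phi>s k) x - G x $ i)\<^sup>2 \<partial>N) \<longlonglongrightarrow> 0" for i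
  proof (rule tendsto_sandwich[OF _ _ tendsto_const lim])
    have "(partial i (\<phi>s k) x - G x $ i)\<^sup>2 \<le> (\<phi>s k x - v x)\<^sup>2 + (\<Sum>i\<in>UNIV. (partial i (\<phi>s k) x - G x $ i)\<^sup>2)" for k x
      using member_le_sum[of i UNIV "\<lambda>i. (partial i (\<phi>s k) x - G x $ i)\<^sup>2"] by (simp add: add_increasing)
    then show "\<forall>\<^sub>F k in sequentially. (\<integral>x. (partial i (\<phi>s k) x - G x $ i)\<^sup>2 \<partial>N)
        \<le> (\<integral>x. (\<phi>s k x - v x)\<^sup>2 + (\<Sum>i\<in>UNIV. (partial i (\<phi>s k) x - G x $ i)\<^sup>2) \<partial>N)"
      by (intro always_eventually allI integral_mono) (auto intro!: d1 d2)
  qed simp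
  obtain r where r: "strict_mono r" "AE x in N. (\<lambda>k. (\<phi>s (r k) x - v x)\<^sup>2) \<longlonglongrightarrow> 0"
    using tendsto_L1_AE_subseq[of N "\<lambda>k x. (\<phi>s k x - v x)\<^sup>2"] d1 c1 by auto
  have ae: "AE x in N. (\<lambda>k. \<phi>s (r k) x) \<longlonglongrightarrow> v x"
    using r(2)
  proof eventually_elim
    case (elim x)
    then have "(\<lambda>k. sqrt ((\<phi>s (r k) x - v x)\<^sup>2)) \<longlonglongrightarrow> sqrt 0" by (rule tendsto_real_sqrt)
    then show ?case by (simp add: tendsto_rabs_zero_iff LIM_zero_iff)
  qed
  show ?thesis
    by (rule that[of "\<lambda>k. \<phi>s (r k)"])
      (use t ae LIMSEQ_subseq_LIMSEQ[OF c1 r(1)] LIMSEQ_subseq_LIMSEQ[OF c2 r(1)] in \<open>auto simp: o_def\<close>)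
qed

text \<open>The divergence theorem without boundary term: it holds for test functions, and on a
  finite measure space pairing with the constant 1 passes to the limit.\<close>

lemma H10_on_integral_grad:
  assumes "H10_on \<Omega> v G"
  shows "(\<integral>x. G x $ i \<partial>N) = 0"
proof -
  obtain \<phi>s :: "nat \<Rightarrow> real^'n \<Rightarrow> real" where t: "\<And>k. test_fun \<Omega> (\<phi>s k)"
    and "(\<lambda>k. \<integral>x. (\<phi>s k x - v x)\<^sup>2 \<partial>N) \<longlonglongrightarrow> 0"
    and c: "\<And>i. (\<lambda>k. \<integral>x. (partial i (\<phi>s k) x - G x $ i)\<^sup>2 \<partial>N) \<longlonglongrightarrow> 0"
    and "AE x in N. (\<lambda>k. \<phi>s k x) \<longlonglongrightarrow> v x"
    by (fact H10_on_approx[OF assms])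
  note s = test_funD(1)[OF t]
  have G: "(\<lambda>x. G x $ i) \<in> borel_measurable N" "integrable N (\<lambda>x. (G x $ i)\<^sup>2)"
    using assms by (auto simp: H10_on_def H1_on_def Lp_on_2)
  note [measurable] = G(1) smooth_Rn_measurable_N[OF smooth_Rn_partial[OF s]]
  have d2: "integrable N (\<lambda>x. (partial i (\<phi>s k) x - G x $ i)\<^sup>2)" for k
    using G by (intro integrable_diff_sq) (auto intro!: smooth_Rn_integrable_sq smooth_Rn_partial s)
  have "(\<lambda>k. \<integral>x. (partial i (\<phi>s k) x - G x $ i) * 1 \<partial>N) \<longlonglongrightarrow> 0"
    by (rule tendsto_0_integral_mult) (use d2 c in auto)
  moreover have "(\<integral>x. partial i (\<phi>s k) x - G x $ i \<partial>N) = - (\<integral>x. G x $ i \<partial>N)" for k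
    using integral_N_partial_test_fun[OF t, of i k]
      square_integrable_imp_integrable[OF G] 
      square_integrable_imp_integrable[OF _ smooth_Rn_integrable_sq[OF smooth_Rn_partial[OF s]], of i k]
    by simp
  ultimately show ?thesis by (simp add: LIMSEQ_const_iff)
qed

text \<open>Since \<open>\<gamma> 0 = 0\<close>, the functions
  \<open>\<phi> * \<gamma> (\<psi> k)\<close> built from approximants of \<open>v\<close> are again
  test functions, although \<open>\<phi>\<close> itself need not vanish at the boundary. The lemma
  is used with \<open>dhyp\<close> to build the test function of the energy method and with
  \<open>hyp\<close> to integrate by parts.\<close>

lemma H10_on_mult_compose:
  fixes \<phi> :: "real^'n \<Rightarrow> real" and \<gamma> \<gamma>' :: "real \<Rightarrow> real"
  assumes vG: "H10_on \<Omega> v G" and \<phi>: "smooth_Rn \<phi>"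
    and \<gamma>0: "\<gamma> 0 = 0" and \<gamma>s: "\<And>\<psi> :: real^'n \<Rightarrow> real. smooth_Rn \<psi> \<Longrightarrow> smooth_Rn (\<lambda>x. \<gamma> (\<psi> x))"
    and d: "\<And>u. (\<gamma> has_real_derivative \<gamma>' u) (at u)"
    and b: "\<And>u. \<bar>\<gamma>' u\<bar> \<le> 1" and c: "continuous_on UNIV \<gamma>'"
  shows "H10_on \<Omega> (\<lambda>x. \<phi> x * \<gamma> (v x)) (\<lambda>x. \<chi> i. \<phi> x * \<gamma>' (v x) * G x $ i + \<gamma> (v x) * partial i \<phi> x)"
proof -
  have v: "v \<in> borel_measurable N" "integrable N (\<lambda>x. (v x)\<^sup>2)"
    and G: "\<And>i. (\<lambda>x. G x $ i) \<in> borel_measurable N" "\<And>i. integrable N (\<lambda>x. (G x $ i)\<^sup>2)"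
    using vG by (auto simp: H10_on_def H1_on_def Lp_on_2)
  obtain \<psi> :: "nat \<Rightarrow> real^'n \<Rightarrow> real" where t: "\<And>k. test_fun \<Omega> (\<psi> k)"
    and c1: "(\<lambda>k. \<integral>x. (\<psi> k x - v x)\<^sup>2 \<partial>N) \<longlonglongrightarrow> 0"
    and c2: "\<And>i. (\<lambda>k. \<integral>x. (partial i (\<psi> k) x - G x $ i)\<^sup>2 \<partial>N) \<longlonglongrightarrow> 0"
    and ae: "AE x in N. (\<lambda>k. \<psi> k x) \<longlonglongrightarrow> v x"
    by (fact H10_on_approx[OF vG])
  note s = test_funD(1)[OF t]
  have lip: "\<bar>\<gamma> a - \<gamma> b\<bar> \<le> \<bar>a - b\<bar>" for a b
  proof -
    have "norm (\<gamma> a - \<gamma> b) \<le> 1 * norm (a - b)"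
      by (rule field_differentiable_bound[of UNIV \<gamma> \<gamma>']) (use d b in auto)
    then show ?thesis by simp
  qed
  have \<gamma>b: "\<bar>\<gamma> a\<bar> \<le> \<bar>a\<bar>" for a using lip[of a 0] \<gamma>0 by simp
  have [measurable]: "\<gamma> \<in> borel_measurable borel" "\<gamma>' \<in> borel_measurable borel"
    using c DERIV_continuous_on[of UNIV \<gamma> \<gamma>'] d by (auto intro!: borel_measurable_continuous_onI)
  obtain C where C: "C \<ge> 0" "\<And>x. x \<in> \<Omega> \<Longrightarrow> \<bar>\<phi> x\<bar> \<le> C" using smooth_Rn_bounded_on[OF \<phi> bounded_dom] by blast
  have "\<exists>Ci. Ci \<ge> 0 \<and> (\<forall>x. x \<in> \<Omega> \<longrightarrow> \<bar>partial i \<phi> x\<bar> \<le> Ci)" for i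
    by (rule smooth_Rn_bounded_on[OF smooth_Rn_partial[OF \<phi>, of i] bounded_dom]) blast
  then obtain D where D: "\<And>i. D i \<ge> 0" "\<And>i x. x \<in> \<Omega> \<Longrightarrow> \<bar>partial i \<phi> x\<bar> \<le> D i" by metis
  note [measurable] = v(1) G(1) smooth_Rn_measurable_N[OF \<phi>] smooth_Rn_measurable_N[OF smooth_Rn_partial[OF \<phi>]]
    smooth_Rn_measurable_N[OF s] smooth_Rn_measurable_N[OF smooth_Rn_partial[OF s]]
  let ?w = "\<lambda>x. \<phi> x * \<gamma> (v x)" and ?W = "\<lambda>x. \<chi> i. \<phi> x * \<gamma>' (v x) * G x $ i + \<gamma> (v x) * partial i \<phi> x"
  have sw: "smooth_Rn (\<lambda>x. \<phi> x * \<gamma> (\<psi> k x))" for k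
    by (rule smooth_Rn_mult[OF \<phi> \<gamma>s[OF s]])
  have d1: "integrable N (\<lambda>x. (\<psi> k x - v x)\<^sup>2)" for k
    using v by (intro integrable_diff_sq) (auto intro!: smooth_Rn_integrable_sq s)
  have d2: "integrable N (\<lambda>x. (partial i (\<psi> k) x - G x $ i)\<^sup>2)" for k i
    using G by (intro integrable_diff_sq) (auto intro!: smooth_Rn_integrable_sq smooth_Rn_partial s)
  have sqm: "(a * b)\<^sup>2 \<le> K\<^sup>2 * e\<^sup>2" if "\<bar>a\<bar> \<le> K" "\<bar>b\<bar> \<le> \<bar>e\<bar>" for a b K e :: real
  proof -
    have "\<bar>a * b\<bar> \<le> K * \<bar>e\<bar>" unfolding abs_mult using that by (intro mult_mono) auto
    then have "\<bar>a * b\<bar>\<^sup>2 \<le> (K * \<bar>e\<bar>)\<^sup>2" by (rule power_mono) simp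
    then show ?thesis by (simp add: power_mult_distrib)
  qed
  show ?thesis
  proof (rule H10_onI[of _ _ "\<lambda>k x. \<phi> x * \<gamma> (\<psi> k x)"])
    show "Lp_on 2 \<Omega> ?w"
      unfolding Lp_on_2
    proof
      show "integrable N (\<lambda>x. (?w x)\<^sup>2)"
        by (rule Bochner_Integration.integrable_bound[OF integrable_mult_right[OF v(2), of "C\<^sup>2"]])
          (use C \<gamma>b in \<open>auto intro!: AE_I2 sqm\<close>)
    qed measurable
    show "Lp_on 2 \<Omega> (\<lambda>x. ?W x $ i)" for i
      unfolding Lp_on_2
    proof
      have "integrable N (\<lambda>x. 3 * (C\<^sup>2 * (G x $ i)\<^sup>2 + (D i)\<^sup>2 * (v x)\<^sup>2 + 0\<^sup>2))"
        using v(2) G(2)[of i] by simp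
      then show "integrable N (\<lambda>x. (?W x $ i)\<^sup>2)"
      proof (rule Bochner_Integration.integrable_bound)
        have "(?W x $ i)\<^sup>2 \<le> 3 * (C\<^sup>2 * (G x $ i)\<^sup>2 + (D i)\<^sup>2 * (v x)\<^sup>2 + 0\<^sup>2)" if "x \<in> \<Omega>" for x
        proof -
          have "(\<phi> x * (\<gamma>' (v x) * G x $ i))\<^sup>2 \<le> C\<^sup>2 * (G x $ i)\<^sup>2"
            using C(2)[OF that] b[of "v x"] by (intro sqm) (auto simp: abs_mult intro: mult_left_le_one_le)
          moreover have "(partial i \<phi> x * \<gamma> (v x))\<^sup>2 \<le> (D i)\<^sup>2 * (v x)\<^sup>2"
            using D(2)[OF that] \<gamma>b by (intro sqm) auto
          ultimately show ?thesis
            using power2_sum3_le[of "\<phi> x * (\<gamma>' (v x) * G x $ i)" "partial i \<phi> x * \<gamma> (v x)" 0]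
            by (simp add: mult_ac)
        qed
        then show "AE x in N. norm ((?W x $ i)\<^sup>2) \<le> norm (3 * (C\<^sup>2 * (G x $ i)\<^sup>2 + (D i)\<^sup>2 * (v x)\<^sup>2 + 0\<^sup>2))"
          by (intro AE_I2) auto
      qed simp
    qed simp
    show "test_fun \<Omega> (\<lambda>x. \<phi> x * \<gamma> (\<psi> k x))" for k
      by (rule test_fun_subset_support[OF t[of k] sw]) (use \<gamma>0 in auto)
    show "(\<lambda>k. \<integral>x. (\<phi> x * \<gamma> (\<psi> k x) - ?w x)\<^sup>2 \<partial>N) \<longlonglongrightarrow> 0"
    proof (rule tendsto_sandwich[OF _ _ tendsto_const])
      show "(\<lambda>k. C\<^sup>2 * (\<integral>x. (\<psi> k x - v x)\<^sup>2 \<partial>N)) \<longlonglongrightarrow> 0"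
        using tendsto_mult_right_zero[OF c1] by simp
      have *: "(\<phi> x * \<gamma> (\<psi> k x) - ?w x)\<^sup>2 \<le> C\<^sup>2 * (\<psi> k x - v x)\<^sup>2" if "x \<in> \<Omega>" for k x
        using sqm[OF C(2)[OF that] lip] by (simp add: right_diff_distrib)
      have "(\<integral>x. (\<phi> x * \<gamma> (\<psi> k x) - ?w x)\<^sup>2 \<partial>N) \<le> (\<integral>x. C\<^sup>2 * (\<psi> k x - v x)\<^sup>2 \<partial>N)" for k
        by (intro integral_mono_AE' integrable_mult_right d1 AE_I2) (use * in auto)
      then show "\<forall>\<^sub>F k in sequentially. (\<integral>x. (\<phi> x * \<gamma> (\<psi> k x) - ?w x)\<^sup>2 \<partial>N) \<le> C\<^sup>2 * (\<integral>x. (\<psi> k x - v x)\<^sup>2 \<partial>N)"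
        by simp
    qed simp
    fix i
    \<comment> \<open>The three contributions to the gradient error: the error of the approximating
      gradient, the error in the coefficient \<open>\<gamma>'\<close>, and the error in
      \<open>\<gamma>\<close> where the derivative falls on \<open>\<phi>\<close>.\<close>
    let ?R = "\<lambda>k. 3 * (C\<^sup>2 * (\<integral>x. (partial i (\<psi> k) x - G x $ i)\<^sup>2 \<partial>N) +
        C\<^sup>2 * (\<integral>x. ((\<gamma>' (\<psi> k x) - \<gamma>' (v x)) * G x $ i)\<^sup>2 \<partial>N) + (D i)\<^sup>2 * (\<integral>x. (\<psi> k x - v x)\<^sup>2 \<partial>N))"
    have dd: "((\<gamma>' (\<psi> k x) - \<gamma>' (v x)) * G x $ i)\<^sup>2 \<le> 2\<^sup>2 * (G x $ i)\<^sup>2" for k x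
      using b[of "\<psi> k x"] b[of "v x"] by (intro sqm) auto
    have I4: "integrable N (\<lambda>x. 2\<^sup>2 * (G x $ i)\<^sup>2)" using G(2)[of i] by simp
    have d3: "integrable N (\<lambda>x. ((\<gamma>' (\<psi> k x) - \<gamma>' (v x)) * G x $ i)\<^sup>2)" for k
      by (rule Bochner_Integration.integrable_bound[OF I4]) (use dd in auto)
    \<comment> \<open>This term has no rate, as \<open>\<gamma>'\<close> is merely continuous; it
      needs the almost everywhere convergence of \<open>\<psi> k\<close> and the bound on
      \<open>\<gamma>'\<close>.\<close>
    have "(\<lambda>k. \<integral>x. ((\<gamma>' (\<psi> k x) - \<gamma>' (v x)) * G x $ i)\<^sup>2 \<partial>N) \<longlonglongrightarrow> (\<integral>x. 0 \<partial>N)"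
    proof (rule integral_dominated_convergence[OF _ _ I4])
      show "AE x in N. (\<lambda>k. ((\<gamma>' (\<psi> k x) - \<gamma>' (v x)) * G x $ i)\<^sup>2) \<longlonglongrightarrow> 0"
        using ae
      proof eventually_elim
        case (elim x)
        have "(\<lambda>k. \<gamma>' (\<psi> k x)) \<longlonglongrightarrow> \<gamma>' (v x)"
          using continuous_on_tendsto_compose[OF c elim] by simp
        then have "(\<lambda>k. ((\<gamma>' (\<psi> k x) - \<gamma>' (v x)) * G x $ i)\<^sup>2) \<longlonglongrightarrow> ((\<gamma>' (v x) - \<gamma>' (v x)) * G x $ i)\<^sup>2"
          by (intro tendsto_intros)
        then show ?case by simp
      qed
      show "AE x in N. norm (((\<gamma>' (\<psi> k x) - \<gamma>' (v x)) * G x $ i)\<^sup>2) \<le> 2\<^sup>2 * (G x $ i)\<^sup>2" for k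
        using dd by auto
    qed auto
    then have c3: "(\<lambda>k. \<integral>x. ((\<gamma>' (\<psi> k x) - \<gamma>' (v x)) * G x $ i)\<^sup>2 \<partial>N) \<longlonglongrightarrow> 0" by simp
    show "(\<lambda>k. \<integral>x. (partial i (\<lambda>x. \<phi> x * \<gamma> (\<psi> k x)) x - ?W x $ i)\<^sup>2 \<partial>N) \<longlonglongrightarrow> 0"
    proof (rule tendsto_sandwich[OF _ _ tendsto_const])
      have "?R \<longlonglongrightarrow> 3 * (C\<^sup>2 * 0 + C\<^sup>2 * 0 + (D i)\<^sup>2 * 0)"
        by (intro tendsto_intros c1 c2 c3)
      then show "?R \<longlonglongrightarrow> 0" by simp
      have *: "(partial i (\<lambda>x. \<phi> x * \<gamma> (\<psi> k x)) x - ?W x $ i)\<^sup>2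
          \<le> 3 * (C\<^sup>2 * (partial i (\<psi> k) x - G x $ i)\<^sup>2
            + C\<^sup>2 * ((\<gamma>' (\<psi> k x) - \<gamma>' (v x)) * G x $ i)\<^sup>2 + (D i)\<^sup>2 * (\<psi> k x - v x)\<^sup>2)"
        if "x \<in> \<Omega>" for k x
      proof -
        have "partial i (\<lambda>x. \<phi> x * \<gamma> (\<psi> k x)) x = \<phi> x * (\<gamma>' (\<psi> k x) * partial i (\<psi> k) x) + partial i \<phi> x * \<gamma> (\<psi> k x)"
          using partial_mult[where i=i and x=x and f=\<phi> and g="\<lambda>x. \<gamma> (\<psi> k x)",
              OF smooth_Rn_differentiable[OF \<phi>] smooth_Rn_differentiable[OF \<gamma>s[OF s]]]
            partial_compose[where i=i and x=x and f="\<psi> k", OF smooth_Rn_differentiable[OF s] d] by simp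
        then have "partial i (\<lambda>x. \<phi> x * \<gamma> (\<psi> k x)) x - ?W x $ i =
           \<phi> x * (\<gamma>' (\<psi> k x) * (partial i (\<psi> k) x - G x $ i))
           + \<phi> x * ((\<gamma>' (\<psi> k x) - \<gamma>' (v x)) * G x $ i) + partial i \<phi> x * (\<gamma> (\<psi> k x) - \<gamma> (v x))"
          by (simp add: algebra_simps)
        moreover have "(\<phi> x * (\<gamma>' (\<psi> k x) * (partial i (\<psi> k) x - G x $ i)))\<^sup>2 \<le> C\<^sup>2 * (partial i (\<psi> k) x - G x $ i)\<^sup>2"
          using b[of "\<psi> k x"] by (intro sqm C that) (auto simp: abs_mult intro: mult_left_le_one_le)
        moreover have "(\<phi> x * ((\<gamma>' (\<psi> k x) - \<gamma>' (v x)) * G x $ i))\<^sup>2 \<le> C\<^sup>2 * ((\<gamma>' (\<psi> k x) - \<gamma>' (v x)) * G x $ i)\<^sup>2"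
          by (intro sqm C that) auto
        moreover have "(partial i \<phi> x * (\<gamma> (\<psi> k x) - \<gamma> (v x)))\<^sup>2 \<le> (D i)\<^sup>2 * (\<psi> k x - v x)\<^sup>2"
          by (intro sqm D that lip)
        ultimately show ?thesis by (simp only: power2_sum3_le')
      qed
      have "(\<integral>x. (partial i (\<lambda>x. \<phi> x * \<gamma> (\<psi> k x)) x - ?W x $ i)\<^sup>2 \<partial>N) \<le>
        (\<integral>x. 3 * (C\<^sup>2 * (partial i (\<psi> k) x - G x $ i)\<^sup>2
            + C\<^sup>2 * ((\<gamma>' (\<psi> k x) - \<gamma>' (v x)) * G x $ i)\<^sup>2 + (D i)\<^sup>2 * (\<psi> k x - v x)\<^sup>2) \<partial>N)" for k
        by (intro integral_mono_AE' AE_I2 integrable_mult_right Bochner_Integration.integrable_add d1 d2 d3)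
          (use * in auto)
      then show "\<forall>\<^sub>F k in sequentially. (\<integral>x. (partial i (\<lambda>x. \<phi> x * \<gamma> (\<psi> k x)) x - ?W x $ i)\<^sup>2 \<partial>N) \<le> ?R k"
        using d1 d2 d3 by (simp del: vec_lambda_beta)
    qed simp
  qed
qed

end

section \<open>Smooth cut-offs in time\<close>

text \<open>The classical function that is flat at 0, divided by a power. The index closes the
  family under differentiation, so smoothness at 0 reduces to one limit, uniform in form for all
  \<open>n\<close>.\<close>

definition flat :: "nat \<Rightarrow> real \<Rightarrow> real" where
  "flat n x = (if x > 0 then exp (- 1 / x) / x ^ n else 0)"

lemma flat_tendsto_0: "(flat n \<longlongrightarrow> 0) (at 0)"
proof -
  have "((\<lambda>x::real. exp (- 1 / x) / x ^ n) \<longlongrightarrow> 0) (at_right 0)" by real_asymp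
  then have "(flat n \<longlongrightarrow> 0) (at_right 0)"
    by (rule Lim_transform_eventually) (auto simp: eventually_at_right_less flat_def eventually_at intro!: exI[of _ 1])
  moreover have "(flat n \<longlongrightarrow> 0) (at_left 0)"
    by (rule Lim_transform_eventually[OF tendsto_const]) (auto simp: flat_def eventually_at intro!: exI[of _ 1])
  ultimately show ?thesis by (simp add: filterlim_split_at)
qed

lemma DERIV_flat: "(flat n has_real_derivative flat (n + 2) x - real n * flat (n + 1) x) (at x)"
proof -
  consider "x > 0" | "x < 0" | "x = 0" by linarith
  then show ?thesis
  proof cases
    case 1
    have "((\<lambda>x. exp (- 1 / x) / x ^ n) has_real_derivative flat (n + 2) x - real n * flat (n + 1) x) (at x)"
    proof -
      have p: "((\<lambda>x. x ^ n) has_real_derivative real n * (x ^ n / x)) (at x)"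
        using DERIV_pow[of n x UNIV] 1 by (cases n) auto
      have e: "((\<lambda>x. exp (- 1 / x)) has_real_derivative exp (- 1 / x) * (1 / x\<^sup>2)) (at x)"
        using 1 by (auto intro!: derivative_eq_intros simp: power2_eq_square)
      have "(exp (- 1 / x) * (1 / x\<^sup>2) * x ^ n - exp (- 1 / x) * (real n * (x ^ n / x))) / (x ^ n * x ^ n) =
        flat (n + 2) x - real n * flat (n + 1) x"
        using 1 by (simp add: flat_def field_simps power2_eq_square power_add)
      with DERIV_divide[OF e p] 1 show ?thesis by simp
    qed
    then show ?thesis
      by (rule has_field_derivative_transform_within_open[of _ _ _ "{0<..}"]) (use 1 in \<open>auto simp: flat_def\<close>)
  next
    case 2
    have "((\<lambda>_. 0) has_real_derivative flat (n + 2) x - real n * flat (n + 1) x) (at x)"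
      using 2 by (simp add: flat_def)
    then show ?thesis
      by (rule has_field_derivative_transform_within_open[of _ _ _ "{..<0}"]) (use 2 in \<open>auto simp: flat_def\<close>)
  next
    case 3
    \<comment> \<open>The difference quotient of \<open>flat n\<close> at 0 is the next member of
      the family, at \<open>h = 0\<close> too because division by zero gives 0.\<close>
    have "flat (Suc n) = (\<lambda>h. (flat n (0 + h) - flat n 0) / h)"
      by (auto simp: flat_def)
    with flat_tendsto_0[of "Suc n"] have "(flat n has_real_derivative 0) (at 0)"
      unfolding has_field_derivative_iff by simp
    with 3 show ?thesis by (simp add: flat_def)
  qed
qed

text \<open>The analogue of \<open>smooth_term\<close> in the time variable, adapted to the iterates
  of \<open>deriv\<close> that occur in \<open>test_fun1\<close>.\<close>

inductive bump_term :: "(real \<Rightarrow> real) \<Rightarrow> bool" where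
  flat: "bump_term (\<lambda>x. flat n (x - a))"
| flat_rev: "bump_term (\<lambda>x. flat n (b - x))"
| const: "bump_term (\<lambda>_. c)"
| add: "bump_term f \<Longrightarrow> bump_term g \<Longrightarrow> bump_term (\<lambda>x. f x + g x)"
| mult: "bump_term f \<Longrightarrow> bump_term g \<Longrightarrow> bump_term (\<lambda>x. f x * g x)"

lemma bump_term_DERIV:
  "bump_term f \<Longrightarrow> \<exists>f'. bump_term f' \<and> (\<forall>x. (f has_real_derivative f' x) (at x))"
proof (induction rule: bump_term.induct)
  case (flat n a)
  have "((\<lambda>x. flat n (x - a)) has_real_derivative flat (n + 2) (x - a) + (- real n) * flat (n + 1) (x - a)) (at x)" for x
  proof -
    have "((\<lambda>x. x - a) has_real_derivative 1) (at x)" by (auto intro!: derivative_eq_intros)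
    from DERIV_chain2[where f="flat n" and g="\<lambda>x. x - a" and x=x and s=UNIV, OF DERIV_flat this]
    show ?thesis by (simp add: algebra_simps)
  qed
  moreover have "bump_term (\<lambda>x. flat (n + 2) (x - a) + (- real n) * flat (n + 1) (x - a))"
    by (intro bump_term.intros)
  ultimately show ?case by blast
next
  case (flat_rev n b)
  have "((\<lambda>x. flat n (b - x)) has_real_derivative
      (-1) * flat (n + 2) (b - x) + real n * flat (n + 1) (b - x)) (at x)" for x
  proof -
    have "((\<lambda>x. b - x) has_real_derivative -1) (at x)" by (auto intro!: derivative_eq_intros)
    from DERIV_chain2[where f="flat n" and g="\<lambda>x. b - x" and x=x and s=UNIV, OF DERIV_flat this]
    show ?thesis by (simp add: algebra_simps)
  qed
  moreover have "bump_term (\<lambda>x. (-1) * flat (n + 2) (b - x) + real n * flat (n + 1) (b - x))"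
    by (intro bump_term.intros)
  ultimately show ?case by blast
next
  case (const c)
  show ?case by (rule exI[of _ "\<lambda>_. 0"]) (auto intro: bump_term.const)
next
  case (add f g)
  then obtain f' g' where "bump_term f'" "bump_term g'" "\<And>x. (f has_real_derivative f' x) (at x)"
    "\<And>x. (g has_real_derivative g' x) (at x)" by blast
  then show ?case
    by (intro exI[of _ "\<lambda>x. f' x + g' x"]) (auto intro!: bump_term.add derivative_intros)
next
  case (mult f g)
  then obtain f' g' where *: "bump_term f'" "bump_term g'" "\<And>x. (f has_real_derivative f' x) (at x)"
    "\<And>x. (g has_real_derivative g' x) (at x)" by blast
  have "((\<lambda>x. f x * g x) has_real_derivative f' x * g x + g' x * f x) (at x)" for x
    by (rule DERIV_mult) (use * in auto)
  moreover have "bump_term (\<lambda>x. f' x * g x + g' x * f x)"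
    by (intro bump_term.add bump_term.mult * mult.hyps)
  ultimately show ?case by blast
qed

lemma bump_term_deriv_iterate: "bump_term f \<Longrightarrow> bump_term ((deriv ^^ k) f)"
proof (induction k)
  case (Suc k)
  then obtain f' where f': "bump_term f'" "\<forall>x. ((deriv ^^ k) f has_real_derivative f' x) (at x)"
    using bump_term_DERIV by blast
  then have "deriv ((deriv ^^ k) f) = f'" by (auto intro!: ext DERIV_imp_deriv)
  with f' show ?case by simp
qed simp

lemma bump_term_differentiable: "bump_term f \<Longrightarrow> (deriv ^^ k) f differentiable (at x)"
  using bump_term_DERIV[OF bump_term_deriv_iterate] by (meson real_differentiable_def)

lemma bump_term_continuous_on: "bump_term f \<Longrightarrow> continuous_on S f"
  using bump_term_DERIV by (meson DERIV_isCont continuous_at_imp_continuous_on)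

text \<open>The product of a flat function rising at \<open>a\<close> and one falling at
  \<open>b\<close>, divided by its integral. That integral is positive because a continuous
  nonnegative function with zero integral would vanish at the midpoint.\<close>

lemma ex_unit_bump:
  assumes "a < (b::real)"
  obtains r where "bump_term r" "\<And>x. r x \<ge> 0" "\<And>x. x \<le> a \<or> b \<le> x \<Longrightarrow> r x = 0" "integral {a..b} r = 1"
proof -
  define r0 where "r0 x = flat 0 (x - a) * flat 0 (b - x)" for x
  have bt: "bump_term r0" unfolding r0_def by (intro bump_term.intros)
  have r0: "r0 x \<ge> 0" "x \<le> a \<or> b \<le> x \<Longrightarrow> r0 x = 0" "a < x \<Longrightarrow> x < b \<Longrightarrow> r0 x > 0" for x
    by (auto simp: r0_def flat_def)
  have c: "continuous_on {a..b} r0" by (rule bump_term_continuous_on[OF bt])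
  have "integral {a..b} r0 \<noteq> 0"
  proof
    assume "integral {a..b} r0 = 0"
    then have "(r0 has_integral 0) (cbox a b)"
      using integrable_integral[OF integrable_continuous_real[OF c]] by simp
    from has_integral_0_cbox_imp_0[OF _ _ this, of "(a + b) / 2"] c r0 assms
    show False using r0(3)[of "(a + b) / 2"] by (auto simp: field_simps)
  qed
  moreover have "integral {a..b} r0 \<ge> 0"
    by (rule integral_nonneg[OF integrable_continuous_real[OF c]]) (use r0 in auto)
  ultimately have pos: "integral {a..b} r0 > 0" by simp
  define r where "r x = (1 / integral {a..b} r0) * r0 x" for x
  show ?thesis
  proof (rule that[of r])
    show "bump_term r" unfolding r_def by (intro bump_term.mult bump_term.const bt)
    show "integral {a..b} r = 1" unfolding r_def[abs_def] using pos by simp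
  qed (use r0 pos in \<open>auto simp: r_def\<close>)
qed

text \<open>\<open>\<eta>\<close> is the difference of the primitives of two unit bumps, placed just
  after \<open>s\<close> and just after \<open>t\<close>. Thus \<open>deriv \<eta>\<close> is a
  difference of two probability densities, and integrating a function against it compares averages
  near \<open>s\<close> and near \<open>t\<close>.\<close>

lemma ex_cutoff:
  assumes "0 < e" "s + e \<le> t"
  obtains \<eta> r1 r2 where "\<And>a b. a < s \<Longrightarrow> t + e < b \<Longrightarrow> test_fun1 a b \<eta>"
    "\<And>x. 0 \<le> \<eta> x \<and> \<eta> x \<le> 1" "\<And>x. s + e \<le> x \<Longrightarrow> x \<le> t \<Longrightarrow> \<eta> x = 1"
    "\<And>x. x \<le> s \<or> t + e \<le> x \<Longrightarrow> \<eta> x = 0"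
    "\<And>x. deriv \<eta> x = r1 x - r2 x"
    "continuous_on UNIV r1" "\<And>x. r1 x \<ge> 0" "\<And>x. x \<notin> {s..s+e} \<Longrightarrow> r1 x = 0" "integral {s..s+e} r1 = 1"
    "continuous_on UNIV r2" "\<And>x. r2 x \<ge> 0" "\<And>x. x \<notin> {t..t+e} \<Longrightarrow> r2 x = 0" "integral {t..t+e} r2 = 1"
proof -
  obtain r1 where r1: "bump_term r1" "\<And>x. r1 x \<ge> 0" "\<And>x. x \<le> s \<or> s + e \<le> x \<Longrightarrow> r1 x = 0" "integral {s..s+e} r1 = 1"
    using ex_unit_bump[of s "s + e"] assms(1) by (metis less_add_same_cancel1)
  obtain r2 where r2: "bump_term r2" "\<And>x. r2 x \<ge> 0" "\<And>x. x \<le> t \<or> t + e \<le> x \<Longrightarrow> r2 x = 0" "integral {t..t+e} r2 = 1"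
    using ex_unit_bump[of t "t + e"] assms(1) by (metis less_add_same_cancel1)
  note c = bump_term_continuous_on[OF r1(1)] bump_term_continuous_on[OF r2(1)]
  have int: "r1 integrable_on {x..y}" "r2 integrable_on {x..y}" for x y
    by (auto intro!: integrable_continuous_real c)
  \<comment> \<open>The base point lies strictly to the left of both supports, so each primitive
    starts from 0 and is differentiable at \<open>s\<close> as well.\<close>
  define I where "I r x = integral {s - 1..x} r" for r :: "real \<Rightarrow> real" and x
  have I0: "I r x = 0" if "\<And>z. z \<le> a \<or> a + e \<le> z \<Longrightarrow> r z = 0" "x \<le> a" for r a x
  proof -
    have "I r x = integral {s - 1..x} (\<lambda>_. 0)"
      unfolding I_def by (rule Henstock_Kurzweil_Integration.integral_cong) (use that in auto)
    then show ?thesis by simp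
  qed
  have I1: "I r x = 1" if r: "\<And>z. z \<le> a \<or> a + e \<le> z \<Longrightarrow> r z = 0" and x: "a + e \<le> x" and a: "s \<le> a"
      and i: "integral {a..a+e} r = 1" and ri: "\<And>x y. r integrable_on {x..y}" for r a x
  proof -
    have "I r x = I r a + integral {a..x} r"
      unfolding I_def by (rule Henstock_Kurzweil_Integration.integral_combine[symmetric]) (use ri x a assms in auto)
    also have "integral {a..x} r = integral {a..a+e} r + integral {a+e..x} r"
      by (rule Henstock_Kurzweil_Integration.integral_combine[symmetric]) (use ri x assms in auto)
    also have "integral {a+e..x} r = integral {a+e..x} (\<lambda>_. 0)"
      by (rule Henstock_Kurzweil_Integration.integral_cong) (use r in auto)
    finally show ?thesis using I0[of a r a] r i by simp
  qed
  have mono: "0 \<le> I r x \<and> I r x \<le> 1" if r: "\<And>z. z \<le> a \<or> a + e \<le> z \<Longrightarrow> r z = 0" and a: "s \<le> a"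
      and i: "integral {a..a+e} r = 1" and ri: "\<And>x y. r integrable_on {x..y}" and p: "\<And>x. r x \<ge> 0" for r a x
  proof -
    have "0 \<le> I r x" unfolding I_def by (rule Henstock_Kurzweil_Integration.integral_nonneg) (use ri p in auto)
    moreover have "I r x \<le> I r (max x (a + e))"
      unfolding I_def by (rule integral_subset_le) (use ri p in auto)
    moreover have "I r (max x (a + e)) = 1" by (rule I1[of a]) (use that in auto)
    ultimately show ?thesis by simp
  qed
  have DI: "(I r has_real_derivative r x) (at x)" if z: "\<And>z. z \<le> s \<Longrightarrow> r z = 0" and cr: "\<And>S. continuous_on S r" for r x
  proof (cases "x < s")
    case True
    have "((\<lambda>_. 0) has_real_derivative r x) (at x)" using z True by simp
    then show ?thesis
    proof (rule has_field_derivative_transform_within_open[of _ _ _ "{..<s}"])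
      show "0 = I r y" if "y \<in> {..<s}" for y
      proof -
        have "I r y = integral {s - 1..y} (\<lambda>_. 0)"
          unfolding I_def by (rule Henstock_Kurzweil_Integration.integral_cong) (use that z in auto)
        then show ?thesis by simp
      qed
    qed (use True in auto)
  next
    case False
    have "(I r has_real_derivative r x) (at x within {s - 1..x + 1})"
      unfolding I_def
      by (rule integral_has_real_derivative) (use cr False in auto)
    moreover have "x \<in> interior {s - 1..x + 1}" using False by simp
    ultimately show ?thesis using at_within_interior by metis
  qed
  define \<eta> where "\<eta> x = I r1 x - I r2 x" for x
  have d: "(\<eta> has_real_derivative r1 x - r2 x) (at x)" for x
    unfolding \<eta>_def by (intro derivative_intros DI) (use r1 r2 c assms in auto)
  then have der: "deriv \<eta> = (\<lambda>x. r1 x + (-1) * r2 x)" by (auto intro!: ext DERIV_imp_deriv)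
  have zero: "\<eta> x = 0" if "x \<le> s \<or> t + e \<le> x" for x
  proof (cases "x \<le> s")
    case True
    then show ?thesis using I0[of s r1 x] I0[of t r2 x] r1 r2 assms by (simp add: \<eta>_def)
  next
    case False
    with that have "t + e \<le> x" by simp
    then have "I r1 x = 1" "I r2 x = 1"
      using assms by (auto intro!: I1[of s r1 x] I1[of t r2 x] r1 r2 int)
    then show ?thesis by (simp add: \<eta>_def)
  qed
  have bt: "bump_term (\<lambda>x. r1 x + (-1) * r2 x)" by (intro bump_term.add bump_term.mult bump_term.const r1 r2)
  have sm: "(deriv ^^ k) \<eta> differentiable (at x)" for k x
  proof (cases k)
    case 0
    then show ?thesis using d by (auto simp: real_differentiable_def)
  next
    case (Suc m)
    then have "(deriv ^^ k) \<eta> = (deriv ^^ m) (deriv \<eta>)" by (simp only: funpow_Suc_right o_def)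
    then show ?thesis using bump_term_differentiable[OF bt, of m x] by (simp add: der)
  qed
  show ?thesis
  proof (rule that[of \<eta> r1 r2])
    fix a b assume ab: "a < s" "t + e < b"
    have "closure {x. \<eta> x \<noteq> 0} \<subseteq> {s..t+e}"
    proof (rule closure_minimal)
      show "{x. \<eta> x \<noteq> 0} \<subseteq> {s..t+e}"
      proof
        fix x assume "x \<in> {x. \<eta> x \<noteq> 0}"
        then show "x \<in> {s..t+e}" using zero[of x] by (cases "x \<le> s"; cases "t + e \<le> x") auto
      qed
    qed simp
    then have "compact (closure {x. \<eta> x \<noteq> 0})" "closure {x. \<eta> x \<noteq> 0} \<subseteq> {a<..<b}"
      using ab by (auto simp: compact_eq_bounded_closed intro: bounded_subset[OF bounded_closed_interval])
    then show "test_fun1 a b \<eta>" unfolding test_fun1_def using sm by blast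
  next
    fix x
    have m1: "0 \<le> I r1 x \<and> I r1 x \<le> 1" by (rule mono[of s]) (use r1 int in auto)
    have m2: "0 \<le> I r2 x \<and> I r2 x \<le> 1" by (rule mono[of t]) (use r2 int assms in auto)
    show "0 \<le> \<eta> x \<and> \<eta> x \<le> 1"
    proof (cases "x \<le> t")
      case True
      then show ?thesis using m1 I0[of t r2 x] r2 by (simp add: \<eta>_def)
    next
      case False
      have "I r1 x = 1" by (rule I1[of s]) (use False assms r1 int in auto)
      then show ?thesis using m2 by (simp add: \<eta>_def)
    qed
  next
    fix x assume x: "s + e \<le> x" "x \<le> t"
    have "I r1 x = 1" by (rule I1[of s]) (use x assms r1 int in auto)
    moreover have "I r2 x = 0" by (rule I0[of t]) (use x r2 in auto)
    ultimately show "\<eta> x = 1" by (simp add: \<eta>_def)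
  qed (use zero der r1 r2 c in auto)
qed

section \<open>Continuity of time translations\<close>

lemma integrable_shift_real:
  fixes f :: "real \<Rightarrow> real"
  assumes "integrable lborel f"
  shows "integrable lborel (\<lambda>t. f (t - h))" "(\<integral>t. f (t - h) \<partial>lborel) = (\<integral>t. f t \<partial>lborel)"
  using lborel_integrable_real_affine[OF assms, of 1 "-h"] lborel_integral_real_affine[of 1 f "-h"] assms
  by auto

text \<open>The functions with continuous translations form a closed set: by shift invariance the
  error of replacing \<open>f\<close> by \<open>g\<close> is paid twice, once shifted and once
  not.\<close>

lemma translation_L1_approx:
  fixes f :: "real \<Rightarrow> real"
  assumes f: "integrable lborel f" and h: "h \<longlonglongrightarrow> 0"
    and ap: "\<And>e. e > 0 \<Longrightarrow> \<exists>g. integrable lborel g \<and> (\<integral>t. \<bar>f t - g t\<bar> \<partial>lborel) \<le> e \<and>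
        (\<lambda>n. \<integral>t. \<bar>g (t - h n) - g t\<bar> \<partial>lborel) \<longlonglongrightarrow> 0"
  shows "(\<lambda>n::nat. \<integral>t. \<bar>f (t - h n) - f t\<bar> \<partial>lborel) \<longlonglongrightarrow> 0"
proof (rule LIMSEQ_I)
  fix r :: real assume "r > 0"
  then obtain g where g: "integrable lborel g" "(\<integral>t. \<bar>f t - g t\<bar> \<partial>lborel) \<le> r / 4"
    and lim: "(\<lambda>n. \<integral>t. \<bar>g (t - h n) - g t\<bar> \<partial>lborel) \<longlonglongrightarrow> 0" using ap[of "r / 4"] by auto
  from LIMSEQ_D[OF lim, of "r / 4"] \<open>r > 0\<close> obtain n0
    where n0: "\<And>n. n \<ge> n0 \<Longrightarrow> \<bar>\<integral>t. \<bar>g (t - h n) - g t\<bar> \<partial>lborel\<bar> < r / 4" by auto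
  have d: "integrable lborel (\<lambda>t. \<bar>f t - g t\<bar>)" using f g by auto
  note sh = integrable_shift_real[OF d] integrable_shift_real(1)[OF f] integrable_shift_real(1)[OF g(1)]
  have "norm ((\<integral>t. \<bar>f (t - h n) - f t\<bar> \<partial>lborel) - 0) < r" if "n \<ge> n0" for n
  proof -
    have "(\<integral>t. \<bar>f (t - h n) - f t\<bar> \<partial>lborel) \<le>
      (\<integral>t. \<bar>f (t - h n) - g (t - h n)\<bar> + \<bar>g (t - h n) - g t\<bar> + \<bar>f t - g t\<bar> \<partial>lborel)"
      by (rule integral_mono) (use f g(1) sh in auto)
    also have "\<dots> = (\<integral>t. \<bar>f (t - h n) - g (t - h n)\<bar> \<partial>lborel) + (\<integral>t. \<bar>g (t - h n) - g t\<bar> \<partial>lborel) + (\<integral>t. \<bar>f t - g t\<bar> \<partial>lborel)"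
      using f g(1) sh d by (subst Bochner_Integration.integral_add; auto)
    also have "\<dots> < r" using sh(2)[of "h n"] g(2) n0[OF that] \<open>r > 0\<close> by linarith
    finally show ?thesis by (simp add: integral_nonneg_AE)
  qed
  then show "\<exists>no. \<forall>n\<ge>no. norm ((\<integral>t. \<bar>f (t - h n) - f t\<bar> \<partial>lborel) - 0) < r" by blast
qed

text \<open>Both indicators have the same integral, so their distance is twice the integral of the
  positive part \<open>max 0 (?i t - ?i (t - h n))\<close>. That part lives on \<open>U\<close>,
  where openness makes it vanish eventually; nothing has to be known about the boundary of
  \<open>U\<close>, which may have positive measure.\<close>

lemma translation_L1_open:
  fixes U :: "real set"
  assumes U: "open U" "emeasure lborel U < \<infinity>" and h: "h \<longlonglongrightarrow> 0"
  shows "(\<lambda>n::nat. \<integral>t. \<bar>indicator U (t - h n) - indicator U t\<bar> \<partial>lborel) \<longlonglongrightarrow> (0::real)"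
proof -
  let ?i = "indicator U :: real \<Rightarrow> real"
  have [measurable]: "U \<in> sets borel" using U by simp
  have i: "integrable lborel ?i" using U by (intro integrable_real_indicator) auto
  note sh = integrable_shift_real[OF i]
  have eq: "(\<integral>t. \<bar>?i (t - h n) - ?i t\<bar> \<partial>lborel) = 2 * (\<integral>t. max 0 (?i t - ?i (t - h n)) \<partial>lborel)" for n
  proof -
    have "\<bar>?i (t - h n) - ?i t\<bar> = 2 * max 0 (?i t - ?i (t - h n)) + (?i (t - h n) - ?i t)" for t
      by (auto simp: indicator_def)
    then have "(\<integral>t. \<bar>?i (t - h n) - ?i t\<bar> \<partial>lborel) = (\<integral>t. 2 * max 0 (?i t - ?i (t - h n)) + (?i (t - h n) - ?i t) \<partial>lborel)"
      by presburger
    also have "\<dots> = 2 * (\<integral>t. max 0 (?i t - ?i (t - h n)) \<partial>lborel) + ((\<integral>t. ?i (t - h n) \<partial>lborel) - (\<integral>t. ?i t \<partial>lborel))"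
      using i sh(1) by (subst Bochner_Integration.integral_add) auto
    finally show ?thesis using sh(2)[of "h n"] by simp
  qed
  have "(\<lambda>n. \<integral>t. max 0 (?i t - ?i (t - h n)) \<partial>lborel) \<longlonglongrightarrow> (\<integral>t. 0 \<partial>(lborel::real measure))"
  proof (rule integral_dominated_convergence[OF _ _ i])
    show "AE t in lborel. (\<lambda>n. max 0 (?i t - ?i (t - h n))) \<longlonglongrightarrow> 0"
    proof (rule always_eventually, rule allI)
      fix t
      show "(\<lambda>n. max 0 (?i t - ?i (t - h n))) \<longlonglongrightarrow> 0"
      proof (cases "t \<in> U")
        case True
        have "(\<lambda>n. t - h n) \<longlonglongrightarrow> t - 0" by (intro tendsto_intros h)
        then have "\<forall>\<^sub>F n in sequentially. t - h n \<in> U"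
          using topological_tendstoD[of "\<lambda>n. t - h n" t sequentially U] U True by simp
        then show ?thesis
          by (intro tendsto_eventually) (auto elim!: eventually_mono simp: indicator_def)
      next
        case False
        then show ?thesis by (intro tendsto_eventually) (auto simp: indicator_def)
      qed
    qed
    show "AE t in lborel. norm (max 0 (?i t - ?i (t - h n))) \<le> ?i t" for n
      by (auto simp: indicator_def)
  qed auto
  from tendsto_mult_left[OF this, of 2] show ?thesis unfolding eq by simp
qed

text \<open>Outer regularity passes from open sets to Borel sets, linearity to simple functions, and
  density to all integrable functions.\<close>

lemma translation_L1:
  fixes f :: "real \<Rightarrow> real"
  assumes "integrable lborel f" and h: "h \<longlonglongrightarrow> 0"
  shows "(\<lambda>n::nat. \<integral>t. \<bar>f (t - h n) - f t\<bar> \<partial>lborel) \<longlonglongrightarrow> 0"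
  using assms(1)
proof (induction rule: integrable_induct)
  case (base A c)
  have iA: "integrable lborel (indicator A :: real \<Rightarrow> real)"
    using base by (intro integrable_real_indicator) auto
  have "(\<lambda>n. \<integral>t. \<bar>indicator A (t - h n) - indicator A t\<bar> \<partial>lborel) \<longlonglongrightarrow> (0::real)"
  proof (rule translation_L1_approx[OF iA h])
    fix e :: real assume "e > 0"
    with outer_regular_lborel[of A e] base obtain U where U: "open U" "A \<subseteq> U" "emeasure lborel (U - A) < ennreal e"
      by auto
    have Us [measurable]: "U \<in> sets lborel" "A \<in> sets lborel" using U base by auto
    have "emeasure lborel U = emeasure lborel A + emeasure lborel (U - A)"
      using U(2) Us by (subst plus_emeasure) (auto simp: Un_absorb1 simp del: sets_lborel)
    also have "\<dots> < \<infinity>" using base U(3) by (auto simp: less_top[symmetric] top_unique)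
    finally have Uf: "emeasure lborel U < \<infinity>" .
    have iU: "integrable lborel (indicator U :: real \<Rightarrow> real)"
      using Uf Us by (intro integrable_real_indicator) auto
    have "(\<integral>t. \<bar>indicator A t - indicator U t\<bar> \<partial>lborel) = (\<integral>t. indicator (U - A) t \<partial>lborel :: real)"
      by (intro Bochner_Integration.integral_cong) (use U in \<open>auto simp: indicator_def\<close>)
    also have "\<dots> = measure lborel (U - A)" by simp
    also have "\<dots> \<le> e"
      using U(3) \<open>e > 0\<close> unfolding measure_def by (intro enn2real_leI) auto
    finally have "(\<integral>t. \<bar>indicator A t - indicator U t\<bar> \<partial>lborel) \<le> e" .
    with iU translation_L1_open[OF U(1) Uf h]
    show "\<exists>g. integrable lborel g \<and> (\<integral>t. \<bar>indicator A t - g t\<bar> \<partial>lborel) \<le> e \<and>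
        (\<lambda>n. \<integral>t. \<bar>g (t - h n) - g t\<bar> \<partial>lborel) \<longlonglongrightarrow> 0" by blast
  qed
  from tendsto_mult_left[OF this, of "\<bar>c\<bar>"]
  have "(\<lambda>n. \<integral>t. \<bar>c\<bar> * \<bar>indicator A (t - h n) - indicator A t\<bar> \<partial>lborel) \<longlonglongrightarrow> 0" by simp
  moreover have "\<bar>c\<bar> * \<bar>indicator A (t - h n) - indicator A t\<bar> = \<bar>indicator A (t - h n) *\<^sub>R c - indicator A t *\<^sub>R c\<bar>" for t n
    by (simp add: abs_mult[symmetric] algebra_simps)
  ultimately show ?case by simp
next
  case (add f g)
  note sh = integrable_shift_real(1)[OF add.hyps(1)] integrable_shift_real(1)[OF add.hyps(2)]
  show ?case
  proof (rule tendsto_sandwich[OF _ _ tendsto_const])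
    show "(\<lambda>n. (\<integral>t. \<bar>f (t - h n) - f t\<bar> \<partial>lborel) + (\<integral>t. \<bar>g (t - h n) - g t\<bar> \<partial>lborel)) \<longlonglongrightarrow> 0"
      using tendsto_add[OF add.IH] by simp
    have "(\<integral>t. \<bar>f (t - h n) + g (t - h n) - (f t + g t)\<bar> \<partial>lborel) \<le>
      (\<integral>t. \<bar>f (t - h n) - f t\<bar> + \<bar>g (t - h n) - g t\<bar> \<partial>lborel)" for n
      by (rule integral_mono) (use add sh in auto)
    then show "\<forall>\<^sub>F n in sequentially. (\<integral>t. \<bar>f (t - h n) + g (t - h n) - (f t + g t)\<bar> \<partial>lborel) \<le>
      (\<integral>t. \<bar>f (t - h n) - f t\<bar> \<partial>lborel) + (\<integral>t. \<bar>g (t - h n) - g t\<bar> \<partial>lborel)"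
      using add sh by simp
  qed (auto intro!: integral_nonneg_AE)
next
  case (lim f s)
  show ?case
  proof (rule translation_L1_approx[OF lim.hyps(4) h])
    fix e :: real assume e: "e > 0"
    have "(\<lambda>i. \<integral>t. \<bar>f t - s i t\<bar> \<partial>lborel) \<longlonglongrightarrow> (\<integral>t. 0 \<partial>(lborel::real measure))"
    \<comment> \<open>The induction rule supplies approximants bounded by twice the absolute value
      of \<open>f\<close>, whence the factor 3 for the difference.\<close>
    proof (rule integral_dominated_convergence[where w="\<lambda>t. 3 * \<bar>f t\<bar>"])
      show "AE t in lborel. (\<lambda>i. \<bar>f t - s i t\<bar>) \<longlonglongrightarrow> 0"
      proof (rule always_eventually, rule allI)
        fix t
        have "(\<lambda>i. \<bar>f t - s i t\<bar>) \<longlonglongrightarrow> \<bar>f t - f t\<bar>" using lim.hyps(2)[of t] by (intro tendsto_intros) auto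
        then show "(\<lambda>i. \<bar>f t - s i t\<bar>) \<longlonglongrightarrow> 0" by simp
      qed
      show "AE t in lborel. norm \<bar>f t - s i t\<bar> \<le> 3 * \<bar>f t\<bar>" for i
      proof (rule always_eventually, rule allI)
        fix t show "norm \<bar>f t - s i t\<bar> \<le> 3 * \<bar>f t\<bar>" using lim.hyps(3)[of t i] by simp
      qed
    qed (use lim in auto)
    then have "(\<lambda>i. \<integral>t. \<bar>f t - s i t\<bar> \<partial>lborel) \<longlonglongrightarrow> 0" by simp
    then have "\<forall>\<^sub>F i in sequentially. (\<integral>t. \<bar>f t - s i t\<bar> \<partial>lborel) < e" using e by (auto dest: order_tendstoD(2))
    then obtain i where "(\<integral>t. \<bar>f t - s i t\<bar> \<partial>lborel) < e" by (auto simp: eventually_sequentially)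
    then show "\<exists>g. integrable lborel g \<and> (\<integral>t. \<bar>f t - g t\<bar> \<partial>lborel) \<le> e \<and>
        (\<lambda>n. \<integral>t. \<bar>g (t - h n) - g t\<bar> \<partial>lborel) \<longlonglongrightarrow> 0" using lim.hyps(1) lim.IH by (intro exI[of _ "s i"]) auto
  qed
qed

section \<open>Translations in time on products of the time axis with a measure space\<close>

context sigma_finite_measure
begin

lemma pair_sigma_finite_time: "pair_sigma_finite lborel M"
  by (simp add: pair_sigma_finite_def lborel.sigma_finite_measure_axioms sigma_finite_measure_axioms)

lemma distr_time_shift:
  "distr (lborel \<Otimes>\<^sub>M M) (lborel \<Otimes>\<^sub>M M) (\<lambda>z. (fst z - h, snd z)) = (lborel :: real measure) \<Otimes>\<^sub>M M"
proof (rule measure_eqI)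
  interpret P: pair_sigma_finite "lborel :: real measure" M by (rule pair_sigma_finite_time)
  fix A assume "A \<in> sets (distr (lborel \<Otimes>\<^sub>M M) (lborel \<Otimes>\<^sub>M M) (\<lambda>z. (fst z - h, snd z)))"
  then have A: "A \<in> sets (lborel \<Otimes>\<^sub>M M)" by simp
  moreover have "sets ((lborel :: real measure) \<Otimes>\<^sub>M M) = sets (borel \<Otimes>\<^sub>M M)"
    by (rule sets_pair_measure_cong) simp_all
  ultimately have [measurable]: "A \<in> sets (lborel \<Otimes>\<^sub>M M)" "A \<in> sets (borel \<Otimes>\<^sub>M M)" by auto
  have mt: "(\<lambda>z. (fst z - h, snd z)) \<in> (lborel \<Otimes>\<^sub>M M) \<rightarrow>\<^sub>M (lborel \<Otimes>\<^sub>M M)" by measurable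
  define E where "E t = (\<integral>\<^sup>+x. indicator A (t, x) \<partial>M)" for t
  have [measurable]: "E \<in> borel_measurable borel"
    unfolding E_def by measurable
  have "emeasure (distr (lborel \<Otimes>\<^sub>M M) (lborel \<Otimes>\<^sub>M M) (\<lambda>z. (fst z - h, snd z))) A
     = (\<integral>\<^sup>+z. indicator A z \<partial>distr (lborel \<Otimes>\<^sub>M M) (lborel \<Otimes>\<^sub>M M) (\<lambda>z. (fst z - h, snd z)))"
    by (rule nn_integral_indicator[symmetric]) simp
  also have "\<dots> = (\<integral>\<^sup>+z. indicator A (fst z - h, snd z) \<partial>(lborel \<Otimes>\<^sub>M M))"
    by (rule nn_integral_distr[OF mt]) measurable
  also have "\<dots> = (\<integral>\<^sup>+t. E (t - h) \<partial>lborel)"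
    unfolding E_def by (subst nn_integral_fst[symmetric]) simp_all
  also have "\<dots> = (\<integral>\<^sup>+t. E t \<partial>lborel)"
    using nn_integral_real_affine[of E 1 "-h"] by simp
  also have "\<dots> = emeasure (lborel \<Otimes>\<^sub>M M) A"
    unfolding E_def by (subst nn_integral_fst) simp_all
  finally show "emeasure (distr (lborel \<Otimes>\<^sub>M M) (lborel \<Otimes>\<^sub>M M) (\<lambda>z. (fst z - h, snd z))) A = emeasure (lborel \<Otimes>\<^sub>M M) A" .
qed simp

lemma integrable_time_shift:
  fixes F :: "real \<times> 'a \<Rightarrow> real"
  assumes "integrable (lborel \<Otimes>\<^sub>M M) F"
  shows "integrable (lborel \<Otimes>\<^sub>M M) (\<lambda>z. F (fst z - h, snd z))"
    "(\<integral>z. F (fst z - h, snd z) \<partial>(lborel \<Otimes>\<^sub>M M)) = (\<integral>z. F z \<partial>(lborel \<Otimes>\<^sub>M M))"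
proof -
  have mt: "(\<lambda>z. (fst z - h, snd z)) \<in> (lborel \<Otimes>\<^sub>M M) \<rightarrow>\<^sub>M (lborel \<Otimes>\<^sub>M M)" by measurable
  have mF: "F \<in> borel_measurable (lborel \<Otimes>\<^sub>M M)" using assms by simp
  show "integrable (lborel \<Otimes>\<^sub>M M) (\<lambda>z. F (fst z - h, snd z))"
    using integrable_distr[OF mt, of F] assms unfolding distr_time_shift by simp
  show "(\<integral>z. F (fst z - h, snd z) \<partial>(lborel \<Otimes>\<^sub>M M)) = (\<integral>z. F z \<partial>(lborel \<Otimes>\<^sub>M M))"
    using integral_distr[OF mt mF] unfolding distr_time_shift by simp
qed

text \<open>The one-dimensional statement holds on the time line through almost every
  \<open>x\<close>. Twice the integral of the absolute value over that line dominates, so the limit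
  passes under the integral in \<open>x\<close>.\<close>

lemma time_translation_L1:
  fixes F :: "real \<times> 'a \<Rightarrow> real"
  assumes F: "integrable (lborel \<Otimes>\<^sub>M M) F" and h: "h \<longlonglongrightarrow> 0"
  shows "(\<lambda>n::nat. \<integral>z. \<bar>F (fst z - h n, snd z) - F z\<bar> \<partial>(lborel \<Otimes>\<^sub>M M)) \<longlonglongrightarrow> 0"
proof -
  interpret P: pair_sigma_finite "lborel :: real measure" M by (rule pair_sigma_finite_time)
  have [measurable]: "F \<in> borel_measurable (lborel \<Otimes>\<^sub>M M)" using F by simp
  define k where "k n x = (\<integral>t. \<bar>F (t - h n, x) - F (t, x)\<bar> \<partial>lborel)" for n x
  have iD: "integrable (lborel \<Otimes>\<^sub>M M) (\<lambda>z. \<bar>F (fst z - h n, snd z) - F z\<bar>)" for n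
    using F integrable_time_shift(1)[OF F] by auto
  have iD': "integrable (lborel \<Otimes>\<^sub>M M) (\<lambda>(t, x). \<bar>F (t - h n, x) - F (t, x)\<bar>)" for n
    using iD[of n] by (simp add: split_beta')
  have iA: "integrable (lborel \<Otimes>\<^sub>M M) (\<lambda>(t, x). \<bar>F (t, x)\<bar>)" using F by (simp add: split_beta')
  have eq: "(\<integral>z. \<bar>F (fst z - h n, snd z) - F z\<bar> \<partial>(lborel \<Otimes>\<^sub>M M)) = (\<integral>x. k n x \<partial>M)" for n
    unfolding k_def P.integral_snd[OF iD'] by (simp add: split_beta')
  have Fx: "AE x in M. integrable lborel (\<lambda>t. F (t, x))"
    using P.AE_integrable_snd[of "\<lambda>t x. F (t, x)"] F by simp
  have "(\<lambda>n. \<integral>x. k n x \<partial>M) \<longlonglongrightarrow> (\<integral>x. 0 \<partial>M)"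
  proof (rule integral_dominated_convergence[where w="\<lambda>x. 2 * (\<integral>t. \<bar>F (t, x)\<bar> \<partial>lborel)"])
    show "integrable M (\<lambda>x. 2 * (\<integral>t. \<bar>F (t, x)\<bar> \<partial>lborel))"
      using P.integrable_snd[OF iA] by simp
    show "(\<lambda>x. k n x) \<in> borel_measurable M" for n
      unfolding k_def using P.integrable_snd[OF iD', of n] by simp
    show "AE x in M. (\<lambda>n. k n x) \<longlonglongrightarrow> 0"
      using Fx unfolding k_def by eventually_elim (rule translation_L1[OF _ h])
    show "AE x in M. norm (k n x) \<le> 2 * (\<integral>t. \<bar>F (t, x)\<bar> \<partial>lborel)" for n
      using Fx
    proof eventually_elim
      case (elim x)
      have e': "integrable lborel (\<lambda>t. \<bar>F (t, x)\<bar>)" using elim by simp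
      note sh = integrable_shift_real[OF elim] integrable_shift_real[OF e']
      have "k n x \<le> (\<integral>t. \<bar>F (t - h n, x)\<bar> + \<bar>F (t, x)\<bar> \<partial>lborel)"
        unfolding k_def by (rule integral_mono) (use elim sh in auto)
      also have "\<dots> = 2 * (\<integral>t. \<bar>F (t, x)\<bar> \<partial>lborel)" using e' sh(3,4)[of "h n"] by simp
      finally show ?case by (simp add: k_def integral_nonneg_AE)
    qed
  qed simp
  then show ?thesis unfolding eq by simp
qed

lemma time_translation_L2:
  fixes F :: "real \<times> 'a \<Rightarrow> real"
  assumes [measurable]: "F \<in> borel_measurable (lborel \<Otimes>\<^sub>M M)"
    and F: "integrable (lborel \<Otimes>\<^sub>M M) (\<lambda>z. (F z)\<^sup>2)" and h: "h \<longlonglongrightarrow> 0"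
  shows "integrable (lborel \<Otimes>\<^sub>M M) (\<lambda>z. (F (fst z - h n, snd z) - F z)\<^sup>2)"
    "(\<lambda>n::nat. \<integral>z. (F (fst z - h n, snd z) - F z)\<^sup>2 \<partial>(lborel \<Otimes>\<^sub>M M)) \<longlonglongrightarrow> 0"
proof -
  \<comment> \<open>The signed square \<open>F * \<bar>F\<bar>\<close> reduces the claim to continuity of translations in \<open>L\<^sup>1\<close>.\<close>
  have S: "integrable (lborel \<Otimes>\<^sub>M M) (\<lambda>z. F z * \<bar>F z\<bar>)"
    by (rule Bochner_Integration.integrable_bound[OF F]) (auto simp: abs_mult power2_eq_square)
  \<comment> \<open>For equal signs the right side without the factor 2 suffices, being the
    difference of the squares; the factor pays for opposite signs, where the signed squares add
    up.\<close>
  have le: "(a - b)\<^sup>2 \<le> 2 * \<bar>a * \<bar>a\<bar> - b * \<bar>b\<bar>\<bar>" for a b :: real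
  proof -
    have same: "(a - b)\<^sup>2 \<le> a\<^sup>2 - b\<^sup>2" if "0 \<le> b" "b \<le> a" for a b :: real
      using mult_left_mono[OF that(2,1)] by (simp add: power2_eq_square algebra_simps)
    have opp: "(a - b)\<^sup>2 \<le> 2 * (a\<^sup>2 + b\<^sup>2)"
      using zero_le_power2[of "a + b"] by (simp add: power2_eq_square algebra_simps)
    consider "0 \<le> b" "b \<le> a" | "0 \<le> a" "a \<le> b" | "b \<le> 0" "a \<le> b" | "a \<le> 0" "b \<le> a" | "a \<le> 0" "0 \<le> b" | "0 \<le> a" "b \<le> 0"
      by linarith
    then show ?thesis
    proof cases
      case 1 then show ?thesis using same[of b a] power_mono[of b a 2] by (simp add: power2_eq_square)
    next
      case 2 then show ?thesis using same[of a b] power_mono[of a b 2] by (simp add: power2_eq_square algebra_simps)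
    next
      case 3 then show ?thesis using same[of "-b" "-a"] power_mono[of "-b" "-a" 2] by (simp add: power2_eq_square algebra_simps)
    next
      case 4 then show ?thesis using same[of "-a" "-b"] power_mono[of "-a" "-b" 2] by (simp add: power2_eq_square algebra_simps)
    next
      case 5 then show ?thesis using opp zero_le_square[of a] zero_le_square[of b] by (simp add: power2_eq_square)
    next
      case 6 then show ?thesis using opp zero_le_square[of a] zero_le_square[of b] by (simp add: power2_eq_square)
    qed
  qed
  have i2: "integrable (lborel \<Otimes>\<^sub>M M) (\<lambda>z. 2 * \<bar>F (fst z - h n, snd z) * \<bar>F (fst z - h n, snd z)\<bar> - F z * \<bar>F z\<bar>\<bar>)" for n
    using integrable_time_shift(1)[OF S, of "h n"] S by auto
  show *: "integrable (lborel \<Otimes>\<^sub>M M) (\<lambda>z. (F (fst z - h n, snd z) - F z)\<^sup>2)" for n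
    by (rule Bochner_Integration.integrable_bound[OF i2[of n]]) (use le in auto)
  show "(\<lambda>n. \<integral>z. (F (fst z - h n, snd z) - F z)\<^sup>2 \<partial>(lborel \<Otimes>\<^sub>M M)) \<longlonglongrightarrow> 0"
  proof (rule tendsto_sandwich[OF _ _ tendsto_const])
    show "(\<lambda>n. 2 * (\<integral>z. \<bar>F (fst z - h n, snd z) * \<bar>F (fst z - h n, snd z)\<bar> - F z * \<bar>F z\<bar>\<bar> \<partial>(lborel \<Otimes>\<^sub>M M))) \<longlonglongrightarrow> 0"
      using tendsto_mult_left[OF time_translation_L1[OF S h], of 2] by simp
    have "(\<integral>z. (F (fst z - h n, snd z) - F z)\<^sup>2 \<partial>(lborel \<Otimes>\<^sub>M M)) \<le>
      (\<integral>z. 2 * \<bar>F (fst z - h n, snd z) * \<bar>F (fst z - h n, snd z)\<bar> - F z * \<bar>F z\<bar>\<bar> \<partial>(lborel \<Otimes>\<^sub>M M))" for n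
      by (rule integral_mono[OF * i2]) (rule le)
    then show "\<forall>\<^sub>F n in sequentially. (\<integral>z. (F (fst z - h n, snd z) - F z)\<^sup>2 \<partial>(lborel \<Otimes>\<^sub>M M)) \<le>
      2 * (\<integral>z. \<bar>F (fst z - h n, snd z) * \<bar>F (fst z - h n, snd z)\<bar> - F z * \<bar>F z\<bar>\<bar> \<partial>(lborel \<Otimes>\<^sub>M M))" by simp
  qed (auto intro!: integral_nonneg_AE)
qed

end

section \<open>Weak time derivatives\<close>

lemma (in complete_measure) borel_measurable_AE_eq:
  fixes f g :: "'a \<Rightarrow> real"
  assumes g: "g \<in> borel_measurable M" and ae: "AE x in M. f x = g x"
  shows "f \<in> borel_measurable M"
proof (rule borel_measurableI)
  fix S :: "real set" assume "open S"
  then have "g -` S \<inter> space M \<in> sets M" using g by (intro measurable_sets[OF g]) simp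
  then show "f -` S \<inter> space M \<in> sets M"
    by (rule in_sets_AE[rotated]) (use ae in \<open>auto elim!: eventually_mono\<close>)
qed

text \<open>Exchanges an integrand for a Borel representative and the completed measure for
  \<open>lborel\<close>. Measurability of \<open>f\<close> on \<open>S\<close> comes from
  completeness.\<close>

lemma integral_lebesgue_on_AE_eq:
  fixes f g :: "'a::euclidean_space \<Rightarrow> real"
  assumes g [measurable]: "g \<in> borel_measurable borel" and S [measurable]: "S \<in> sets borel"
    and ae: "AE x in lborel. x \<in> S \<longrightarrow> f x = g x"
  shows "(\<integral>x. f x \<partial>lebesgue_on S) = (\<integral>x. indicator S x * g x \<partial>lborel)"
    "integrable (lebesgue_on S) f \<longleftrightarrow> integrable lborel (\<lambda>x. indicator S x * g x)"
proof -
  let ?k = "\<lambda>x. indicator S x * f x" and ?h = "\<lambda>x. indicator S x * g x"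
  have h: "?h \<in> borel_measurable lborel" by measurable
  have ae': "AE x in lebesgue. ?k x = ?h x"
    by (rule AE_completion) (use ae in \<open>auto elim!: eventually_mono simp: indicator_def\<close>)
  have h': "?h \<in> borel_measurable lebesgue" by (rule measurable_completion[OF h])
  have k: "?k \<in> borel_measurable lebesgue"
    by (rule completion.borel_measurable_AE_eq[OF h' ae'])
  have Sl: "S \<inter> space lebesgue \<in> sets lebesgue" using S by simp
  have "(\<integral>x. f x \<partial>lebesgue_on S) = (\<integral>x. ?k x \<partial>lebesgue)"
    by (subst integral_restrict_space[OF Sl]) simp
  also have "\<dots> = (\<integral>x. ?h x \<partial>lebesgue)" by (rule integral_cong_AE[OF k h' ae'])
  also have "\<dots> = (\<integral>x. ?h x \<partial>lborel)" by (rule integral_completion[OF h])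
  finally show "(\<integral>x. f x \<partial>lebesgue_on S) = (\<integral>x. ?h x \<partial>lborel)" .
  have "integrable (lebesgue_on S) f \<longleftrightarrow> integrable lebesgue ?k"
    by (subst integrable_restrict_space[OF Sl]) simp
  also have "\<dots> \<longleftrightarrow> integrable lebesgue ?h" by (rule integrable_cong_AE[OF k h' ae'])
  also have "\<dots> \<longleftrightarrow> integrable lborel ?h" by (rule integrable_completion[OF h])
  finally show "integrable (lebesgue_on S) f \<longleftrightarrow> integrable lborel ?h" .
qed

text \<open>\<open>r\<close> is a probability density on the interval, so an average against it
  differs from \<open>m s\<close> by no more than the oscillation of \<open>m\<close> there.\<close>

lemma bump_average:
  fixes m r :: "real \<Rightarrow> real"
  assumes e: "0 < e" and m: "continuous_on {s..s+e} m" and r: "continuous_on UNIV r" "\<And>x. r x \<ge> 0"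
    "\<And>x. x \<notin> {s..s+e} \<Longrightarrow> r x = 0" "integral {s..s+e} r = 1"
    and d: "\<And>x. x \<in> {s..s+e} \<Longrightarrow> \<bar>m x - m s\<bar> \<le> d"
  shows "integrable lborel (\<lambda>x. m x * r x)" "\<bar>(\<integral>x. m x * r x \<partial>lborel) - m s\<bar> \<le> d"
proof -
  have I: "integrable lborel k \<and> (\<integral>x. k x \<partial>lborel) = integral {s..s+e} k"
    if c: "continuous_on {s..s+e} k" and z: "\<And>x. x \<notin> {s..s+e} \<Longrightarrow> k x = 0" for k :: "real \<Rightarrow> real"
  proof -
    have "set_integrable lborel {s..s+e} k" by (rule borel_integrable_atLeastAtMost'[OF c])
    moreover have "(\<lambda>x. indicator {s..s+e} x *\<^sub>R k x) = k"
    proof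
      fix x show "indicator {s..s+e} x *\<^sub>R k x = k x" using z[of x] by (cases "x \<in> {s..s+e}") auto
    qed
    ultimately show ?thesis
      using set_borel_integral_eq_integral(2)[of "{s..s+e}" k]
      by (simp add: set_integrable_def set_lebesgue_integral_def)
  qed
  have cr: "continuous_on {s..s+e} r" using r(1) continuous_on_subset by blast
  have 1: "integrable lborel (\<lambda>x. m x * r x)"
    by (rule I[THEN conjunct1]) (use m cr r in \<open>auto intro!: continuous_intros\<close>)
  have 2: "integrable lborel r" "(\<integral>x. r x \<partial>lborel) = 1" using I[OF cr] r by auto
  show "integrable lborel (\<lambda>x. m x * r x)" by (rule 1)
  have "(\<integral>x. m x * r x \<partial>lborel) - m s = (\<integral>x. m x * r x - m s * r x \<partial>lborel)"
    using 1 2 by simp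
  also have "\<bar>\<dots>\<bar> \<le> (\<integral>x. d * r x \<partial>lborel)"
  proof (rule integral_abs_bound[THEN order_trans], rule integral_mono)
    show "\<bar>m x * r x - m s * r x\<bar> \<le> d * r x" for x
      using d[of x] r(2)[of x] r(3)[of x]
      by (cases "x \<in> {s..s+e}") (auto simp: left_diff_distrib[symmetric] abs_mult mult_right_mono)
  qed (use 1 2 in auto)
  also have "\<dots> = d" using 2 by simp
  finally show "\<bar>(\<integral>x. m x * r x \<partial>lborel) - m s\<bar> \<le> d" .
qed

text \<open>Tests with a cut-off of \<open>(s, t]\<close> whose ramps have length
  \<open>e n\<close>. The derivative of the cut-off produces averages of \<open>m\<close> just after
  \<open>s\<close> and just after \<open>t\<close>, each within \<open>d\<close> of the point value;
  on the other side the cut-off differs from the indicator of \<open>(s, t]\<close> only on the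
  ramps, where the mass of \<open>A\<close> tends to 0.\<close>

lemma weak_derivative_FTC:
  fixes m A \<alpha> :: "real \<Rightarrow> real"
  assumes m: "continuous_on {0<..<T} m" and A: "integrable lborel A"
    and ae: "AE t in lborel. t \<in> {0<..<T} \<longrightarrow> \<alpha> t = A t"
    and weak: "\<And>\<eta>. test_fun1 0 T \<eta> \<Longrightarrow>
      - (\<integral>t. m t * deriv \<eta> t \<partial>lebesgue_on {0<..<T}) + (\<integral>t. \<alpha> t * \<eta> t \<partial>lebesgue_on {0<..<T}) = 0"
    and st: "0 < s" "s < t" "t < T"
  shows "m t - m s = - (\<integral>r. indicator {s<..t} r * A r \<partial>lborel)"
proof -
  have [measurable]: "A \<in> borel_measurable borel" using A by simp
  let ?X = "m t - m s + (\<integral>r. indicator {s<..t} r * A r \<partial>lborel)"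
  \<comment> \<open>The divisor is at least 2, so already the first ramps fit: the one at
    \<open>s\<close> ends before \<open>t\<close>, the one at \<open>t\<close> ends before
    \<open>T\<close>.\<close>
  define e where "e n = min (t - s) (T - t) / real (n + 2)" for n
  have e: "0 < e n" "s + e n \<le> t" "t + e n < T" for n
  proof -
    have mp: "min (t - s) (T - t) > 0" using st by simp
    then show "0 < e n" by (simp add: e_def)
    have "e n < min (t - s) (T - t)"
      unfolding e_def using divide_strict_left_mono[OF _ mp, of 1 "real (n + 2)"] by simp
    then show "s + e n \<le> t" "t + e n < T" by auto
  qed
  have e0: "e \<longlonglongrightarrow> 0" unfolding e_def by real_asymp
  \<comment> \<open>Open on the left, so that every point, \<open>s\<close> and \<open>t\<close>
    included, leaves the ramps eventually.\<close>
  let ?B = "\<lambda>n. {s<..s+e n} \<union> {t<..t+e n}"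
  define b where "b n = (\<integral>r. indicator (?B n) r * \<bar>A r\<bar> \<partial>lborel)" for n
  have iA: "integrable lborel (\<lambda>r. indicator S r * \<bar>A r\<bar>)" if "S \<in> sets borel" for S
    by (rule Bochner_Integration.integrable_bound[OF A]) (use that in \<open>auto simp: indicator_def\<close>)
  have "b \<longlonglongrightarrow> (\<integral>r. 0 \<partial>(lborel :: real measure))"
    unfolding b_def
  proof (rule integral_dominated_convergence[where w="\<lambda>r. \<bar>A r\<bar>"])
    show "AE r in lborel. (\<lambda>n. indicator (?B n) r * \<bar>A r\<bar>) \<longlonglongrightarrow> 0"
    proof (rule always_eventually, rule allI)
      fix r
      have "\<forall>\<^sub>F n in sequentially. r \<notin> ?B n"
      proof -
        have *: "\<forall>\<^sub>F n in sequentially. r \<notin> {x<..x+e n}" for x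
        proof (cases "x < r")
          case True
          then have "\<forall>\<^sub>F n in sequentially. e n < r - x" using e0 by (intro order_tendstoD(2)[OF e0]) simp
          then show ?thesis by eventually_elim auto
        qed simp
        show ?thesis using *[of s] *[of t] by eventually_elim auto
      qed
      then show "(\<lambda>n. indicator (?B n) r * \<bar>A r\<bar>) \<longlonglongrightarrow> 0"
        by (intro tendsto_eventually) (auto elim!: eventually_mono simp: indicator_def)
    qed
    show "AE r in lborel. norm (indicator (?B n) r * \<bar>A r\<bar>) \<le> \<bar>A r\<bar>" for n
      by (auto simp: indicator_def)
  qed (use A in auto)
  then have b0: "b \<longlonglongrightarrow> 0" by simp
  have main: "\<bar>?X\<bar> \<le> 2 * d + b n"
    if ds: "\<And>x. x \<in> {s..s+e n} \<Longrightarrow> \<bar>m x - m s\<bar> \<le> d" and dt: "\<And>x. x \<in> {t..t+e n} \<Longrightarrow> \<bar>m x - m t\<bar> \<le> d" for n d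
  proof -
    obtain \<eta> r1 r2 where \<eta>: "\<And>a b. a < s \<Longrightarrow> t + e n < b \<Longrightarrow> test_fun1 a b \<eta>"
      "\<And>x. 0 \<le> \<eta> x \<and> \<eta> x \<le> 1" "\<And>x. s + e n \<le> x \<Longrightarrow> x \<le> t \<Longrightarrow> \<eta> x = 1"
      "\<And>x. x \<le> s \<or> t + e n \<le> x \<Longrightarrow> \<eta> x = 0"
      "\<And>x. deriv \<eta> x = r1 x - r2 x"
      and r1: "continuous_on UNIV r1" "\<And>x. r1 x \<ge> 0" "\<And>x. x \<notin> {s..s+e n} \<Longrightarrow> r1 x = 0" "integral {s..s+e n} r1 = 1"
      and r2: "continuous_on UNIV r2" "\<And>x. r2 x \<ge> 0" "\<And>x. x \<notin> {t..t+e n} \<Longrightarrow> r2 x = 0" "integral {t..t+e n} r2 = 1"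
      by (fact ex_cutoff[OF e(1,2)])
    have tf: "test_fun1 0 T \<eta>" by (rule \<eta>(1)) (use st e in auto)
    have "continuous_on UNIV \<eta>"
    proof -
      have "(deriv ^^ 0) \<eta> differentiable (at x)" for x using tf unfolding test_fun1_def by blast
      then show ?thesis by (simp add: continuous_at_imp_continuous_on differentiable_imp_continuous_within)
    qed
    then have [measurable]: "\<eta> \<in> borel_measurable borel" by (rule borel_measurable_continuous_onI)
    have [measurable]: "r1 \<in> borel_measurable borel" "r2 \<in> borel_measurable borel"
      using r1(1) r2(1) by (auto intro: borel_measurable_continuous_onI)
    have cs: "continuous_on {s..s+e n} m" "continuous_on {t..t+e n} m"
      using st e[of n] by (auto intro!: continuous_on_subset[OF m])
    note a1 = bump_average[OF e(1) cs(1) r1 ds] and a2 = bump_average[OF e(1) cs(2) r2 dt]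
    have "(\<integral>t. m t * deriv \<eta> t \<partial>lebesgue_on {0<..<T}) = (\<integral>x. indicator {0<..<T} x * (m x * r1 x - m x * r2 x) \<partial>lborel)"
      by (rule integral_lebesgue_on_AE_eq) (use a1(1) a2(1) in \<open>auto simp: \<eta>(5) right_diff_distrib\<close>)
    also have "\<dots> = (\<integral>x. m x * r1 x - m x * r2 x \<partial>lborel)"
    proof (rule Bochner_Integration.integral_cong[OF refl])
      fix x show "indicator {0<..<T} x * (m x * r1 x - m x * r2 x) = m x * r1 x - m x * r2 x"
        using r1(3)[of x] r2(3)[of x] st e[of n] by (cases "x \<in> {0<..<T}") auto
    qed
    also have "\<dots> = (\<integral>x. m x * r1 x \<partial>lborel) - (\<integral>x. m x * r2 x \<partial>lborel)" using a1(1) a2(1) by simp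
    finally have 1: "(\<integral>t. m t * deriv \<eta> t \<partial>lebesgue_on {0<..<T}) = \<dots>" .
    have "(\<integral>t. \<alpha> t * \<eta> t \<partial>lebesgue_on {0<..<T}) = (\<integral>x. indicator {0<..<T} x * (A x * \<eta> x) \<partial>lborel)"
      by (rule integral_lebesgue_on_AE_eq) (use ae in \<open>auto elim!: eventually_mono\<close>)
    also have "\<dots> = (\<integral>x. A x * \<eta> x \<partial>lborel)"
    proof (rule Bochner_Integration.integral_cong[OF refl])
      fix x show "indicator {0<..<T} x * (A x * \<eta> x) = A x * \<eta> x"
        using \<eta>(4)[of x] st e[of n] by (cases "x \<in> {0<..<T}") auto
    qed
    finally have 2: "(\<integral>t. \<alpha> t * \<eta> t \<partial>lebesgue_on {0<..<T}) = (\<integral>x. A x * \<eta> x \<partial>lborel)" .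
    have iE: "integrable lborel (\<lambda>x. A x * \<eta> x)"
      by (rule Bochner_Integration.integrable_bound[OF A])
        (use \<eta>(2) in \<open>auto simp: abs_mult intro!: mult_left_le\<close>)
    have iI: "integrable lborel (\<lambda>x. indicator {s<..t} x * A x)"
      by (rule Bochner_Integration.integrable_bound[OF A]) (auto simp: indicator_def)
    have "\<bar>(\<integral>x. A x * \<eta> x \<partial>lborel) - (\<integral>r. indicator {s<..t} r * A r \<partial>lborel)\<bar> =
      \<bar>\<integral>x. A x * \<eta> x - indicator {s<..t} x * A x \<partial>lborel\<bar>" using iE iI by simp
    also have "\<dots> \<le> b n"
      unfolding b_def
    proof (rule integral_abs_bound[THEN order_trans], rule integral_mono)
      fix x
      have "\<bar>\<eta> x - indicator {s<..t} x\<bar> \<le> indicator (?B n) x"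
        using \<eta>(2)[of x] \<eta>(3)[of x] \<eta>(4)[of x] e[of n] by (auto simp: indicator_def)
      then have "\<bar>\<eta> x - indicator {s<..t} x\<bar> * \<bar>A x\<bar> \<le> indicator (?B n) x * \<bar>A x\<bar>"
        by (rule mult_right_mono) simp
      then show "\<bar>A x * \<eta> x - indicator {s<..t} x * A x\<bar> \<le> indicator (?B n) x * \<bar>A x\<bar>"
        by (simp add: abs_mult[symmetric] algebra_simps)
    qed (use iA iE iI in auto)
    finally have 3: "\<bar>(\<integral>x. A x * \<eta> x \<partial>lborel) - (\<integral>r. indicator {s<..t} r * A r \<partial>lborel)\<bar> \<le> b n" .
    show ?thesis using weak[OF tf] 1 2 3 a1(2) a2(2) by linarith
  qed
  have "\<bar>?X\<bar> \<le> \<epsilon>" if "\<epsilon> > 0" for \<epsilon>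
  proof -
    have at: "\<exists>\<delta>>0. \<forall>x. \<bar>x - y\<bar> < \<delta> \<longrightarrow> \<bar>m x - m y\<bar> \<le> \<epsilon> / 3" if "0 < y" "y < T" for y
    proof -
      have "isCont m y" using m that continuous_on_eq_continuous_at[of "{0<..<T}" m] by auto
      then have "\<forall>e>0. \<exists>d>0. \<forall>x. dist x y < d \<longrightarrow> dist (m x) (m y) < e"
        unfolding continuous_at_eps_delta by (simp add: dist_commute)
      from this[rule_format, of "\<epsilon> / 3"] show ?thesis
        using \<open>\<epsilon> > 0\<close> by (auto simp: dist_real_def intro: less_imp_le)
    qed
    obtain \<delta>1 where d1: "\<delta>1 > 0" "\<And>x. \<bar>x - s\<bar> < \<delta>1 \<Longrightarrow> \<bar>m x - m s\<bar> \<le> \<epsilon> / 3" using at[of s] st by auto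
    obtain \<delta>2 where d2: "\<delta>2 > 0" "\<And>x. \<bar>x - t\<bar> < \<delta>2 \<Longrightarrow> \<bar>m x - m t\<bar> \<le> \<epsilon> / 3" using at[of t] st by auto
    have "\<forall>\<^sub>F n in sequentially. e n < \<delta>1" "\<forall>\<^sub>F n in sequentially. e n < \<delta>2" "\<forall>\<^sub>F n in sequentially. b n < \<epsilon> / 3"
      using e0 b0 d1 d2 that by (auto intro!: order_tendstoD(2))
    then have "\<forall>\<^sub>F n in sequentially. e n < \<delta>1 \<and> e n < \<delta>2 \<and> b n < \<epsilon> / 3" by eventually_elim auto
    then obtain n where n: "e n < \<delta>1" "e n < \<delta>2" "b n < \<epsilon> / 3" by (auto simp: eventually_sequentially)
    have "\<bar>?X\<bar> \<le> 2 * (\<epsilon> / 3) + b n"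
      by (rule main) (use d1 d2 n in auto)
    with n show ?thesis by simp
  qed
  then have "\<bar>?X\<bar> \<le> 0" by (meson dense_ge)
  then show ?thesis by simp
qed

section \<open>The space-time measure, its slices, and continuity in time\<close>

context bounded_open
begin

text \<open>Time runs over the whole line so that time shifts preserve the measure; time windows
  enter as indicator factors.\<close>

abbreviation Q :: "(real \<times> (real^'n)) measure" where "Q \<equiv> lborel \<Otimes>\<^sub>M N"

sublocale QP: pair_sigma_finite "lborel :: real measure" N
  by (rule pair_sigma_finite_time)

lemma measurable_ident_Q: "(\<lambda>z. z) \<in> Q \<rightarrow>\<^sub>M borel"
proof -
  have "(\<lambda>x. x) \<in> N \<rightarrow>\<^sub>M borel" by (rule borel_imp_measurable_N[where f="\<lambda>x. x"]) simp
  then have "snd \<in> Q \<rightarrow>\<^sub>M borel" using measurable_compose[OF measurable_snd] by blast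
  moreover have "fst \<in> Q \<rightarrow>\<^sub>M borel" using measurable_fst[of lborel N] by simp
  ultimately have "(\<lambda>z. (fst z, snd z)) \<in> Q \<rightarrow>\<^sub>M borel \<Otimes>\<^sub>M borel" by (intro measurable_Pair)
  then show ?thesis by (simp add: borel_prod)
qed

lemma borel_imp_measurable_Q:
  "f \<in> borel_measurable (borel :: (real \<times> (real^'n)) measure) \<Longrightarrow> f \<in> borel_measurable Q"
  using measurable_compose[OF measurable_ident_Q] by blast

lemma borel_slice:
  fixes f :: "real \<times> (real^'n) \<Rightarrow> 'b::topological_space"
  assumes "f \<in> borel_measurable borel"
  shows "(\<lambda>x. f (t, x)) \<in> borel_measurable borel" "(\<lambda>x. f (t, x)) \<in> borel_measurable N"
proof -
  have "(\<lambda>x. (t, x)) \<in> borel_measurable borel" by (intro borel_measurable_continuous_onI continuous_intros)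
  then show *: "(\<lambda>x. f (t, x)) \<in> borel_measurable borel" using assms by (rule measurable_compose)
  then show "(\<lambda>x. f (t, x)) \<in> borel_measurable N"
    by (simp add: measurable_completion measurable_restrict_space1)
qed

lemma nn_integral_N:
  assumes [measurable]: "f \<in> borel_measurable borel"
  shows "(\<integral>\<^sup>+x. f x \<partial>N) = (\<integral>\<^sup>+x. f x * indicator \<Omega> x \<partial>lborel)"
  by (simp add: nn_integral_restrict_space nn_integral_completion)

text \<open>\<open>Q\<close> restricts space to the domain and uses the completed measure in space
  only, so it is not a restriction of \<open>lborel\<close> on the product; comparing iterated
  nonnegative integrals bridges the gap.\<close>

lemma integrable_lborel_imp_Q:
  fixes k :: "real \<times> (real^'n) \<Rightarrow> real"
  assumes k: "integrable lborel k"
  shows "integrable Q k"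
proof -
  have [measurable]: "k \<in> borel_measurable borel" using k by simp
  have "(\<integral>\<^sup>+z. ennreal (norm (k z)) \<partial>Q) = (\<integral>\<^sup>+t. (\<integral>\<^sup>+x. ennreal (norm (k (t, x))) \<partial>N) \<partial>lborel)"
    by (rule nn_integral_fst[symmetric]) (intro borel_imp_measurable_Q, measurable)
  also have "\<dots> \<le> (\<integral>\<^sup>+t. (\<integral>\<^sup>+x. ennreal (norm (k (t, x))) \<partial>lborel) \<partial>lborel)"
  proof (rule nn_integral_mono)
    fix t
    have [measurable]: "(\<lambda>x. k (t, x)) \<in> borel_measurable borel" by (rule borel_slice) simp
    have "(\<integral>\<^sup>+x. ennreal (norm (k (t, x))) \<partial>N) = (\<integral>\<^sup>+x. ennreal (norm (k (t, x))) * indicator \<Omega> x \<partial>lborel)"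
      by (rule nn_integral_N) measurable
    also have "\<dots> \<le> (\<integral>\<^sup>+x. ennreal (norm (k (t, x))) \<partial>lborel)"
      by (rule nn_integral_mono) (auto simp: indicator_def)
    finally show "(\<integral>\<^sup>+x. ennreal (norm (k (t, x))) \<partial>N) \<le> (\<integral>\<^sup>+x. ennreal (norm (k (t, x))) \<partial>lborel)" .
  qed
  also have "\<dots> = (\<integral>\<^sup>+z. ennreal (norm (k z)) \<partial>(lborel \<Otimes>\<^sub>M lborel))"
    by (rule lborel.nn_integral_fst) (simp add: lborel_prod)
  also have "\<dots> < \<infinity>" using k unfolding lborel_prod integrable_iff_bounded by simp
  finally show ?thesis
    by (intro integrableI_bounded borel_imp_measurable_Q) auto
qed

lemma AE_lborel_imp_slices:
  assumes "AE z in (lborel :: (real \<times> (real^'n)) measure). P z"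
  shows "AE t in lborel. AE x in N. P (t, x)"
proof -
  have "AE z in lborel \<Otimes>\<^sub>M lborel. P z" using assms unfolding lborel_prod .
  from lborel_pair.AE_pair[OF this] show ?thesis
  proof eventually_elim
    case (elim t)
    have "AE x in lebesgue. P (t, x)" by (rule AE_completion[OF elim])
    then show ?case by (subst AE_restrict_space_iff) (auto elim!: eventually_mono)
  qed
qed

lemma integrable_Q_product:
  fixes a :: "real \<Rightarrow> real" and b :: "real^'n \<Rightarrow> real"
  assumes a: "integrable lborel a" and b: "integrable N b"
  shows "integrable Q (\<lambda>z. a (fst z) * b (snd z))"
proof (rule QP.Fubini_integrable)
  have [measurable]: "a \<in> borel_measurable lborel" "b \<in> borel_measurable N" using a b by auto
  show "(\<lambda>z. a (fst z) * b (snd z)) \<in> borel_measurable Q" by measurable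
  show "integrable lborel (\<lambda>x. \<integral>y. norm (a (fst (x, y)) * b (snd (x, y))) \<partial>N)"
    using a by (simp add: abs_mult)
  show "AE x in lborel. integrable N (\<lambda>y. a (fst (x, y)) * b (snd (x, y)))" using b by simp
qed

text \<open>The same approximating test functions serve both pairs, since none of the integrals sees
  a null set.\<close>

lemma H10_on_cong_AE:
  assumes H: "H10_on \<Omega> v G" and v: "AE x in N. v' x = v x" and G: "AE x in N. G' x = G x"
    and m: "v' \<in> borel_measurable N" "\<And>i. (\<lambda>x. G' x $ i) \<in> borel_measurable N"
  shows "H10_on \<Omega> v' G'"
proof -
  obtain \<phi>s :: "nat \<Rightarrow> real^'n \<Rightarrow> real" where t: "\<And>k. test_fun \<Omega> (\<phi>s k)"
    and c1: "(\<lambda>k. \<integral>x. (\<phi>s k x - v x)\<^sup>2 \<partial>N) \<longlonglongrightarrow> 0"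
    and c2: "\<And>i. (\<lambda>k. \<integral>x. (partial i (\<phi>s k) x - G x $ i)\<^sup>2 \<partial>N) \<longlonglongrightarrow> 0"
    and "AE x in N. (\<lambda>k. \<phi>s k x) \<longlonglongrightarrow> v x"
    by (fact H10_on_approx[OF H])
  have vm: "v \<in> borel_measurable N" "integrable N (\<lambda>x. (v x)\<^sup>2)"
    and Gm: "\<And>i. (\<lambda>x. G x $ i) \<in> borel_measurable N" "\<And>i. integrable N (\<lambda>x. (G x $ i)\<^sup>2)"
    using H by (auto simp: H10_on_def H1_on_def Lp_on_2)
  note s = smooth_Rn_measurable_N[OF test_funD(1)[OF t]] smooth_Rn_measurable_N[OF smooth_Rn_partial[OF test_funD(1)[OF t]]]
  note [measurable] = m vm(1) Gm(1) s
  show ?thesis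
  proof (rule H10_onI[OF _ _ t])
    have "integrable N (\<lambda>x. (v' x)\<^sup>2) \<longleftrightarrow> integrable N (\<lambda>x. (v x)\<^sup>2)"
      by (rule integrable_cong_AE) (use v in \<open>auto elim!: eventually_mono\<close>)
    with vm m show "Lp_on 2 \<Omega> v'" by (simp add: Lp_on_2)
    have "integrable N (\<lambda>x. (G' x $ i)\<^sup>2) \<longleftrightarrow> integrable N (\<lambda>x. (G x $ i)\<^sup>2)" for i
      by (rule integrable_cong_AE) (use G in \<open>auto elim!: eventually_mono\<close>)
    with Gm m show "Lp_on 2 \<Omega> (\<lambda>x. G' x $ i)" for i by (simp add: Lp_on_2)
    have "(\<integral>x. (\<phi>s k x - v' x)\<^sup>2 \<partial>N) = (\<integral>x. (\<phi>s k x - v x)\<^sup>2 \<partial>N)" for k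
      by (rule integral_cong_AE) (use v in \<open>auto elim!: eventually_mono\<close>)
    with c1 show "(\<lambda>k. \<integral>x. (\<phi>s k x - v' x)\<^sup>2 \<partial>N) \<longlonglongrightarrow> 0" by simp
    have "(\<integral>x. (partial i (\<phi>s k) x - G' x $ i)\<^sup>2 \<partial>N) = (\<integral>x. (partial i (\<phi>s k) x - G x $ i)\<^sup>2 \<partial>N)" for k i
      by (rule integral_cong_AE) (use G in \<open>auto elim!: eventually_mono\<close>)
    with c2 show "(\<lambda>k. \<integral>x. (partial i (\<phi>s k) x - G' x $ i)\<^sup>2 \<partial>N) \<longlonglongrightarrow> 0" for i by simp
  qed
qed

lemma continuous_L2_sq:
  assumes "continuous_L2 \<Omega> u"
  shows "t \<ge> 0 \<Longrightarrow> u t \<in> borel_measurable N" "t \<ge> 0 \<Longrightarrow> integrable N (\<lambda>x. (u t x)\<^sup>2)"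
    "t \<ge> 0 \<Longrightarrow> ((\<lambda>s. \<integral>x. (u s x - u t x)\<^sup>2 \<partial>N) \<longlongrightarrow> 0) (at t within {0..})"
proof -
  show "t \<ge> 0 \<Longrightarrow> u t \<in> borel_measurable N" "t \<ge> 0 \<Longrightarrow> integrable N (\<lambda>x. (u t x)\<^sup>2)"
    using assms by (auto simp: continuous_L2_def Lp_on_2)
  assume "t \<ge> 0"
  then have "((\<lambda>s. sqrt (\<integral>x. (u s x - u t x)\<^sup>2 \<partial>N)) \<longlongrightarrow> 0) (at t within {0..})"
    using assms by (simp add: continuous_L2_def Lp_norm_2)
  from tendsto_power[OF this, of 2]
  show "((\<lambda>s. \<integral>x. (u s x - u t x)\<^sup>2 \<partial>N) \<longlongrightarrow> 0) (at t within {0..})"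
    by (simp add: integral_nonneg_AE)
qed

lemma continuous_L2_pairing:
  assumes u: "continuous_L2 \<Omega> u" and v: "v \<in> borel_measurable N" "integrable N (\<lambda>x. (v x)\<^sup>2)"
  shows "continuous_on {0..} (\<lambda>t. \<integral>x. u t x * v x \<partial>N)"
  unfolding continuous_on_def
proof
  fix t :: real assume "t \<in> {0..}"
  then have t: "t \<ge> 0" by simp
  \<comment> \<open>The limit lemma asks for integrability at every index, but \<open>u s\<close> is
    only controlled for nonnegative \<open>s\<close>; the value 0 is a harmless filler, as the limit
    stays within \<open>{0..}\<close>.\<close>
  define w where "w s = (if s \<ge> 0 then (\<lambda>x. u s x - u t x) else (\<lambda>_. 0))" for s
  note c = continuous_L2_sq[OF u]
  have [measurable]: "w s \<in> borel_measurable N" for s using c(1) t by (auto simp: w_def)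
  have wi: "integrable N (\<lambda>x. (w s x)\<^sup>2)" for s
    using c(1,2) t by (auto simp: w_def intro!: integrable_diff_sq)
  have ev: "\<forall>\<^sub>F s in at t within {0..}. s \<ge> 0" by (auto simp: eventually_at_filter)
  have "((\<lambda>s. \<integral>x. (w s x)\<^sup>2 \<partial>N) \<longlongrightarrow> 0) (at t within {0..})"
    by (rule Lim_transform_eventually[OF c(3)[OF t]]) (use ev in \<open>auto elim!: eventually_mono simp: w_def\<close>)
  then have "((\<lambda>s. \<integral>x. w s x * v x \<partial>N) \<longlongrightarrow> 0) (at t within {0..})"
    using v wi by (intro tendsto_0_integral_mult) auto
  then have "((\<lambda>s. (\<integral>x. u s x * v x \<partial>N) - (\<integral>x. u t x * v x \<partial>N)) \<longlongrightarrow> 0) (at t within {0..})"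
  proof (rule Lim_transform_eventually)
    show "\<forall>\<^sub>F s in at t within {0..}. (\<integral>x. w s x * v x \<partial>N) = (\<integral>x. u s x * v x \<partial>N) - (\<integral>x. u t x * v x \<partial>N)"
      using ev
    proof eventually_elim
      case (elim s)
      have "integrable N (\<lambda>x. u s x * v x)" "integrable N (\<lambda>x. u t x * v x)"
        using c elim t v by (auto intro!: integral_sq_le_mult(1))
      with elim show ?case by (simp add: w_def left_diff_distrib)
    qed
  qed
  then show "((\<lambda>s. \<integral>x. u s x * v x \<partial>N) \<longlongrightarrow> (\<integral>x. u t x * v x \<partial>N)) (at t within {0..})"
    by (simp add: LIM_zero_iff)
qed

end

section \<open>Borel representatives of weak solutions\<close>

lemma powr_minus_1_le:
  fixes a p :: real assumes "p \<ge> 1"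
  shows "\<bar>a\<bar> powr (p - 1) \<le> 1 + \<bar>a\<bar> powr p"
proof (cases "\<bar>a\<bar> \<le> 1")
  case True
  then have "\<bar>a\<bar> powr (p - 1) \<le> 1" using assms by (intro powr_le1) auto
  then show ?thesis by (smt (verit) powr_ge_zero)
next
  case False
  then have "\<bar>a\<bar> powr (p - 1) \<le> \<bar>a\<bar> powr p" by (intro powr_mono) auto
  then show ?thesis by simp
qed

context bounded_open
begin

text \<open>A solution is only measurable for the completed measure on space-time. Fubini and time
  shifts need joint Borel measurability, so \<open>u\<close> and its gradient are replaced by Borel
  functions that agree with them almost everywhere. The last conclusion is the equation integrated
  over \<open>(s, t]\<close>, with point values of the continuous \<open>u\<close> at the ends; a
  bounded \<open>v\<close> belongs to every space of test functions and can be paired with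
  \<open>f (U)\<close> and \<open>g\<close>.\<close>

lemma weak_solution_borel:
  fixes u :: "real \<Rightarrow> real^'n \<Rightarrow> real"
  assumes W: "weak_solution \<Omega> p f g u" and uc: "continuous_L2 \<Omega> u" and T: "T > 0" and p: "p \<ge> 2"
    and f: "continuous_on UNIV f" and growth: "\<And>s. \<bar>f s\<bar> \<le> C1 * (1 + \<bar>s\<bar> powr (p - 1))"
    and g: "integrable N g"
  obtains U :: "real \<times> (real^'n) \<Rightarrow> real" and H :: "real \<times> (real^'n) \<Rightarrow> real^'n" where
    "U \<in> borel_measurable borel" "\<And>i. (\<lambda>z. H z $ i) \<in> borel_measurable borel"
    "integrable Q (\<lambda>z. (U z)\<^sup>2)" "\<And>i. integrable Q (\<lambda>z. (H z $ i)\<^sup>2)"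
    "integrable Q (\<lambda>z. indicator {0<..<T} (fst z) * f (U z))"
    "AE t in lborel. t \<in> {0<..<T} \<longrightarrow> (AE x in N. U (t, x) = u t x) \<and> H10_on \<Omega> (\<lambda>x. U (t, x)) (\<lambda>x. H (t, x))"
    "\<And>v Gv C s t. H10_on \<Omega> v Gv \<Longrightarrow> (\<And>x. x \<in> \<Omega> \<Longrightarrow> \<bar>v x\<bar> \<le> C) \<Longrightarrow> 0 < s \<Longrightarrow> s < t \<Longrightarrow> t < T \<Longrightarrow>
      (\<integral>x. u t x * v x \<partial>N) - (\<integral>x. u s x * v x \<partial>N) =
      - (\<integral>r. indicator {s<..t} r * (\<integral>x. H (r, x) \<bullet> Gv x + f (U (r, x)) * v x - g x * v x \<partial>N) \<partial>lborel)"
proof -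
  let ?I = "{0<..<T}"
  let ?D = "?I \<times> \<Omega>"
  obtain G where
    m1: "(\<lambda>(t, x). u t x) \<in> borel_measurable (lebesgue_on ?D)" and
    m2: "(\<lambda>(t, x). G t x) \<in> borel_measurable (lebesgue_on ?D)" and
    i1: "integrable (lebesgue_on ?D) (\<lambda>(t,x). (u t x)\<^sup>2 + (norm (G t x))\<^sup>2)" and
    i2: "integrable (lebesgue_on ?D) (\<lambda>(t,x). \<bar>u t x\<bar> powr p)" and
    ae: "AE t in lebesgue_on ?I. H10_on \<Omega> (u t) (G t)" and
    weak: "\<And>v Gv \<eta>. H10_on \<Omega> v Gv \<Longrightarrow> Lp_on p \<Omega> v \<Longrightarrow> test_fun1 0 T \<eta> \<Longrightarrow>
          - (\<integral>t. (\<integral>x. u t x * v x \<partial>N) * deriv \<eta> t \<partial>lebesgue_on ?I)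
          + (\<integral>t. ((\<integral>x. G t x \<bullet> Gv x \<partial>N)
                   + (\<integral>x. f (u t x) * v x \<partial>N)
                   - (\<integral>x. g x * v x \<partial>N)) * \<eta> t \<partial>lebesgue_on ?I) = 0"
    using W T unfolding weak_solution_def by meson
  have D [measurable]: "?D \<in> sets borel" using open_dom by (intro borel_open open_Times) auto
  then have D': "?D \<in> sets lebesgue" by auto
  have fm [measurable]: "f \<in> borel_measurable borel" using f by (rule borel_measurable_continuous_onI)
  have "(\<lambda>z. if z \<in> ?D then (case z of (t, x) \<Rightarrow> u t x) else 0) \<in> borel_measurable lebesgue"
    by (rule borel_measurable_if_I[OF m1 D'])
  then obtain U' where U' [measurable]: "U' \<in> borel_measurable lborel"
    and aeU: "AE z in lborel. (if z \<in> ?D then (case z of (t, x) \<Rightarrow> u t x) else 0) = U' z"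
    using completion_ex_borel_measurable_real[OF borel_measurable_if_I[OF m1 D']] by blast
  have "\<exists>h. h \<in> borel_measurable lborel \<and> (AE z in lborel. (if z \<in> ?D then (case z of (t, x) \<Rightarrow> G t x) $ i else 0) = h z)" (is "\<exists>h. ?P i h") for i
  proof -
    have "(\<lambda>z. (case z of (t, x) \<Rightarrow> G t x) $ i) \<in> borel_measurable (lebesgue_on ?D)"
      by (rule measurable_compose[OF m2]) simp
    from completion_ex_borel_measurable_real[OF borel_measurable_if_I[OF this D']] show ?thesis
      unfolding Bex_def .
  qed
  then have "\<exists>H'. \<forall>i. ?P i (H' i)" by (intro choice allI)
  then obtain H' where HP: "\<forall>i. ?P i (H' i)" by (rule exE)
  have H' [measurable]: "\<And>i. H' i \<in> borel_measurable lborel"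
    and aeH: "\<And>i. AE z in lborel. (if z \<in> ?D then (case z of (t, x) \<Rightarrow> G t x) $ i else 0) = H' i z"
    using HP by simp_all
  \<comment> \<open>Extension by zero outside the cylinder, pointwise and not just almost
    everywhere, so that integrability over all times needs no further cut-off.\<close>
  define U where "U z = indicator ?D z * U' z" for z
  define H where "H z = (\<chi> i. indicator ?D z * H' i z)" for z
  have Hi: "H z $ i = indicator ?D z * H' i z" for z i by (simp add: H_def)
  have Um [measurable]: "U \<in> borel_measurable borel" unfolding U_def using U' by simp
  have Hm [measurable]: "(\<lambda>z. H z $ i) \<in> borel_measurable borel" for i unfolding Hi using H'[of i] by simp
  have U0: "U z = 0" and H0: "H z $ i = 0" if "z \<notin> ?D" for z i
    using that unfolding U_def Hi by (simp_all add: indicator_def)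
  have eqD: "AE z in lborel. z \<in> ?D \<longrightarrow> U z = u (fst z) (snd z) \<and> (\<forall>i. H z $ i = G (fst z) (snd z) $ i)"
  proof -
    have "AE z in lborel. \<forall>i. (if z \<in> ?D then (case z of (t, x) \<Rightarrow> G t x) $ i else 0) = H' i z"
      unfolding AE_all_countable using aeH by blast
    with aeU show ?thesis
      by eventually_elim (auto simp: U_def Hi split: if_splits prod.splits)
  qed
  have nG: "(norm y)\<^sup>2 = (\<Sum>i\<in>UNIV. (y $ i)\<^sup>2)" for y :: "real^'n"
    unfolding power2_norm_eq_inner inner_vec_def by (simp add: power2_eq_square)
  have I1: "integrable lborel (\<lambda>z. indicator ?D z * ((U z)\<^sup>2 + (\<Sum>i\<in>UNIV. (H z $ i)\<^sup>2)))"
  proof (subst integral_lebesgue_on_AE_eq(2)[symmetric])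
    show "AE z in lborel. z \<in> ?D \<longrightarrow> (case z of (t, x) \<Rightarrow> (u t x)\<^sup>2 + (norm (G t x))\<^sup>2) = (U z)\<^sup>2 + (\<Sum>i\<in>UNIV. (H z $ i)\<^sup>2)"
      using eqD by eventually_elim (auto simp: nG)
  qed (use i1 in auto)
  have I2: "integrable lborel (\<lambda>z. indicator ?D z * (\<bar>U z\<bar> powr p))"
  proof (subst integral_lebesgue_on_AE_eq(2)[symmetric])
    show "AE z in lborel. z \<in> ?D \<longrightarrow> (case z of (t, x) \<Rightarrow> \<bar>u t x\<bar> powr p) = \<bar>U z\<bar> powr p"
      using eqD by eventually_elim auto
  qed (use i2 in auto)
  have QU: "integrable Q (\<lambda>z. (U z)\<^sup>2)"
  proof (rule integrable_lborel_imp_Q, rule Bochner_Integration.integrable_bound[OF I1])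
    show "AE z in lborel. norm ((U z)\<^sup>2) \<le> norm (indicator ?D z * ((U z)\<^sup>2 + (\<Sum>i\<in>UNIV. (H z $ i)\<^sup>2)))"
    proof (rule always_eventually, rule allI)
      fix z show "norm ((U z)\<^sup>2) \<le> norm (indicator ?D z * ((U z)\<^sup>2 + (\<Sum>i\<in>UNIV. (H z $ i)\<^sup>2)))"
        using U0[of z] by (cases "z \<in> ?D") (auto simp: sum_nonneg)
    qed
  qed simp
  have QH: "integrable Q (\<lambda>z. (H z $ i)\<^sup>2)" for i
  proof (rule integrable_lborel_imp_Q, rule Bochner_Integration.integrable_bound[OF I1])
    show "AE z in lborel. norm ((H z $ i)\<^sup>2) \<le> norm (indicator ?D z * ((U z)\<^sup>2 + (\<Sum>i\<in>UNIV. (H z $ i)\<^sup>2)))"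
    proof (rule always_eventually, rule allI)
      fix z
      have "(H z $ i)\<^sup>2 \<le> (\<Sum>i\<in>UNIV. (H z $ i)\<^sup>2)" by (rule member_le_sum) auto
      also have "\<dots> \<le> (U z)\<^sup>2 + (\<Sum>i\<in>UNIV. (H z $ i)\<^sup>2)" by simp
      finally show "norm ((H z $ i)\<^sup>2) \<le> norm (indicator ?D z * ((U z)\<^sup>2 + (\<Sum>i\<in>UNIV. (H z $ i)\<^sup>2)))"
        using H0[of z i] by (cases "z \<in> ?D") auto
    qed
  qed simp
  have indI: "integrable lborel (indicator ?I :: real \<Rightarrow> real)"
    using T by (intro integrable_real_indicator) (auto simp: less_imp_le)
  \<comment> \<open>The indicator cannot be dropped: where \<open>U\<close> has been set to 0 the
    value is \<open>f 0\<close>, which may differ from 0 and would not be integrable over all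
    times.\<close>
  let ?F = "\<lambda>z. indicator ?I (fst z) * f (U z)"
  have mQ [measurable]: "U \<in> borel_measurable Q" "\<And>i. (\<lambda>z. H z $ i) \<in> borel_measurable Q"
    by (auto intro!: borel_imp_measurable_Q)
  have QF: "integrable Q ?F"
  proof -
    have c: "integrable N (\<lambda>_. 1 :: real)" by simp
    have "integrable Q (\<lambda>z. C1 * (2 * (indicator ?I (fst z) * 1) + indicator ?D z * \<bar>U z\<bar> powr p))"
      using integrable_Q_product[OF indI c] integrable_lborel_imp_Q[OF I2]
      by (intro integrable_mult_right Bochner_Integration.integrable_add) auto
    then show ?thesis
    proof (rule Bochner_Integration.integrable_bound)
      show "AE z in Q. norm (?F z) \<le> norm (C1 * (2 * (indicator ?I (fst z) * 1) + indicator ?D z * \<bar>U z\<bar> powr p))"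
      proof (rule always_eventually, rule allI)
        fix z
        have C1: "C1 \<ge> 0" using growth[of 0] by (auto simp: zero_le_mult_iff intro: order_trans[OF abs_ge_zero])
        have "\<bar>f (U z)\<bar> \<le> C1 * (1 + \<bar>U z\<bar> powr (p - 1))" by (rule growth)
        also have "\<dots> \<le> C1 * (2 + \<bar>U z\<bar> powr p)"
          using powr_minus_1_le[of p "U z"] p C1 by (intro mult_left_mono) auto
        finally have *: "\<bar>f (U z)\<bar> \<le> C1 * (2 + \<bar>U z\<bar> powr p)" .
        show "norm (?F z) \<le> norm (C1 * (2 * (indicator ?I (fst z) * 1) + indicator ?D z * \<bar>U z\<bar> powr p))"
        proof (cases "fst z \<in> ?I")
          case True
          with * U0[of z] C1 show ?thesis by (cases "z \<in> ?D") auto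
        next
          case False
          then show ?thesis by simp
        qed
      qed
    qed measurable
  qed
  have aeH10: "AE t in lborel. t \<in> ?I \<longrightarrow> H10_on \<Omega> (u t) (G t)"
    using ae by (subst (asm) AE_restrict_space_iff) (auto simp: AE_completion_iff)
  have sl: "AE t in lborel. t \<in> ?I \<longrightarrow> (AE x in N. U (t, x) = u t x) \<and> (AE x in N. H (t, x) = G t x)"
    using AE_lborel_imp_slices[OF eqD]
  proof eventually_elim
    case (elim t)
    show ?case
    proof (intro impI conjI)
      assume t: "t \<in> ?I"
      from elim AE_space[of N] show "AE x in N. U (t, x) = u t x"
        by eventually_elim (use t in auto)
      from elim AE_space[of N] show "AE x in N. H (t, x) = G t x"
        by eventually_elim (use t in \<open>auto simp: vec_eq_iff\<close>)
    qed
  qed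
  have slice: "AE t in lborel. t \<in> ?I \<longrightarrow> (AE x in N. U (t, x) = u t x) \<and> H10_on \<Omega> (\<lambda>x. U (t, x)) (\<lambda>x. H (t, x))"
    using sl aeH10
  proof eventually_elim
    case (elim t)
    then show ?case
      using H10_on_cong_AE[of "u t" "G t" "\<lambda>x. U (t, x)" "\<lambda>x. H (t, x)"] borel_slice(2)[OF Um] borel_slice(2)[OF Hm] by auto
  qed
  have key: "(\<integral>x. u t x * v x \<partial>N) - (\<integral>x. u s x * v x \<partial>N) =
      - (\<integral>r. indicator {s<..t} r * (\<integral>x. H (r, x) \<bullet> Gv x + f (U (r, x)) * v x - g x * v x \<partial>N) \<partial>lborel)"
    if v: "H10_on \<Omega> v Gv" and C: "\<And>x. x \<in> \<Omega> \<Longrightarrow> \<bar>v x\<bar> \<le> C" and st: "0 < s" "s < t" "t < T" for v Gv C s t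
  proof -
    have vm [measurable]: "v \<in> borel_measurable N" and v2: "integrable N (\<lambda>x. (v x)\<^sup>2)"
      and Gm [measurable]: "\<And>i. (\<lambda>x. Gv x $ i) \<in> borel_measurable N" and G2: "\<And>i. integrable N (\<lambda>x. (Gv x $ i)\<^sup>2)"
      using v by (auto simp: H10_on_def H1_on_def Lp_on_2)
    have gm [measurable]: "g \<in> borel_measurable N" using g by simp
    have Lp: "Lp_on p \<Omega> v"
      unfolding Lp_on_def
    proof
      show "integrable N (\<lambda>x. \<bar>v x\<bar> powr p)"
        by (rule integrable_bounded_N[of _ "\<bar>C\<bar> powr p"])
          (use C p in \<open>auto intro!: powr_mono2 intro: order_trans[OF C]\<close>)
    qed simp
    have gv: "integrable N (\<lambda>x. g x * v x)"
    proof (rule Bochner_Integration.integrable_bound[OF integrable_mult_left[OF g, of C]])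
      show "AE x in N. norm (g x * v x) \<le> norm (g x * C)"
        by (rule AE_I2) (use C in \<open>fastforce simp: abs_mult intro!: mult_left_mono intro: order_trans[OF C]\<close>)
    qed simp
    define k1 where "k1 z = H z \<bullet> Gv (snd z)" for z
    define k2 where "k2 z = ?F z * v (snd z)" for z
    define k3 where "k3 z = indicator ?I (fst z) * (g (snd z) * v (snd z))" for z
    have K1: "integrable Q k1"
    proof -
      \<comment> \<open>\<open>Gv (snd z)\<close> is constant in time and need not be square
        integrable over the whole line. As \<open>H\<close> vanishes outside \<open>?I\<close>, the
        inserted indicator changes nothing.\<close>
      have "integrable Q (\<lambda>z. H z $ i * (indicator ?I (fst z) * Gv (snd z) $ i))" for i
      proof (rule integral_sq_le_mult(1))
        show "integrable Q (\<lambda>z. (indicator ?I (fst z) * Gv (snd z) $ i)\<^sup>2)"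
        proof -
          have "(indicator ?I (fst z) * Gv (snd z) $ i)\<^sup>2 = indicator ?I (fst z) * (Gv (snd z) $ i)\<^sup>2" for z
            by (auto simp: indicator_def)
          then show ?thesis using integrable_Q_product[OF indI G2[of i]] by simp
        qed
      qed (use QH in measurable)
      moreover have "H z $ i * (indicator ?I (fst z) * Gv (snd z) $ i) = H z $ i * Gv (snd z) $ i" for z i
        using H0[of z i] by (cases "z \<in> ?D") (auto simp: mem_Times_iff)
      ultimately have "integrable Q (\<lambda>z. \<Sum>i\<in>UNIV. H z $ i * Gv (snd z) $ i)"
        by (intro Bochner_Integration.integrable_sum) simp
      then show ?thesis unfolding k1_def inner_vec_def by simp
    qed
    have K2: "integrable Q k2"
      unfolding k2_def
    proof (rule Bochner_Integration.integrable_bound[OF integrable_mult_left[OF QF, of C]])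
      show "AE z in Q. norm (?F z * v (snd z)) \<le> norm (?F z * C)"
      proof (rule AE_I2)
        fix z assume "z \<in> space Q"
        then have "snd z \<in> \<Omega>" by (auto simp: space_pair_measure)
        then have "\<bar>v (snd z)\<bar> \<le> \<bar>C\<bar>" using C by fastforce
        then show "norm (?F z * v (snd z)) \<le> norm (?F z * C)" by (simp add: abs_mult mult_left_mono)
      qed
    qed measurable
    have K3: "integrable Q k3" unfolding k3_def by (rule integrable_Q_product[OF indI gv])
    define A where "A t = (\<integral>x. k1 (t, x) + k2 (t, x) - k3 (t, x) \<partial>N)" for t
    have A: "integrable lborel A"
      unfolding A_def using QP.integrable_fst'[of "\<lambda>z. k1 z + k2 z - k3 z"] K1 K2 K3 by simp
    let ?\<alpha> = "\<lambda>t. (\<integral>x. G t x \<bullet> Gv x \<partial>N) + (\<integral>x. f (u t x) * v x \<partial>N) - (\<integral>x. g x * v x \<partial>N)"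
    have aeA: "AE t in lborel. t \<in> ?I \<longrightarrow> ?\<alpha> t = A t"
      using QP.AE_integrable_fst'[OF K1] QP.AE_integrable_fst'[OF K2] QP.AE_integrable_fst'[OF K3] sl aeH10
    proof eventually_elim
      case (elim t)
      show ?case
      proof
        assume t: "t \<in> ?I"
        have H10: "H10_on \<Omega> (u t) (G t)" using elim t by blast
        have [measurable]: "u t \<in> borel_measurable N" "\<And>i. (\<lambda>x. G t x $ i) \<in> borel_measurable N"
          using H10 by (auto simp: H10_on_def H1_on_def Lp_on_2)
        note [measurable] = borel_slice(2)[OF Um] borel_slice(2)[OF Hm]
        have eU: "AE x in N. U (t, x) = u t x" and eH: "AE x in N. H (t, x) = G t x"
          using elim t by blast+
        have e1: "(\<integral>x. G t x \<bullet> Gv x \<partial>N) = (\<integral>x. k1 (t, x) \<partial>N)"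
          unfolding k1_def inner_vec_def by (rule integral_cong_AE) (use eH in \<open>auto elim!: eventually_mono\<close>)
        have e2: "(\<integral>x. f (u t x) * v x \<partial>N) = (\<integral>x. k2 (t, x) \<partial>N)"
          unfolding k2_def by (rule integral_cong_AE) (use eU t in \<open>auto elim!: eventually_mono\<close>)
        have e3: "(\<integral>x. g x * v x \<partial>N) = (\<integral>x. k3 (t, x) \<partial>N)"
          unfolding k3_def using t by simp
        show "?\<alpha> t = A t" unfolding e1 e2 e3 A_def using elim by simp
      qed
    qed
    have mc: "continuous_on ?I (\<lambda>t. \<integral>x. u t x * v x \<partial>N)"
      by (rule continuous_on_subset[OF continuous_L2_pairing[OF uc vm v2]]) auto
    have "(\<integral>x. u t x * v x \<partial>N) - (\<integral>x. u s x * v x \<partial>N) = - (\<integral>r. indicator {s<..t} r * A r \<partial>lborel)"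
      by (rule weak_derivative_FTC[OF mc A aeA weak[OF v Lp] st])
    also have "(\<integral>r. indicator {s<..t} r * A r \<partial>lborel) =
      (\<integral>r. indicator {s<..t} r * (\<integral>x. H (r, x) \<bullet> Gv x + f (U (r, x)) * v x - g x * v x \<partial>N) \<partial>lborel)"
    proof (rule Bochner_Integration.integral_cong[OF refl])
      fix r
      show "indicator {s<..t} r * A r = indicator {s<..t} r * (\<integral>x. H (r, x) \<bullet> Gv x + f (U (r, x)) * v x - g x * v x \<partial>N)"
        using st by (cases "r \<in> {s<..t}") (auto simp: A_def k1_def k2_def k3_def)
    qed
    finally show ?thesis .
  qed
  show ?thesis
    by (rule that[OF Um Hm QU QH QF slice key])
qed

end

section \<open>A smooth convex substitute for the absolute value\<close>

text \<open>
  Since \<open>dhyp u = u * rsq u\<close> with \<open>0 < rsq u \<le> 1\<close>, the lower bound \<open>f u * u \<ge> - C2\<close> is inherited by \<open>f u * dhyp u\<close>.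
\<close>

definition hyp :: "real \<Rightarrow> real" where "hyp u = sqrt (1 + u\<^sup>2) - 1"
definition dhyp :: "real \<Rightarrow> real" where "dhyp u = u * rsq u"

lemma hyp_0 [simp]: "hyp 0 = 0" and dhyp_0 [simp]: "dhyp 0 = 0"
  by (simp_all add: hyp_def dhyp_def)

text \<open>Brings \<open>hyp\<close> into the form of the \<open>smooth_term\<close> constructors,
  which know \<open>rsq\<close> but not the square root.\<close>

lemma hyp_eq: "hyp u = (1 + u * u) * rsq u + (-1)"
proof -
  have "(1 + u\<^sup>2) / sqrt (1 + u\<^sup>2) = sqrt (1 + u\<^sup>2)"
    by (rule real_div_sqrt) simp
  then show ?thesis by (simp add: hyp_def rsq_def power2_eq_square)
qed

lemma DERIV_hyp: "(hyp has_real_derivative dhyp u) (at u)"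
proof -
  have "((\<lambda>u. sqrt (1 + u\<^sup>2) - 1) has_real_derivative u * (1 / sqrt (1 + u\<^sup>2))) (at u)"
    using one_plus_sq_pos[of u] by (auto intro!: derivative_eq_intros simp: field_simps)
  then show ?thesis unfolding hyp_def[abs_def] dhyp_def rsq_def .
qed

lemma DERIV_dhyp: "(dhyp has_real_derivative rsq u ^ 3) (at u)"
proof -
  have "((\<lambda>u. u * rsq u) has_real_derivative 1 * rsq u + - (u * rsq u ^ 3) * u) (at u)"
    by (rule DERIV_mult[OF DERIV_ident DERIV_rsq])
  moreover have "1 * rsq u + - (u * rsq u ^ 3) * u = rsq u * (rsq u ^ 2 * (1 + u\<^sup>2)) - u\<^sup>2 * rsq u ^ 3"
    unfolding rsq_sq by (simp add: power2_eq_square)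
  moreover have "\<dots> = rsq u ^ 3" by (simp add: power2_eq_square power3_eq_cube algebra_simps)
  ultimately show ?thesis unfolding dhyp_def[abs_def] by simp
qed

lemma abs_dhyp_le: "\<bar>dhyp u\<bar> \<le> 1"
proof -
  have "(dhyp u)\<^sup>2 \<le> rsq u ^ 2 * (1 + u\<^sup>2)"
    by (simp add: dhyp_def power_mult_distrib algebra_simps)
  also have "\<dots> = 1" by (rule rsq_sq)
  finally show ?thesis by (simp add: abs_square_le_1)
qed

lemma abs_rsq_cube_le: "\<bar>rsq u ^ 3\<bar> \<le> 1"
  using rsq_pos[of u] rsq_le_1[of u] by (simp add: power_abs power_le_one)

lemma hyp_nonneg: "0 \<le> hyp u"
  by (simp add: hyp_def)

lemma hyp_le_abs: "hyp u \<le> \<bar>u\<bar>"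
  using sqrt_add_le_add_sqrt[of 1 "u\<^sup>2"] by (simp add: hyp_def)

lemma abs_le_hyp: "\<bar>u\<bar> \<le> hyp u + 1"
  by (simp add: hyp_def real_le_rsqrt)

lemma hyp_lipschitz: "\<bar>hyp a - hyp b\<bar> \<le> \<bar>a - b\<bar>"
proof -
  have "norm (hyp a - hyp b) \<le> 1 * norm (a - b)"
    by (rule field_differentiable_bound[of UNIV hyp dhyp]) (use DERIV_hyp abs_dhyp_le in auto)
  then show ?thesis by simp
qed

text \<open>The graph lies above its tangent at \<open>a\<close>. This is Cauchy-Schwarz for the
  vectors \<open>(1, a)\<close> and \<open>(1, b)\<close>, divided by the length of the
  first.\<close>

lemma hyp_convex: "hyp a - hyp b \<le> dhyp a * (a - b)"
proof -
  let ?A = "sqrt (1 + a\<^sup>2)" and ?B = "sqrt (1 + b\<^sup>2)"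
  have "(1 + a * b)\<^sup>2 \<le> (1 + a\<^sup>2) * (1 + b\<^sup>2)"
    using zero_le_power2[of "a - b"] by (simp add: power2_eq_square algebra_simps)
  then have "1 + a * b \<le> sqrt ((1 + a\<^sup>2) * (1 + b\<^sup>2))" by (rule real_le_rsqrt)
  then have AB: "1 + a * b \<le> ?A * ?B" by (simp add: real_sqrt_mult)
  have A: "?A > 0" "?A * ?A = 1 + a\<^sup>2" using one_plus_sq_pos[of a] by auto
  have "(?A - ?B) * ?A \<le> a * (a - b)"
    using AB A(2) by (simp add: algebra_simps power2_eq_square)
  then have "?A - ?B \<le> a * (a - b) / ?A" using A(1) by (simp add: pos_le_divide_eq)
  then show ?thesis by (simp add: hyp_def dhyp_def rsq_def)
qed

lemma smooth_Rn_dhyp: "smooth_Rn \<psi> \<Longrightarrow> smooth_Rn (\<lambda>x. dhyp (\<psi> x))"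
  unfolding dhyp_def
  by (rule smooth_term_smooth, rule smooth_term.mult[OF _ smooth_term.rsq]) (auto intro: smooth_term.base)

lemma smooth_Rn_hyp: "smooth_Rn \<psi> \<Longrightarrow> smooth_Rn (\<lambda>x. hyp (\<psi> x))"
  unfolding hyp_eq
  by (rule smooth_term_smooth, rule smooth_term.add[OF smooth_term.mult[OF smooth_term.add[OF smooth_term.const
      smooth_term.mult] smooth_term.rsq] smooth_term.const]) (auto intro: smooth_term.base)

lemma continuous_on_rsq_cube: "continuous_on UNIV (\<lambda>u. rsq u ^ 3)"
  by (intro continuous_intros continuous_at_imp_continuous_on ballI DERIV_isCont[OF DERIV_rsq])

lemma continuous_on_dhyp: "continuous_on UNIV dhyp"
  by (intro continuous_at_imp_continuous_on ballI DERIV_isCont[OF DERIV_dhyp])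

lemma borel_hyp [measurable]: "hyp \<in> borel_measurable borel" "dhyp \<in> borel_measurable borel" "rsq \<in> borel_measurable borel"
  by (auto intro!: borel_measurable_continuous_onI continuous_at_imp_continuous_on
      DERIV_isCont[OF DERIV_hyp] DERIV_isCont[OF DERIV_dhyp] DERIV_isCont[OF DERIV_rsq])

lemma integrable_mult_bounded:
  fixes F Y :: "'z \<Rightarrow> real"
  assumes F: "integrable M F" and [measurable]: "Y \<in> borel_measurable M" and Y: "\<And>z. z \<in> space M \<Longrightarrow> \<bar>Y z\<bar> \<le> K"
  shows "integrable M (\<lambda>z. F z * Y z)"
proof (rule Bochner_Integration.integrable_bound[OF integrable_mult_left[OF F, of K]])
  show "AE z in M. norm (F z * Y z) \<le> norm (F z * K)"
  proof (rule AE_I2)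
    fix z assume "z \<in> space M"
    then have "\<bar>Y z\<bar> \<le> \<bar>K\<bar>" using Y by fastforce
    then show "norm (F z * Y z) \<le> norm (F z * K)" by (simp add: abs_mult mult_left_mono)
  qed
qed (use F in measurable)

context bounded_open
begin

lemma measurable_shift_Q [measurable]: "(\<lambda>z. (fst z - \<sigma>, snd z)) \<in> Q \<rightarrow>\<^sub>M Q"
  by measurable

text \<open>The abstract form of the time-shift error. Shifted square integrable \<open>Hc i\<close>
  meet fixed square integrable \<open>X i\<close>, and the shifted integrable \<open>F\<close> meets
  the bounded \<open>Y\<close>; each pairing is continuous in the shift by the matching translation
  theorem. The variable \<open>\<theta>\<close> parametrises the window \<open>(r - h, r]\<close> by
  \<open>r - h * \<theta>\<close>.\<close>

lemma shifted_pairing: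
  fixes Hc X :: "'n \<Rightarrow> real \<times> (real^'n) \<Rightarrow> real" and F Y Z :: "real \<times> (real^'n) \<Rightarrow> real"
  assumes Hm [measurable]: "\<And>i. Hc i \<in> borel_measurable Q" and Xm [measurable]: "\<And>i. X i \<in> borel_measurable Q"
    and Ym [measurable]: "Y \<in> borel_measurable Q"
    and H2: "\<And>i. integrable Q (\<lambda>z. (Hc i z)\<^sup>2)" and X2: "\<And>i. integrable Q (\<lambda>z. (X i z)\<^sup>2)"
    and F: "integrable Q F" and Y: "\<And>z. z \<in> space Q \<Longrightarrow> \<bar>Y z\<bar> \<le> K" and Z: "integrable Q Z"
  defines "kk \<equiv> (\<lambda>\<sigma> z. (\<Sum>i\<in>UNIV. Hc i (fst z - \<sigma>, snd z) * X i z) + F (fst z - \<sigma>, snd z) * Y z - Z z)"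
  shows "integrable Q (kk \<sigma>)"
    and "integrable lborel (\<lambda>r. \<integral>\<theta>. indicator {0..<1} \<theta> * (\<integral>x. kk (h * \<theta>) (r, x) \<partial>N) \<partial>lborel)"
    and "(\<integral>r. (\<integral>\<theta>. indicator {0..<1} \<theta> * (\<integral>x. kk (h * \<theta>) (r, x) \<partial>N) \<partial>lborel) \<partial>lborel)
        = (\<integral>\<theta>. indicator {0..<1} \<theta> * (\<integral>z. kk (h * \<theta>) z \<partial>Q) \<partial>lborel)"
    and "hs \<longlonglongrightarrow> 0 \<Longrightarrow> (\<lambda>n::nat. \<integral>\<theta>. indicator {0..<1} \<theta> * (\<integral>z. kk (hs n * \<theta>) z \<partial>Q) \<partial>lborel) \<longlonglongrightarrow> (\<integral>z. kk 0 z \<partial>Q)"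
proof -
  have Fm [measurable]: "F \<in> borel_measurable Q" and Zm [measurable]: "Z \<in> borel_measurable Q" using F Z by auto
  note shH = integrable_time_shift[OF H2] and shF = integrable_time_shift[OF F]
  have F': "integrable Q (\<lambda>z. \<bar>F z\<bar>)" using F by simp
  note shF' = integrable_time_shift[OF F']
  have hm [measurable]: "(\<lambda>z. Hc i (fst z - \<sigma>, snd z)) \<in> borel_measurable Q" for i \<sigma>
    using measurable_compose[OF measurable_shift_Q Hm] by simp
  have fm [measurable]: "(\<lambda>z. F (fst z - \<sigma>, snd z)) \<in> borel_measurable Q" for \<sigma>
    using measurable_compose[OF measurable_shift_Q Fm] by simp
  have iHX: "integrable Q (\<lambda>z. Hc i (fst z - \<sigma>, snd z) * X i z)" for i \<sigma>
    by (rule integral_sq_le_mult(1)) (use shH X2 in auto)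
  have iFY: "integrable Q (\<lambda>z. F (fst z - \<sigma>, snd z) * Y z)" for \<sigma>
    by (rule integrable_mult_bounded[OF shF(1) Ym Y])
  have ikk: "integrable Q (kk \<sigma>)" for \<sigma>
    unfolding kk_def by (intro Bochner_Integration.integrable_diff Bochner_Integration.integrable_add
      Bochner_Integration.integrable_sum iHX iFY Z)
  show "integrable Q (kk \<sigma>)" by (rule ikk)
  \<comment> \<open>Shift invariance makes this bound independent of \<open>\<sigma>\<close>. It
    serves twice: for the integrability behind Fubini and as the majorant of the limit in
    \<open>\<theta>\<close>.\<close>
  define M where "M = (\<Sum>i\<in>UNIV. (\<integral>z. (Hc i z)\<^sup>2 \<partial>Q) + (\<integral>z. (X i z)\<^sup>2 \<partial>Q)) + \<bar>K\<bar> * (\<integral>z. \<bar>F z\<bar> \<partial>Q) + (\<integral>z. \<bar>Z z\<bar> \<partial>Q)"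
  have bd: "(\<integral>z. \<bar>kk \<sigma> z\<bar> \<partial>Q) \<le> M" for \<sigma>
  proof -
    let ?R = "\<lambda>z. (\<Sum>i\<in>UNIV. (Hc i (fst z - \<sigma>, snd z))\<^sup>2 + (X i z)\<^sup>2) + \<bar>K\<bar> * \<bar>F (fst z - \<sigma>, snd z)\<bar> + \<bar>Z z\<bar>"
    have "(\<integral>z. \<bar>kk \<sigma> z\<bar> \<partial>Q) \<le> (\<integral>z. ?R z \<partial>Q)"
    proof (rule integral_mono)
      show "integrable Q ?R"
        by (intro Bochner_Integration.integrable_add Bochner_Integration.integrable_sum shH X2
            integrable_mult_right integrable_abs shF Z)
      fix z assume z: "z \<in> space Q"
      have "\<bar>\<Sum>i\<in>UNIV. Hc i (fst z - \<sigma>, snd z) * X i z\<bar> \<le> (\<Sum>i\<in>UNIV. (Hc i (fst z - \<sigma>, snd z))\<^sup>2 + (X i z)\<^sup>2)"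
        by (rule order_trans[OF sum_abs sum_mono]) (rule abs_mult_le_sum_squares)
      moreover have "\<bar>F (fst z - \<sigma>, snd z) * Y z\<bar> \<le> \<bar>K\<bar> * \<bar>F (fst z - \<sigma>, snd z)\<bar>"
        using Y[OF z] by (simp add: abs_mult mult.commute mult_right_mono)
      ultimately show "\<bar>kk \<sigma> z\<bar> \<le> ?R z" unfolding kk_def by linarith
    qed (use ikk in auto)
    also have "\<dots> = M"
      using shH X2 shF F' shF' Z by (simp add: M_def Bochner_Integration.integral_sum)
    finally show ?thesis .
  qed
  define k2 where "k2 h p = indicator {0..<1} (fst p) * (\<integral>x. kk (h * fst p) (snd p, x) \<partial>N)" for h and p :: "real \<times> real"
  define J where "J \<sigma> = (\<integral>z. kk \<sigma> z \<partial>Q)" for \<sigma>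
  have Jb: "\<bar>J \<sigma>\<bar> \<le> M" for \<sigma> unfolding J_def using integral_abs_bound[of Q "kk \<sigma>"] bd[of \<sigma>] by linarith
  have k2m: "k2 h \<in> borel_measurable (lborel \<Otimes>\<^sub>M lborel)" for h
  proof -
    have sh: "(\<lambda>w. (snd (fst w) - h * fst (fst w), snd w)) \<in> (lborel \<Otimes>\<^sub>M lborel) \<Otimes>\<^sub>M N \<rightarrow>\<^sub>M Q"
      and sh0: "(\<lambda>w. (snd (fst w), snd w)) \<in> (lborel \<Otimes>\<^sub>M lborel) \<Otimes>\<^sub>M N \<rightarrow>\<^sub>M Q" by measurable
    note [measurable] = measurable_compose[OF sh Hm] measurable_compose[OF sh Fm] measurable_compose[OF sh0 Xm]
      measurable_compose[OF sh0 Ym] measurable_compose[OF sh0 Zm]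
    have "(\<lambda>w. kk (h * fst (fst w)) (snd (fst w), snd w)) \<in> borel_measurable ((lborel \<Otimes>\<^sub>M lborel) \<Otimes>\<^sub>M N)"
      unfolding kk_def fst_conv snd_conv by measurable
    then have "(\<lambda>p. \<integral>x. kk (h * fst p) (snd p, x) \<partial>N) \<in> borel_measurable (lborel \<Otimes>\<^sub>M lborel)"
      by (intro borel_measurable_lebesgue_integral) (simp add: split_beta')
    moreover have "(\<lambda>p :: real \<times> real. indicator {0..<1} (fst p) :: real) \<in> borel_measurable (lborel \<Otimes>\<^sub>M lborel)" by measurable
    ultimately show ?thesis unfolding k2_def by (rule borel_measurable_times[rotated])
  qed
  have fstJ: "integrable lborel (\<lambda>r. \<integral>x. kk \<sigma> (r, x) \<partial>N)" "(\<integral>r. \<integral>x. kk \<sigma> (r, x) \<partial>N \<partial>lborel) = J \<sigma>" for \<sigma>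
    unfolding J_def using QP.integrable_fst'[OF ikk] QP.integral_fst'[OF ikk] by auto
  have k2i: "integrable (lborel \<Otimes>\<^sub>M lborel) (k2 h)" for h
  proof (rule lborel_pair.Fubini_integrable[OF k2m])
    show "AE \<theta> in lborel. integrable lborel (\<lambda>r. k2 h (\<theta>, r))"
      using fstJ(1) by (simp add: k2_def)
    show "integrable lborel (\<lambda>\<theta>. \<integral>r. norm (k2 h (\<theta>, r)) \<partial>lborel)"
    proof (rule Bochner_Integration.integrable_bound[of _ "\<lambda>\<theta>. indicator {0..<1} \<theta> * M"])
      show "integrable lborel (\<lambda>\<theta>::real. indicator {0..<1} \<theta> * M)"
        by (intro integrable_mult_left integrable_real_indicator) auto
      show "(\<lambda>\<theta>. \<integral>r. norm (k2 h (\<theta>, r)) \<partial>lborel) \<in> borel_measurable lborel"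
        by (intro lborel.borel_measurable_lebesgue_integral) (use k2m in \<open>simp add: split_beta'\<close>)
      show "AE \<theta> in lborel. norm (\<integral>r. norm (k2 h (\<theta>, r)) \<partial>lborel) \<le> norm (indicator {0..<1} \<theta> * M)"
      proof (rule always_eventually, rule allI)
        fix \<theta>
        have a: "integrable Q (\<lambda>z. \<bar>kk (h * \<theta>) z\<bar>)" using ikk by simp
        have "(\<integral>r. \<bar>\<integral>x. kk (h * \<theta>) (r, x) \<partial>N\<bar> \<partial>lborel) \<le> (\<integral>r. \<integral>x. \<bar>kk (h * \<theta>) (r, x)\<bar> \<partial>N \<partial>lborel)"
          by (rule integral_mono) (use fstJ(1) QP.integrable_fst'[OF a] integral_abs_bound in auto)
        also have "\<dots> \<le> M" unfolding QP.integral_fst'[OF a] by (rule bd)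
        finally show "norm (\<integral>r. norm (k2 h (\<theta>, r)) \<partial>lborel) \<le> norm (indicator {0..<1} \<theta> * M)"
          using abs_ge_self[of M] by (auto simp: k2_def indicator_def integral_nonneg_AE)
      qed
    qed
  qed
  have k2i': "integrable (lborel \<Otimes>\<^sub>M lborel) (\<lambda>(\<theta>, r). k2 h (\<theta>, r))" for h using k2i[of h] by simp
  show "integrable lborel (\<lambda>r. \<integral>\<theta>. indicator {0..<1} \<theta> * (\<integral>x. kk (h * \<theta>) (r, x) \<partial>N) \<partial>lborel)"
    using lborel_pair.integrable_snd[OF k2i'[of h]] by (simp add: k2_def)
  have "(\<integral>r. (\<integral>\<theta>. indicator {0..<1} \<theta> * (\<integral>x. kk (h * \<theta>) (r, x) \<partial>N) \<partial>lborel) \<partial>lborel)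
     = (\<integral>\<theta>. (\<integral>r. indicator {0..<1} \<theta> * (\<integral>x. kk (h * \<theta>) (r, x) \<partial>N) \<partial>lborel) \<partial>lborel)"
    using lborel_pair.Fubini_integral[OF k2i'[of h]] by (simp add: k2_def)
  also have "\<dots> = (\<integral>\<theta>. indicator {0..<1} \<theta> * J (h * \<theta>) \<partial>lborel)"
    using fstJ(2) by simp
  finally show "(\<integral>r. (\<integral>\<theta>. indicator {0..<1} \<theta> * (\<integral>x. kk (h * \<theta>) (r, x) \<partial>N) \<partial>lborel) \<partial>lborel)
        = (\<integral>\<theta>. indicator {0..<1} \<theta> * (\<integral>z. kk (h * \<theta>) z \<partial>Q) \<partial>lborel)" unfolding J_def .
  have Jlim: "(\<lambda>n. J (s n)) \<longlonglongrightarrow> J 0" if s: "s \<longlonglongrightarrow> 0" for s :: "nat \<Rightarrow> real"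
  proof -
    have d1: "(\<lambda>n. \<integral>z. (Hc i (fst z - s n, snd z) - Hc i z) * X i z \<partial>Q) \<longlonglongrightarrow> 0" for i
      by (rule tendsto_0_integral_mult) (use time_translation_L2[OF Hm H2 s] X2 in auto)
    have d2: "(\<lambda>n. \<integral>z. (F (fst z - s n, snd z) - F z) * Y z \<partial>Q) \<longlonglongrightarrow> 0"
    proof (rule tendsto_rabs_zero_cancel, rule tendsto_sandwich[OF _ _ tendsto_const])
      show "(\<lambda>n. (\<integral>z. \<bar>F (fst z - s n, snd z) - F z\<bar> \<partial>Q) * \<bar>K\<bar>) \<longlonglongrightarrow> 0"
        using tendsto_mult_right[OF time_translation_L1[OF F s], of "\<bar>K\<bar>"] by simp
      have "\<bar>\<integral>z. (F (fst z - s n, snd z) - F z) * Y z \<partial>Q\<bar> \<le> (\<integral>z. \<bar>F (fst z - s n, snd z) - F z\<bar> * \<bar>K\<bar> \<partial>Q)" for n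
      proof (rule integral_abs_bound[THEN order_trans], rule integral_mono)
        show "integrable Q (\<lambda>z. \<bar>(F (fst z - s n, snd z) - F z) * Y z\<bar>)"
          by (intro integrable_abs integrable_mult_bounded[OF _ Ym Y] Bochner_Integration.integrable_diff shF F)
        show "integrable Q (\<lambda>z. \<bar>F (fst z - s n, snd z) - F z\<bar> * \<bar>K\<bar>)" using shF F by auto
        show "\<bar>(F (fst z - s n, snd z) - F z) * Y z\<bar> \<le> \<bar>F (fst z - s n, snd z) - F z\<bar> * \<bar>K\<bar>" if "z \<in> space Q" for z
          using Y[OF that] by (simp add: abs_mult mult_left_mono)
      qed
      then show "\<forall>\<^sub>F n in sequentially. \<bar>\<integral>z. (F (fst z - s n, snd z) - F z) * Y z \<partial>Q\<bar> \<le> (\<integral>z. \<bar>F (fst z - s n, snd z) - F z\<bar> \<partial>Q) * \<bar>K\<bar>"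
        by simp
    qed simp
    have eq: "J (s n) - J 0 = (\<Sum>i\<in>UNIV. \<integral>z. (Hc i (fst z - s n, snd z) - Hc i z) * X i z \<partial>Q) + (\<integral>z. (F (fst z - s n, snd z) - F z) * Y z \<partial>Q)" for n
    proof -
      have "J (s n) - J 0 = (\<integral>z. kk (s n) z - kk 0 z \<partial>Q)" unfolding J_def using ikk by simp
      also have "\<dots> = (\<integral>z. (\<Sum>i\<in>UNIV. (Hc i (fst z - s n, snd z) - Hc i z) * X i z) + (F (fst z - s n, snd z) - F z) * Y z \<partial>Q)"
        by (rule Bochner_Integration.integral_cong[OF refl]) (simp add: kk_def left_diff_distrib sum_subtractf)
      also have "\<dots> = (\<Sum>i\<in>UNIV. \<integral>z. (Hc i (fst z - s n, snd z) - Hc i z) * X i z \<partial>Q) + (\<integral>z. (F (fst z - s n, snd z) - F z) * Y z \<partial>Q)"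
      proof -
        have "integrable Q (\<lambda>z. (Hc i (fst z - s n, snd z) - Hc i z) * X i z)" for i
          unfolding left_diff_distrib using iHX[of i "s n"] iHX[of i 0] by simp
        moreover have "integrable Q (\<lambda>z. (F (fst z - s n, snd z) - F z) * Y z)"
          unfolding left_diff_distrib using iFY[of "s n"] iFY[of 0] by simp
        ultimately show ?thesis by (simp add: Bochner_Integration.integral_sum)
      qed
      finally show ?thesis .
    qed
    have "(\<lambda>n. J (s n) - J 0) \<longlonglongrightarrow> (\<Sum>i\<in>(UNIV::'n set). 0) + 0"
      unfolding eq by (intro tendsto_add tendsto_sum d1 d2)
    then show ?thesis by (simp add: LIM_zero_iff)
  qed
  show "(\<lambda>n::nat. \<integral>\<theta>. indicator {0..<1} \<theta> * (\<integral>z. kk (hs n * \<theta>) z \<partial>Q) \<partial>lborel) \<longlonglongrightarrow> (\<integral>z. kk 0 z \<partial>Q)"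
    if hs: "hs \<longlonglongrightarrow> 0"
  proof -
    have i1: "integrable lborel (indicator {0..<1} :: real \<Rightarrow> real)" by (rule integrable_real_indicator) auto
    have "(\<lambda>n. \<integral>\<theta>. indicator {0..<1} \<theta> * J (hs n * \<theta>) \<partial>lborel) \<longlonglongrightarrow> (\<integral>\<theta>. indicator {0..<1::real} \<theta> * J 0 \<partial>lborel)"
    proof (rule integral_dominated_convergence[where w="\<lambda>\<theta>. indicator {0..<1} \<theta> * M"])
      show "integrable lborel (\<lambda>\<theta>::real. indicator {0..<1} \<theta> * M)" using i1 by simp
      show "(\<lambda>\<theta>. indicator {0..<1} \<theta> * J (hs n * \<theta>)) \<in> borel_measurable lborel" for n
        using borel_measurable_integrable[OF lborel_pair.integrable_fst'[OF k2i[of "hs n"]]] fstJ(2)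
        by (simp add: k2_def)
      show "AE \<theta> in lborel. (\<lambda>n. indicator {0..<1} \<theta> * J (hs n * \<theta>)) \<longlonglongrightarrow> indicator {0..<1} \<theta> * J 0"
      proof (rule always_eventually, rule allI)
        fix \<theta> show "(\<lambda>n. indicator {0..<1} \<theta> * J (hs n * \<theta>)) \<longlonglongrightarrow> indicator {0..<1} \<theta> * J 0"
          by (intro tendsto_intros Jlim) (use tendsto_mult_left_zero[OF hs, of \<theta>] in simp)
      qed
      show "AE \<theta> in lborel. norm (indicator {0..<1} \<theta> * J (hs n * \<theta>)) \<le> indicator {0..<1} \<theta> * M" for n
        using Jb by (auto simp: indicator_def)
    qed auto
    then show ?thesis unfolding J_def by simp
  qed
qed

end

section \<open>The energy inequality\<close>

text \<open>The averages are formed with a function \<open>M\<close> that agrees with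
  \<open>m\<close> only almost everywhere, which is how a Borel representative recovers the value of
  the continuous solution at an exact time.\<close>

lemma left_average_tendsto:
  fixes M m :: "real \<Rightarrow> real"
  assumes h: "\<And>n. 0 < h n" "h \<longlonglongrightarrow> 0"
    and i: "\<And>n. integrable lborel (\<lambda>t. indicator {c - h n..<c} t * M t)"
    and ae: "\<And>n. AE t in lborel. t \<in> {c - h n..<c} \<longrightarrow> M t = m t"
    and m: "(m \<longlongrightarrow> m c) (at_left c)"
  shows "(\<lambda>n::nat. (\<integral>t. indicator {c - h n..<c} t * M t \<partial>lborel) / h n) \<longlonglongrightarrow> m c"
proof (rule tendstoI)
  fix e :: real assume e: "e > 0"
  from tendstoD[OF m, of "e/2"] e have "\<forall>\<^sub>F t in at_left c. dist (m t) (m c) < e/2" by simp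
  then obtain b where b: "b < c" "\<And>t. b < t \<Longrightarrow> t < c \<Longrightarrow> dist (m t) (m c) < e/2"
    unfolding eventually_at_left_field by auto
  have "\<forall>\<^sub>F n in sequentially. h n < c - b" using h(2) b by (intro order_tendstoD(2)) auto
  then show "\<forall>\<^sub>F n in sequentially. dist ((\<integral>t. indicator {c - h n..<c} t * M t \<partial>lborel) / h n) (m c) < e"
  proof eventually_elim
    case (elim n)
    let ?i = "indicator {c - h n..<c} :: real \<Rightarrow> real"
    have ii: "integrable lborel ?i" using h(1)[of n] by (intro integrable_real_indicator) auto
    have v: "(\<integral>t. ?i t \<partial>lborel) = h n" using h(1)[of n] by simp
    have "(\<integral>t. ?i t * M t \<partial>lborel) - h n * m c = (\<integral>t. ?i t * M t - ?i t * m c \<partial>lborel)"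
      using i[of n] ii v by simp
    also have "\<bar>\<dots>\<bar> \<le> (\<integral>t. ?i t * (e/2) \<partial>lborel)"
    proof (rule integral_abs_bound[THEN order_trans], rule integral_mono_AE)
      show "AE t in lborel. \<bar>?i t * M t - ?i t * m c\<bar> \<le> ?i t * (e/2)"
        using ae[of n]
      proof eventually_elim
        case (elim t)
        show ?case
        proof (cases "t \<in> {c - h n..<c}")
          case True
          then have "dist (m t) (m c) < e/2" using \<open>h n < c - b\<close> by (intro b) auto
          with True elim show ?thesis by (simp add: dist_real_def)
        qed simp
      qed
    qed (use i[of n] ii in auto)
    also have "\<dots> = h n * (e/2)" using v by simp
    finally have "\<bar>(\<integral>t. ?i t * M t \<partial>lborel) - h n * m c\<bar> \<le> h n * (e/2)" .
    then have "\<bar>(\<integral>t. ?i t * M t \<partial>lborel) / h n - m c\<bar> \<le> e/2"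
      using h(1)[of n] by (simp add: field_simps abs_le_iff)
    then show ?case using e by (simp add: dist_real_def)
  qed
qed

text \<open>
  \<open>U\<close> and \<open>H\<close> are Borel representatives of the solution \<open>u\<close> and of its gradient on \<open>(0, T)\<close>. The test function \<open>\<phi>\<close>,
  with time derivative \<open>\<phi>t\<close> and gradient \<open>D\<phi>\<close>, solves the backward heat equation up to time \<open>b\<close>.
\<close>

locale energy_setting = bounded_open \<Omega> for \<Omega> :: "(real^'n::finite) set" +
  fixes T a b K C2 :: real and f :: "real \<Rightarrow> real" and g :: "real^'n \<Rightarrow> real"
    and u :: "real \<Rightarrow> real^'n \<Rightarrow> real"
    and U :: "real \<times> (real^'n) \<Rightarrow> real" and H :: "real \<times> (real^'n) \<Rightarrow> real^'n"
    and \<phi> \<phi>t :: "real \<times> (real^'n) \<Rightarrow> real" and D\<phi> :: "'n \<Rightarrow> real \<times> (real^'n) \<Rightarrow> real"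
  assumes ab: "0 < a" "a < b" "b < T"
    and uc: "continuous_L2 \<Omega> u"
    and fm [measurable]: "f \<in> borel_measurable borel"
    and C2: "0 \<le> C2" "\<And>s. - C2 \<le> f s * s"
    and g: "integrable N g"
    and Um [measurable]: "U \<in> borel_measurable borel"
    and Hm [measurable]: "\<And>i. (\<lambda>z. H z $ i) \<in> borel_measurable borel"
    and QU: "integrable Q (\<lambda>z. (U z)\<^sup>2)" and QH: "\<And>i. integrable Q (\<lambda>z. (H z $ i)\<^sup>2)"
    and QF: "integrable Q (\<lambda>z. indicator {0<..<T} (fst z) * f (U z))"
    and slice: "AE t in lborel. t \<in> {0<..<T} \<longrightarrow> (AE x in N. U (t, x) = u t x) \<and> H10_on \<Omega> (\<lambda>x. U (t, x)) (\<lambda>x. H (t, x))"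
    and key: "\<And>v Gv C s t. H10_on \<Omega> v Gv \<Longrightarrow> (\<And>x. x \<in> \<Omega> \<Longrightarrow> \<bar>v x\<bar> \<le> C) \<Longrightarrow> 0 < s \<Longrightarrow> s < t \<Longrightarrow> t < T \<Longrightarrow>
      (\<integral>x. u t x * v x \<partial>N) - (\<integral>x. u s x * v x \<partial>N) =
      - (\<integral>r. indicator {s<..t} r * (\<integral>x. H (r, x) \<bullet> Gv x + f (U (r, x)) * v x - g x * v x \<partial>N) \<partial>lborel)"
    and \<phi>m [measurable]: "\<phi> \<in> borel_measurable borel" "\<phi>t \<in> borel_measurable borel" "\<And>i. D\<phi> i \<in> borel_measurable borel"
    and \<phi>b: "\<And>t x. t \<in> {0..b} \<Longrightarrow> x \<in> \<Omega> \<Longrightarrow> \<bar>\<phi> (t, x)\<bar> \<le> K"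
      "\<And>t x. t \<in> {0..b} \<Longrightarrow> x \<in> \<Omega> \<Longrightarrow> \<bar>\<phi>t (t, x)\<bar> \<le> K"
      "\<And>t x i. t \<in> {0..b} \<Longrightarrow> x \<in> \<Omega> \<Longrightarrow> \<bar>D\<phi> i (t, x)\<bar> \<le> K"
    and \<phi>0: "\<And>t x. t \<in> {0..b} \<Longrightarrow> 0 \<le> \<phi> (t, x)"
    and \<phi>s: "\<And>t. t \<in> {0..b} \<Longrightarrow> smooth_Rn (\<lambda>x. \<phi> (t, x))"
    and \<phi>d: "\<And>t i. t \<in> {0..b} \<Longrightarrow> partial i (\<lambda>x. \<phi> (t, x)) = (\<lambda>x. D\<phi> i (t, x))"
    and \<phi>L: "\<And>t x. t \<in> {0..b} \<Longrightarrow> (\<Sum>i\<in>UNIV. partial i (\<lambda>x. D\<phi> i (t, x)) x) = - \<phi>t (t, x)"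
    and \<phi>\<tau>: "\<And>t x. t \<in> {0..b} \<Longrightarrow> x \<in> \<Omega> \<Longrightarrow> ((\<lambda>t. \<phi> (t, x)) has_real_derivative \<phi>t (t, x)) (at t)"
begin

lemma K_nonneg: "x \<in> \<Omega> \<Longrightarrow> 0 \<le> K"
  using \<phi>b(1)[of 0 x] ab by fastforce

lemma space_Q_snd: "z \<in> space Q \<Longrightarrow> snd z \<in> \<Omega>"
  by (auto simp: space_pair_measure)

lemma mQ [measurable]: "U \<in> borel_measurable Q" "(\<lambda>z. H z $ i) \<in> borel_measurable Q"
  "\<phi> \<in> borel_measurable Q" "\<phi>t \<in> borel_measurable Q" "D\<phi> i \<in> borel_measurable Q"
  by (auto intro!: borel_imp_measurable_Q)

lemma mgQ [measurable]: "g \<in> borel_measurable N" using g by simp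

definition V where "V z = \<phi> z * dhyp (U z)"
definition DV where "DV z = (\<chi> i. \<phi> z * rsq (U z) ^ 3 * H z $ i + dhyp (U z) * D\<phi> i z)"

lemma V_bound: "t \<in> {0..b} \<Longrightarrow> x \<in> \<Omega> \<Longrightarrow> \<bar>V (t, x)\<bar> \<le> K"
  unfolding V_def abs_mult
  using mult_mono[OF \<phi>b(1) abs_dhyp_le, of t x "U (t, x)"] K_nonneg by simp

lemma V_H10:
  assumes "H10_on \<Omega> (\<lambda>x. U (t, x)) (\<lambda>x. H (t, x))" "t \<in> {0..b}"
  shows "H10_on \<Omega> (\<lambda>x. V (t, x)) (\<lambda>x. DV (t, x))"
  using H10_on_mult_compose[OF assms(1) \<phi>s[OF assms(2)] dhyp_0 smooth_Rn_dhyp DERIV_dhyp abs_rsq_cube_le continuous_on_rsq_cube]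
  unfolding V_def DV_def \<phi>d[OF assms(2)] .

lemma u_meas: "t \<ge> 0 \<Longrightarrow> u t \<in> borel_measurable N" and u_int: "t \<ge> 0 \<Longrightarrow> integrable N (u t)"
  using continuous_L2_sq(1,2)[OF uc] square_integrable_imp_integrable by auto

lemma hyp_u_int: "t \<ge> 0 \<Longrightarrow> integrable N (\<lambda>x. hyp (u t x))"
  by (rule Bochner_Integration.integrable_bound[OF u_int])
    (use u_meas hyp_le_abs hyp_nonneg in \<open>auto simp: abs_of_nonneg\<close>)

lemma \<phi>N: "(\<lambda>x. \<phi> (t, x)) \<in> borel_measurable N" by (rule borel_slice) simp

lemma \<phi>_hyp_int: "t \<ge> 0 \<Longrightarrow> r \<in> {0..b} \<Longrightarrow> integrable N (\<lambda>x. \<phi> (r, x) * hyp (u t x))"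
  using integrable_mult_bounded[OF hyp_u_int \<phi>N, of t r K] \<phi>b(1) by (simp add: mult.commute)

text \<open>
  The equation is tested with \<open>\<phi> r * dhyp (u r)\<close> at the later time \<open>r\<close>; convexity of \<open>hyp\<close> is what makes a
  backward difference suffice.
\<close>

lemma slice_ineq:
  assumes h: "0 < h" "h < a"
  shows "AE r in lborel. r \<in> {a..<b} \<longrightarrow>
    (\<integral>x. \<phi> (r, x) * hyp (u r x) - \<phi> (r, x) * hyp (u (r - h) x) \<partial>N) \<le>
    - (\<integral>s. indicator {r-h<..r} s * (\<integral>x. H (s, x) \<bullet> DV (r, x) + f (U (s, x)) * V (r, x) - g x * V (r, x) \<partial>N) \<partial>lborel)"
  using slice
proof eventually_elim
  case (elim r)
  show ?case
  proof
    assume r: "r \<in> {a..<b}"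
    then have rb: "r \<in> {0..b}" and rT: "r \<in> {0<..<T}" using ab by auto
    from elim rT have eq: "AE x in N. U (r, x) = u r x" and H10: "H10_on \<Omega> (\<lambda>x. U (r, x)) (\<lambda>x. H (r, x))" by auto
    have r0: "r \<ge> 0" "r - h \<ge> 0" "0 < r - h" "r < T" using r h ab by auto
    \<comment> \<open>With the time \<open>r\<close> frozen, \<open>V\<close> becomes a fixed
      bounded spatial function with zero boundary values, although it depends on the solution; this
      is what \<open>key\<close> accepts.\<close>
    note V10 = V_H10[OF H10 rb]
    have Vm: "(\<lambda>x. V (r, x)) \<in> borel_measurable N" and V2: "integrable N (\<lambda>x. (V (r, x))\<^sup>2)"
      using V10 by (auto simp: H10_on_def H1_on_def Lp_on_2)
    have i: "integrable N (\<lambda>x. u t x * V (r, x))" if "t \<ge> 0" for t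
      by (rule integrable_mult_bounded[OF u_int[OF that] Vm]) (use V_bound[OF rb] in auto)
    have "(\<integral>x. \<phi> (r, x) * hyp (u r x) - \<phi> (r, x) * hyp (u (r - h) x) \<partial>N) \<le> (\<integral>x. u r x * V (r, x) - u (r - h) x * V (r, x) \<partial>N)"
    proof (rule integral_mono_AE)
      show "AE x in N. \<phi> (r, x) * hyp (u r x) - \<phi> (r, x) * hyp (u (r - h) x) \<le> u r x * V (r, x) - u (r - h) x * V (r, x)"
        using eq
      proof eventually_elim
        case (elim x)
        have "\<phi> (r, x) * (hyp (u r x) - hyp (u (r - h) x)) \<le> \<phi> (r, x) * (dhyp (u r x) * (u r x - u (r - h) x))"
          by (rule mult_left_mono[OF hyp_convex \<phi>0[OF rb]])
        then show ?case by (simp add: V_def elim algebra_simps)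
      qed
    qed (use \<phi>_hyp_int rb r0 i in auto)
    also have "\<dots> = (\<integral>x. u r x * V (r, x) \<partial>N) - (\<integral>x. u (r - h) x * V (r, x) \<partial>N)" using i r0 by simp
    also have "\<dots> = - (\<integral>s. indicator {r-h<..r} s * (\<integral>x. H (s, x) \<bullet> DV (r, x) + f (U (s, x)) * V (r, x) - g x * V (r, x) \<partial>N) \<partial>lborel)"
      by (rule key[OF V10 V_bound[OF rb]]) (use r0 h in auto)
    finally show "(\<integral>x. \<phi> (r, x) * hyp (u r x) - \<phi> (r, x) * hyp (u (r - h) x) \<partial>N) \<le> \<dots>" .
  qed
qed

text \<open>
  In \<open>kk \<sigma>\<close> the gradient and the nonlinearity at the earlier time \<open>t - \<sigma>\<close> are paired with the test function of time \<open>t\<close>.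
\<close>

definition w :: "real \<times> (real^'n) \<Rightarrow> real" where "w z = indicator {a..<b} (fst z)"
definition F where "F z = indicator {0<..<T} (fst z) * f (U z)"
definition kk where "kk \<sigma> z = (\<Sum>i\<in>UNIV. H (fst z - \<sigma>, snd z) $ i * (w z * DV z $ i))
    + F (fst z - \<sigma>, snd z) * (w z * V z) - w z * (g (snd z) * V z)"

lemma w_meas [measurable]: "w \<in> borel_measurable Q" unfolding w_def by measurable
lemma V_meas [measurable]: "V \<in> borel_measurable Q" unfolding V_def by measurable
lemma DV_meas [measurable]: "(\<lambda>z. DV z $ i) \<in> borel_measurable Q" unfolding DV_def by simp measurable

lemma wV_bound: "z \<in> space Q \<Longrightarrow> \<bar>w z * V z\<bar> \<le> K"
  using V_bound[of "fst z" "snd z"] K_nonneg[of "snd z"] space_Q_snd[of z] ab by (auto simp: w_def indicator_def)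

lemma ind_int: "integrable lborel (indicator {0<..<T} :: real \<Rightarrow> real)" "integrable lborel (indicator {a..<b} :: real \<Rightarrow> real)"
  using ab by (auto intro!: integrable_real_indicator)

lemma one_int_Q: "integrable Q (\<lambda>z. indicator {0<..<T} (fst z) :: real)"
  using integrable_Q_product[OF ind_int(1), of "\<lambda>_. 1"] by simp

lemma hypU_int: "integrable Q (\<lambda>z. indicator {0<..<T} (fst z) * hyp (U z))"
proof (rule Bochner_Integration.integrable_bound[OF Bochner_Integration.integrable_add[OF one_int_Q QU]])
  have "hyp (U z) \<le> 1 + (U z)\<^sup>2" for z
  proof -
    have "\<bar>U z\<bar> \<le> 1 + (U z)\<^sup>2" using sum_squares_bound[of 1 "\<bar>U z\<bar>"] by simp
    with hyp_le_abs[of "U z"] show ?thesis by linarith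
  qed
  then show "AE z in Q. norm (indicator {0<..<T} (fst z) * hyp (U z)) \<le> norm (indicator {0<..<T} (fst z) + (U z)\<^sup>2)"
    using hyp_nonneg by (intro AE_I2) (auto simp: indicator_def)
qed measurable

lemma hypU_mult_int:
  assumes S: "S \<in> sets borel" "S \<subseteq> {0<..<T}" and [measurable]: "Y \<in> borel_measurable Q"
    and b: "\<And>z. z \<in> space Q \<Longrightarrow> fst z \<in> S \<Longrightarrow> \<bar>Y z\<bar> \<le> C"
  shows "integrable Q (\<lambda>z. indicator S (fst z) * (Y z * hyp (U z)))"
proof -
  note [measurable] = S(1)
  have "integrable Q (\<lambda>z. indicator {0<..<T} (fst z) * hyp (U z) * (indicator S (fst z) * Y z))"
    by (rule integrable_mult_bounded[OF hypU_int, of _ "\<bar>C\<bar>"]) (use b in \<open>force simp: indicator_def\<close>)+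
  moreover have "indicator {0<..<T} (fst z) * hyp (U z) * (indicator S (fst z) * Y z) = indicator S (fst z) * (Y z * hyp (U z))" for z
    using S(2) by (auto simp: indicator_def)
  ultimately show ?thesis by simp
qed

lemma DV_sq_int: "integrable Q (\<lambda>z. (w z * DV z $ i)\<^sup>2)"
proof (rule Bochner_Integration.integrable_bound)
  show "integrable Q (\<lambda>z. 3 * (K\<^sup>2 * (H z $ i)\<^sup>2 + K\<^sup>2 * indicator {0<..<T} (fst z) + 0))"
    using QH[of i] one_int_Q by simp
  show "AE z in Q. norm ((w z * DV z $ i)\<^sup>2) \<le> norm (3 * (K\<^sup>2 * (H z $ i)\<^sup>2 + K\<^sup>2 * indicator {0<..<T} (fst z) + 0))"
  proof (rule AE_I2)
    fix z assume z: "z \<in> space Q"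
    show "norm ((w z * DV z $ i)\<^sup>2) \<le> norm (3 * (K\<^sup>2 * (H z $ i)\<^sup>2 + K\<^sup>2 * indicator {0<..<T} (fst z) + 0))"
    proof (cases "fst z \<in> {a..<b}")
      case True
      then have t: "fst z \<in> {0..b}" "fst z \<in> {0<..<T}" using ab by auto
      have p1: "\<bar>\<phi> z\<bar> \<le> K" and p2: "\<bar>D\<phi> i z\<bar> \<le> K" using \<phi>b(1,3)[OF t(1) space_Q_snd[OF z]] by auto
      have "\<bar>\<phi> z * rsq (U z) ^ 3 * H z $ i\<bar> \<le> K * 1 * \<bar>H z $ i\<bar>"
        unfolding abs_mult by (intro mult_mono p1 abs_rsq_cube_le) (use p1 in auto)
      then have "\<bar>\<phi> z * rsq (U z) ^ 3 * H z $ i\<bar>\<^sup>2 \<le> (K * 1 * \<bar>H z $ i\<bar>)\<^sup>2" by (rule power_mono) simp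
      then have 1: "(\<phi> z * rsq (U z) ^ 3 * H z $ i)\<^sup>2 \<le> K\<^sup>2 * (H z $ i)\<^sup>2" by (simp add: power_mult_distrib)
      have "\<bar>dhyp (U z) * D\<phi> i z\<bar> \<le> 1 * K"
        unfolding abs_mult by (intro mult_mono p2 abs_dhyp_le) auto
      then have "\<bar>dhyp (U z) * D\<phi> i z\<bar>\<^sup>2 \<le> (1 * K)\<^sup>2" by (rule power_mono) simp
      then have 2: "(dhyp (U z) * D\<phi> i z)\<^sup>2 \<le> K\<^sup>2" by simp
      have "(\<phi> z * rsq (U z) ^ 3 * H z $ i + dhyp (U z) * D\<phi> i z + 0)\<^sup>2 \<le> 3 * (K\<^sup>2 * (H z $ i)\<^sup>2 + K\<^sup>2 + 0)"
        by (rule power2_sum3_le'[OF 1 2]) simp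
      with True t show ?thesis by (simp add: w_def DV_def)
    next
      case False then show ?thesis by (simp add: w_def)
    qed
  qed
qed measurable

lemma gV_int: "integrable Q (\<lambda>z. w z * (g (snd z) * V z))"
proof -
  have "integrable Q (\<lambda>z. (indicator {a..<b} (fst z) * g (snd z)) * (w z * V z))"
    by (rule integrable_mult_bounded[OF integrable_Q_product[OF ind_int(2) g] _ wV_bound]) measurable
  moreover have "(indicator {a..<b} (fst z) * g (snd z)) * (w z * V z) = w z * (g (snd z) * V z)" for z
    by (auto simp: w_def indicator_def)
  ultimately show ?thesis by simp
qed

lemma F_int: "integrable Q F" unfolding F_def by (rule QF)

end

text \<open>Lets one time \<open>r\<close> be good for the slice property at \<open>r\<close> and at
  \<open>r - h\<close> simultaneously.\<close>

lemma AE_lborel_shift: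
  fixes P :: "real \<Rightarrow> bool"
  assumes "AE t in lborel. P t"
  shows "AE t in lborel. P (t - h)"
proof -
  obtain N where N: "{t. \<not> P t} \<subseteq> N" "N \<in> null_sets lborel"
    using assms unfolding eventually_ae_filter by auto
  then have [measurable]: "N \<in> sets borel" by auto
  have "AE t in lborel. t \<notin> N" using N(2) by (rule AE_not_in)
  then have "AE t in lborel. - h + 1 * t \<notin> N" by (intro AE_borel_affine) measurable
  then show ?thesis by eventually_elim (use N(1) in auto)
qed

section \<open>One backward time step, and the limit of vanishing step size\<close>

context energy_setting
begin

lemma wV_meas: "(\<lambda>z. w z * V z) \<in> borel_measurable Q" and wDV_meas: "(\<lambda>z. w z * DV z $ i) \<in> borel_measurable Q"
  by measurable

lemma kk_facts:
  shows "integrable Q (kk \<sigma>)"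
    and "integrable lborel (\<lambda>r. \<integral>\<theta>. indicator {0..<1} \<theta> * (\<integral>x. kk (h * \<theta>) (r, x) \<partial>N) \<partial>lborel)"
    and "(\<integral>r. (\<integral>\<theta>. indicator {0..<1} \<theta> * (\<integral>x. kk (h * \<theta>) (r, x) \<partial>N) \<partial>lborel) \<partial>lborel)
        = (\<integral>\<theta>. indicator {0..<1} \<theta> * (\<integral>z. kk (h * \<theta>) z \<partial>Q) \<partial>lborel)"
    and "hs \<longlonglongrightarrow> 0 \<Longrightarrow> (\<lambda>n::nat. \<integral>\<theta>. indicator {0..<1} \<theta> * (\<integral>z. kk (hs n * \<theta>) z \<partial>Q) \<partial>lborel) \<longlonglongrightarrow> (\<integral>z. kk 0 z \<partial>Q)"
  using shifted_pairing[OF mQ(2) wDV_meas wV_meas QH DV_sq_int F_int wV_bound gV_int] unfolding kk_def[abs_def]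
  by auto

text \<open>The slice inequality integrated over \<open>r\<close> in \<open>[a, b)\<close>. On the
  left the time shift is moved from \<open>U\<close> onto \<open>\<phi>\<close> and the window, a
  discrete integration by parts; on the right the window of length \<open>h\<close> contributes the
  factor \<open>h\<close>.\<close>

lemma time_step:
  assumes h: "0 < h" "h < a" "h < b - a"
  shows "integrable Q (\<lambda>z. indicator {a-h..<b-h} (fst z) * (\<phi> (fst z + h, snd z) * hyp (U z)))"
    and "(\<integral>z. w z * (\<phi> z * hyp (U z)) \<partial>Q) - (\<integral>z. indicator {a-h..<b-h} (fst z) * (\<phi> (fst z + h, snd z) * hyp (U z)) \<partial>Q)
      \<le> - (h * (\<integral>\<theta>. indicator {0..<1} \<theta> * (\<integral>z. kk (h * \<theta>) z \<partial>Q) \<partial>lborel))"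
proof -
  let ?P = "\<lambda>z. w z * (\<phi> z * hyp (U z))"
  let ?F1 = "\<lambda>z. indicator {a-h..<b-h} (fst z) * (\<phi> (fst z + h, snd z) * hyp (U z))"
  let ?Ph = "\<lambda>z. w z * (\<phi> z * hyp (U (fst z - h, snd z)))"
  have iP: "integrable Q ?P"
    unfolding w_def
  proof (rule hypU_mult_int[where C=K])
    fix z assume "z \<in> space Q" "fst z \<in> {a..<b}"
    then show "\<bar>\<phi> z\<bar> \<le> K" using \<phi>b(1)[of "fst z" "snd z"] space_Q_snd[of z] ab by simp
  qed (use ab in auto)
  show iF: "integrable Q ?F1"
  proof (rule hypU_mult_int[where C=K])
    show "(\<lambda>z. \<phi> (fst z + h, snd z)) \<in> borel_measurable Q"
      using measurable_compose[OF measurable_shift_Q[of "-h"] mQ(3)] by simp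
    fix z assume "z \<in> space Q" "fst z \<in> {a-h..<b-h}"
    then show "\<bar>\<phi> (fst z + h, snd z)\<bar> \<le> K" using \<phi>b(1)[of "fst z + h" "snd z"] space_Q_snd[of z] ab h by simp
  qed (use ab h in auto)
  \<comment> \<open>Shift invariance of \<open>Q\<close> then moves the delay off \<open>U\<close>:
    the window becomes \<open>[a - h, b - h)\<close> and \<open>\<phi>\<close> is evaluated at
    \<open>t + h\<close>.\<close>
  have PhF: "?Ph z = ?F1 (fst z - h, snd z)" for z
    by (auto simp: w_def indicator_def)
  have iPh: "integrable Q ?Ph" and ePh: "(\<integral>z. ?Ph z \<partial>Q) = (\<integral>z. ?F1 z \<partial>Q)"
    unfolding PhF using integrable_time_shift[OF iF, of h] by auto
  have iD: "integrable Q (\<lambda>z. ?P z - ?Ph z)" using iP iPh by simp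
  let ?R = "\<lambda>r. \<integral>\<theta>. indicator {0..<1} \<theta> * (\<integral>x. kk (h * \<theta>) (r, x) \<partial>N) \<partial>lborel"
  have ae: "AE r in lborel. (\<integral>x. ?P (r, x) - ?Ph (r, x) \<partial>N) \<le> - (h * ?R r)"
    using slice_ineq[OF h(1,2)] slice AE_lborel_shift[OF slice, of h]
  proof eventually_elim
    case (elim r)
    show ?case
    proof (cases "r \<in> {a..<b}")
      case False
      then have "kk \<sigma> (r, x) = 0" "w (r, x) = 0" for \<sigma> x by (auto simp: kk_def w_def)
      then show ?thesis by simp
    next
      case True
      then have rr: "r \<in> {0<..<T}" "r - h \<in> {0<..<T}" "r \<ge> 0" "r - h \<ge> 0" "r \<in> {0..b}" using ab h by auto
      from elim rr have eq1: "AE x in N. U (r, x) = u r x" and eq2: "AE x in N. U (r - h, x) = u (r - h) x" by auto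
      have w1: "w (r, x) = 1" for x using True by (simp add: w_def)
      note [measurable] = borel_slice(2)[OF Um] u_meas[OF rr(3)] u_meas[OF rr(4)] \<phi>N
      have "(\<integral>x. ?P (r, x) - ?Ph (r, x) \<partial>N) = (\<integral>x. \<phi> (r, x) * hyp (u r x) - \<phi> (r, x) * hyp (u (r - h) x) \<partial>N)"
      proof (rule integral_cong_AE)
        show "AE x in N. ?P (r, x) - ?Ph (r, x) = \<phi> (r, x) * hyp (u r x) - \<phi> (r, x) * hyp (u (r - h) x)"
          using eq1 eq2 by eventually_elim (simp add: w1)
      qed (simp_all add: w1)
      also have "\<dots> \<le> - (\<integral>s. indicator {r-h<..r} s * (\<integral>x. H (s, x) \<bullet> DV (r, x) + f (U (s, x)) * V (r, x) - g x * V (r, x) \<partial>N) \<partial>lborel)"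
        using elim True by blast
      \<comment> \<open>The substitution \<open>s = r - h * \<theta>\<close> reverses orientation,
        so the window closed on the right becomes \<open>{0..<1}\<close>, closed on the
        left.\<close>
      also have "(\<integral>s. indicator {r-h<..r} s * (\<integral>x. H (s, x) \<bullet> DV (r, x) + f (U (s, x)) * V (r, x) - g x * V (r, x) \<partial>N) \<partial>lborel)
        = h * (\<integral>\<theta>. indicator {r-h<..r} (r + - h * \<theta>) * (\<integral>x. H (r + - h * \<theta>, x) \<bullet> DV (r, x) + f (U (r + - h * \<theta>, x)) * V (r, x) - g x * V (r, x) \<partial>N) \<partial>lborel)"
        using lborel_integral_real_affine[of "-h" "\<lambda>s. indicator {r-h<..r} s * (\<integral>x. H (s, x) \<bullet> DV (r, x) + f (U (s, x)) * V (r, x) - g x * V (r, x) \<partial>N)" r] h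
        by simp
      also have "\<dots> = h * ?R r"
      proof -
        have "indicator {r-h<..r} (r + - h * \<theta>) * (\<integral>x. H (r + - h * \<theta>, x) \<bullet> DV (r, x) + f (U (r + - h * \<theta>, x)) * V (r, x) - g x * V (r, x) \<partial>N)
          = indicator {0..<1} \<theta> * (\<integral>x. kk (h * \<theta>) (r, x) \<partial>N)" for \<theta>
        proof (cases "\<theta> \<in> {0..<1}")
          case t: True
          have ht: "0 \<le> h * \<theta>" "h * \<theta> < h" using t h by auto
          then have i: "r + - h * \<theta> \<in> {r-h<..r}" "r - h * \<theta> \<in> {0<..<T}" using rr by auto
          have "kk (h * \<theta>) (r, x) = H (r + - h * \<theta>, x) \<bullet> DV (r, x) + f (U (r + - h * \<theta>, x)) * V (r, x) - g x * V (r, x)" for x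
            using i(2) by (simp add: kk_def w1 F_def inner_vec_def)
          with t i(1) show ?thesis by simp
        next
          case t: False
          have "r + - h * \<theta> \<notin> {r-h<..r}"
          proof
            assume "r + - h * \<theta> \<in> {r-h<..r}"
            then have "h * \<theta> < h * 1" "0 \<le> h * \<theta>" by auto
            then have "\<theta> < 1" "0 \<le> \<theta>" using h(1) by (simp, simp add: zero_le_mult_iff)
            with t show False by simp
          qed
          with t show ?thesis by simp
        qed
        then show ?thesis by simp
      qed
      finally show ?thesis by simp
    qed
  qed
  have "(\<integral>z. ?P z \<partial>Q) - (\<integral>z. ?F1 z \<partial>Q) = (\<integral>z. ?P z - ?Ph z \<partial>Q)" using iP iPh ePh by simp
  also have "\<dots> = (\<integral>r. (\<integral>x. ?P (r, x) - ?Ph (r, x) \<partial>N) \<partial>lborel)"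
    by (rule QP.integral_fst'[OF iD, symmetric])
  also have "\<dots> \<le> (\<integral>r. - (h * ?R r) \<partial>lborel)"
    by (rule integral_mono_AE[OF QP.integrable_fst'[OF iD] _ ae]) (use kk_facts(2)[of h] in simp)
  also have "\<dots> = - (h * (\<integral>\<theta>. indicator {0..<1} \<theta> * (\<integral>z. kk (h * \<theta>) z \<partial>Q) \<partial>lborel))"
    by (simp add: kk_facts(3))
  finally show "(\<integral>z. ?P z \<partial>Q) - (\<integral>z. ?F1 z \<partial>Q) \<le> \<dots>" .
qed

text \<open>Formed with \<open>u\<close> and not with \<open>U\<close>: the values at the exact
  times \<open>a\<close> and \<open>b\<close> matter, and \<open>U\<close> represents
  \<open>u\<close> only at almost every time.\<close>

definition m where "m t = (\<integral>x. \<phi> (t, x) * hyp (u t x) \<partial>N)"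

lemma \<phi>_time_lipschitz:
  assumes "0 \<le> s" "s \<le> t" "t \<le> b" "x \<in> \<Omega>"
  shows "\<bar>\<phi> (t, x) - \<phi> (s, x)\<bar> \<le> K * (t - s)"
proof (cases "s = t")
  case False
  then have "s < t" using assms by simp
  from MVT2[OF this, of "\<lambda>t. \<phi> (t, x)" "\<lambda>t. \<phi>t (t, x)"] obtain z where z: "s < z" "z < t"
    "\<phi> (t, x) - \<phi> (s, x) = (t - s) * \<phi>t (z, x)" using \<phi>\<tau> assms by auto
  then have "\<bar>\<phi> (t, x) - \<phi> (s, x)\<bar> = (t - s) * \<bar>\<phi>t (z, x)\<bar>" using assms by (simp add: abs_mult)
  also have "\<dots> \<le> (t - s) * K" using \<phi>b(2)[of z x] z assms by (intro mult_left_mono) auto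
  finally show ?thesis by (simp add: mult.commute)
qed simp

text \<open>\<open>\<phi>\<close> is Lipschitz in time with constant \<open>K\<close>,
  \<open>hyp\<close> is Lipschitz with constant 1, and \<open>u\<close> is continuous in time in the
  mean.\<close>

lemma m_left_tendsto:
  assumes c: "0 < c" "c \<le> b"
  shows "(m \<longlongrightarrow> m c) (at_left c)"
proof -
  define v where "v t = (if t \<ge> 0 then (\<lambda>x. \<bar>u t x - u c x\<bar>) else (\<lambda>_. 0))" for t
  have [measurable]: "v t \<in> borel_measurable N" for t using u_meas c by (auto simp: v_def)
  have vi: "integrable N (\<lambda>x. (v t x)\<^sup>2)" for t
    using continuous_L2_sq(1,2)[OF uc] c by (auto simp: v_def intro!: integrable_diff_sq)
  have ev: "\<forall>\<^sub>F s in at c within {0..}. s \<ge> 0" by (auto simp: eventually_at_filter)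
  have "((\<lambda>s. \<integral>x. (u s x - u c x)\<^sup>2 \<partial>N) \<longlongrightarrow> 0) (at c within {0..})"
    using continuous_L2_sq(3)[OF uc] c by simp
  then have "((\<lambda>s. \<integral>x. (v s x)\<^sup>2 \<partial>N) \<longlongrightarrow> 0) (at c within {0..})"
    by (rule Lim_transform_eventually) (use ev in \<open>auto elim!: eventually_mono simp: v_def\<close>)
  \<comment> \<open>Pairing with the constant 1 turns convergence of the squares into convergence of
    the integrals, as the domain has finite measure.\<close>
  then have "((\<lambda>s. \<integral>x. v s x * 1 \<partial>N) \<longlongrightarrow> 0) (at c within {0..})"
    by (rule tendsto_0_integral_mult[rotated -1]) (use vi in auto)
  then have "((\<lambda>s. \<integral>x. v s x \<partial>N) \<longlongrightarrow> 0) (at c within {0..c})"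
    by (intro tendsto_within_subset[where S="{0..}" and T="{0..c}"]) auto
  then have v0: "((\<lambda>s. \<integral>x. v s x \<partial>N) \<longlongrightarrow> 0) (at_left c)"
    using c by (simp add: at_within_Icc_at_left)
  have vint: "integrable N (v t)" for t using square_integrable_imp_integrable[OF _ vi] by simp
  have hc: "integrable N (\<lambda>x. hyp (u c x))" using hyp_u_int c by simp
  have "((\<lambda>t. K * (c - t) * (\<integral>x. hyp (u c x) \<partial>N) + K * (\<integral>x. v t x \<partial>N)) \<longlongrightarrow> K * (c - c) * (\<integral>x. hyp (u c x) \<partial>N) + K * 0) (at_left c)"
    by (intro tendsto_intros v0)
  then have up: "((\<lambda>t. K * (c - t) * (\<integral>x. hyp (u c x) \<partial>N) + K * (\<integral>x. v t x \<partial>N)) \<longlongrightarrow> 0) (at_left c)" by simp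
  have "((\<lambda>t. m t - m c) \<longlongrightarrow> 0) (at_left c)"
  proof (rule tendsto_rabs_zero_cancel, rule tendsto_sandwich[OF _ _ tendsto_const up])
    have "\<forall>\<^sub>F t in at_left c. t \<in> {0<..<c}"
      using c eventually_at_left_real[of 0 c] by simp
    then show "\<forall>\<^sub>F t in at_left c. \<bar>m t - m c\<bar> \<le> K * (c - t) * (\<integral>x. hyp (u c x) \<partial>N) + K * (\<integral>x. v t x \<partial>N)"
    proof eventually_elim
      case (elim t)
      then have t: "0 \<le> t" "t \<in> {0..b}" "c \<in> {0..b}" "t \<le> c" "c \<ge> 0" using c by auto
      have i1: "integrable N (\<lambda>x. \<phi> (t, x) * hyp (u t x))" and i2: "integrable N (\<lambda>x. \<phi> (c, x) * hyp (u c x))"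
        using \<phi>_hyp_int t by auto
      have "\<bar>m t - m c\<bar> = \<bar>\<integral>x. \<phi> (t, x) * hyp (u t x) - \<phi> (c, x) * hyp (u c x) \<partial>N\<bar>"
        unfolding m_def using i1 i2 by simp
      also have "\<dots> \<le> (\<integral>x. K * (c - t) * hyp (u c x) + K * v t x \<partial>N)"
      proof (rule integral_abs_bound[THEN order_trans], rule integral_mono)
        fix x assume "x \<in> space N"
        then have x: "x \<in> \<Omega>" by simp
        have "\<phi> (t, x) * hyp (u t x) - \<phi> (c, x) * hyp (u c x) = \<phi> (t, x) * (hyp (u t x) - hyp (u c x)) - (\<phi> (c, x) - \<phi> (t, x)) * hyp (u c x)"
          by (simp add: algebra_simps)
        then have "\<bar>\<phi> (t, x) * hyp (u t x) - \<phi> (c, x) * hyp (u c x)\<bar> \<le> \<bar>\<phi> (t, x)\<bar> * \<bar>hyp (u t x) - hyp (u c x)\<bar> + \<bar>\<phi> (c, x) - \<phi> (t, x)\<bar> * \<bar>hyp (u c x)\<bar>"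
          by (simp add: abs_mult[symmetric])
        also have "\<bar>\<phi> (t, x)\<bar> * \<bar>hyp (u t x) - hyp (u c x)\<bar> \<le> K * v t x"
          using \<phi>b(1)[OF t(2) x] hyp_lipschitz[of "u t x" "u c x"] t K_nonneg[OF x] by (intro mult_mono) (auto simp: v_def)
        also have "\<bar>\<phi> (c, x) - \<phi> (t, x)\<bar> * \<bar>hyp (u c x)\<bar> \<le> K * (c - t) * hyp (u c x)"
          using \<phi>_time_lipschitz[of t c x] t c x hyp_nonneg[of "u c x"] by (intro mult_mono) auto
        finally show "\<bar>\<phi> (t, x) * hyp (u t x) - \<phi> (c, x) * hyp (u c x)\<bar> \<le> K * (c - t) * hyp (u c x) + K * v t x" by simp
      qed (use i1 i2 hc vint in auto)
      also have "\<dots> = K * (c - t) * (\<integral>x. hyp (u c x) \<partial>N) + K * (\<integral>x. v t x \<partial>N)" using hc vint by simp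
      finally show ?case .
    qed
  qed simp
  then show ?thesis by (simp add: LIM_zero_iff)
qed

lemma integral_window:
  assumes S: "S \<in> sets borel" "S \<subseteq> {0<..b}" 
  shows "integrable Q (\<lambda>z. indicator S (fst z) * (\<phi> z * hyp (U z)))"
    "integrable lborel (\<lambda>t. indicator S t * (\<integral>x. \<phi> (t, x) * hyp (U (t, x)) \<partial>N))"
    "(\<integral>z. indicator S (fst z) * (\<phi> z * hyp (U z)) \<partial>Q) = (\<integral>t. indicator S t * (\<integral>x. \<phi> (t, x) * hyp (U (t, x)) \<partial>N) \<partial>lborel)"
proof -
  show i: "integrable Q (\<lambda>z. indicator S (fst z) * (\<phi> z * hyp (U z)))"
  proof (rule hypU_mult_int[where C=K])
    fix z assume "z \<in> space Q" "fst z \<in> S"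
    then show "\<bar>\<phi> z\<bar> \<le> K" using \<phi>b(1)[of "fst z" "snd z"] space_Q_snd[of z] S by auto
  qed (use S ab in auto)
  show "integrable lborel (\<lambda>t. indicator S t * (\<integral>x. \<phi> (t, x) * hyp (U (t, x)) \<partial>N))"
    using QP.integrable_fst'[OF i] by simp
  show "(\<integral>z. indicator S (fst z) * (\<phi> z * hyp (U z)) \<partial>Q) = (\<integral>t. indicator S t * (\<integral>x. \<phi> (t, x) * hyp (U (t, x)) \<partial>N) \<partial>lborel)"
    using QP.integral_fst'[OF i] by simp
qed

lemma window_average:
  assumes h: "\<And>n. 0 < h n" "h \<longlonglongrightarrow> 0" "\<And>n. h n < c" and c: "c \<le> b"
  shows "(\<lambda>n::nat. (\<integral>z. indicator {c - h n..<c} (fst z) * (\<phi> z * hyp (U z)) \<partial>Q) / h n) \<longlonglongrightarrow> m c"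
proof -
  have S: "{c - h n..<c} \<in> sets borel" "{c - h n..<c} \<subseteq> {0<..b}" for n using h(3)[of n] c by auto
  have "AE t in lborel. t \<in> {c - h n..<c} \<longrightarrow> (\<integral>x. \<phi> (t, x) * hyp (U (t, x)) \<partial>N) = m t" for n
    using slice
  proof eventually_elim
    case (elim t)
    show ?case
    proof
      assume "t \<in> {c - h n..<c}"
      then have t: "t \<in> {0<..<T}" "t \<ge> 0" using h(3)[of n] c ab by auto
      note [measurable] = borel_slice(2)[OF Um] u_meas[OF t(2)] \<phi>N
      from elim t have "AE x in N. U (t, x) = u t x" by blast
      then show "(\<integral>x. \<phi> (t, x) * hyp (U (t, x)) \<partial>N) = m t"
        unfolding m_def by (intro integral_cong_AE) (auto elim!: eventually_mono)
    qed
  qed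
  moreover have "0 < c" using h(1)[of 0] h(3)[of 0] by simp
  ultimately show ?thesis
    unfolding integral_window(3)[OF S]
    by (intro left_average_tendsto h integral_window(2) S m_left_tendsto c)
qed

text \<open>Dominated convergence: the Lipschitz bound of \<open>\<phi>\<close> in time makes
  \<open>K * hyp (U)\<close> a majorant, and the windows \<open>[a - h n, b - h n)\<close> converge
  pointwise to \<open>[a, b)\<close>.\<close>

lemma difference_quotient_limit:
  assumes h: "\<And>n. 0 < h n" "h \<longlonglongrightarrow> 0" "\<And>n. h n < a" "\<And>n. h n < b - a"
  shows "integrable Q (\<lambda>z. indicator {a - h n..<b - h n} (fst z) * ((\<phi> (fst z + h n, snd z) - \<phi> z) * hyp (U z)))"
    and "(\<lambda>n::nat. (\<integral>z. indicator {a - h n..<b - h n} (fst z) * ((\<phi> (fst z + h n, snd z) - \<phi> z) * hyp (U z)) \<partial>Q) / h n)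
      \<longlonglongrightarrow> (\<integral>z. w z * (\<phi>t z * hyp (U z)) \<partial>Q)"
proof -
  let ?R = "\<lambda>n z. indicator {a - h n..<b - h n} (fst z) * ((\<phi> (fst z + h n, snd z) - \<phi> z) * hyp (U z))"
  have [measurable]: "(\<lambda>z. \<phi> (fst z + h n, snd z)) \<in> borel_measurable Q" for n
    using measurable_compose[OF measurable_shift_Q[of "- h n"] mQ(3)] by simp
  have lip: "\<bar>\<phi> (fst z + h n, snd z) - \<phi> z\<bar> \<le> K * h n" if "z \<in> space Q" "fst z \<in> {a - h n..<b - h n}" for z n
    using \<phi>_time_lipschitz[of "fst z" "fst z + h n" "snd z"] that space_Q_snd[of z] h(1)[of n] h(3)[of n] by simp
  show "integrable Q (?R n)"
    by (rule hypU_mult_int[where C="K * h n"]) (use lip ab h(1,3,4)[of n] in auto)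
  have "(\<lambda>n. \<integral>z. ?R n z / h n \<partial>Q) \<longlonglongrightarrow> (\<integral>z. w z * (\<phi>t z * hyp (U z)) \<partial>Q)"
  proof (rule integral_dominated_convergence[where w="\<lambda>z. K * (indicator {0<..<T} (fst z) * hyp (U z))"])
    show "integrable Q (\<lambda>z. K * (indicator {0<..<T} (fst z) * hyp (U z)))" using hypU_int by simp
    show "AE z in Q. norm (?R n z / h n) \<le> K * (indicator {0<..<T} (fst z) * hyp (U z))" for n
    proof (rule AE_I2)
      fix z assume z: "z \<in> space Q"
      show "norm (?R n z / h n) \<le> K * (indicator {0<..<T} (fst z) * hyp (U z))"
      proof (cases "fst z \<in> {a - h n..<b - h n}")
        case True
        then have "fst z \<in> {0<..<T}" using ab h(1,3)[of n] by auto
        moreover have "\<bar>\<phi> (fst z + h n, snd z) - \<phi> z\<bar> * hyp (U z) \<le> K * h n * hyp (U z)"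
          by (rule mult_right_mono[OF lip[OF z True] hyp_nonneg])
        ultimately show ?thesis using True h(1)[of n] hyp_nonneg[of "U z"]
          by (simp add: abs_mult divide_le_eq mult_ac)
      next
        case False
        then show ?thesis using K_nonneg[OF space_Q_snd[OF z]] hyp_nonneg[of "U z"] by simp
      qed
    qed
    show "AE z in Q. (\<lambda>n. ?R n z / h n) \<longlonglongrightarrow> w z * (\<phi>t z * hyp (U z))"
    proof (rule AE_I2)
      fix z assume "z \<in> space Q"
      then have x: "snd z \<in> \<Omega>" by (rule space_Q_snd)
      consider "fst z < a" | "fst z \<in> {a..<b}" | "b \<le> fst z" by fastforce
      then show "(\<lambda>n. ?R n z / h n) \<longlonglongrightarrow> w z * (\<phi>t z * hyp (U z))"
      proof cases
        case 1
        then have "\<forall>\<^sub>F n in sequentially. h n < a - fst z" using h(2) by (intro order_tendstoD(2)) auto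
        then have "\<forall>\<^sub>F n in sequentially. ?R n z / h n = 0" by eventually_elim auto
        with 1 show ?thesis by (auto intro: tendsto_eventually simp: w_def)
      next
        case 3
        have "?R n z / h n = 0" for n using 3 h(1)[of n] by (simp add: indicator_def)
        then have "(\<lambda>n. ?R n z / h n) \<longlonglongrightarrow> 0" by (intro tendsto_eventually always_eventually allI)
        with 3 show ?thesis by (simp add: w_def)
      next
        case 2
        have t: "fst z \<in> {0..b}" using 2 ab by auto
        have "((\<lambda>r. (\<phi> (fst z + r, snd z) - \<phi> (fst z, snd z)) / r) \<longlongrightarrow> \<phi>t (fst z, snd z)) (at 0)"
          using \<phi>\<tau>[OF t x] unfolding DERIV_def .
        then have "(\<lambda>n. (\<phi> (fst z + h n, snd z) - \<phi> (fst z, snd z)) / h n) \<longlonglongrightarrow> \<phi>t (fst z, snd z)"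
          by (rule filterlim_compose) (use h(2) less_imp_neq[OF h(1), symmetric] in \<open>auto simp: filterlim_at\<close>)
        from tendsto_mult_right[OF this, of "hyp (U z)"]
        have l: "(\<lambda>n. (\<phi> (fst z + h n, snd z) - \<phi> z) / h n * hyp (U z)) \<longlonglongrightarrow> w z * (\<phi>t z * hyp (U z))"
          using 2 by (simp add: w_def)
        have "\<forall>\<^sub>F n in sequentially. h n < b - fst z" using h(2) 2 by (intro order_tendstoD(2)) auto
        then have "\<forall>\<^sub>F n in sequentially. (\<phi> (fst z + h n, snd z) - \<phi> z) / h n * hyp (U z) = ?R n z / h n"
        proof eventually_elim
          case (elim n)
          then have "fst z \<in> {a - h n..<b - h n}" using 2 h(1)[of n] by auto
          then show ?case by simp
        qed
        with l show ?thesis by (rule Lim_transform_eventually)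
      qed
    qed
  qed measurable
  then show "(\<lambda>n. (\<integral>z. ?R n z \<partial>Q) / h n) \<longlonglongrightarrow> (\<integral>z. w z * (\<phi>t z * hyp (U z)) \<partial>Q)" by simp
qed

text \<open>The function \<open>D\<phi> i * hyp (U)\<close> has zero boundary values because
  \<open>hyp 0 = 0\<close>, so its \<open>i\<close>-th derivative has integral 0. Summing over
  \<open>i\<close> moves the gradient from \<open>hyp (U)\<close> onto \<open>D\<phi>\<close>, and
  the backward heat equation replaces minus the Laplacian of \<open>\<phi>\<close> by
  \<open>\<phi>t\<close>.\<close>

lemma integration_by_parts:
  shows "integrable Q (\<lambda>z. w z * (\<Sum>i\<in>UNIV. dhyp (U z) * H z $ i * D\<phi> i z))"
    and "integrable Q (\<lambda>z. w z * (\<phi>t z * hyp (U z)))"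
    and "(\<integral>z. w z * (\<Sum>i\<in>UNIV. dhyp (U z) * H z $ i * D\<phi> i z) \<partial>Q) = (\<integral>z. w z * (\<phi>t z * hyp (U z)) \<partial>Q)"
proof -
  let ?e = "\<lambda>z. w z * (\<Sum>i\<in>UNIV. dhyp (U z) * H z $ i * D\<phi> i z)" and ?t = "\<lambda>z. w z * (\<phi>t z * hyp (U z))"
  show it: "integrable Q ?t"
    unfolding w_def
  proof (rule hypU_mult_int[where C=K])
    fix z assume "z \<in> space Q" "fst z \<in> {a..<b}"
    then show "\<bar>\<phi>t z\<bar> \<le> K" using \<phi>b(2)[of "fst z" "snd z"] space_Q_snd[of z] ab by simp
  qed (use ab in auto)
  have "integrable Q (\<lambda>z. H z $ i * (w z * (dhyp (U z) * D\<phi> i z)))" for i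
  proof (rule integral_sq_le_mult(1))
    show "integrable Q (\<lambda>z. (w z * (dhyp (U z) * D\<phi> i z))\<^sup>2)"
    proof (rule Bochner_Integration.integrable_bound[of _ "\<lambda>z. K\<^sup>2 * indicator {0<..<T} (fst z)"])
      show "AE z in Q. norm ((w z * (dhyp (U z) * D\<phi> i z))\<^sup>2) \<le> norm (K\<^sup>2 * indicator {0<..<T} (fst z))"
      proof (rule AE_I2)
        fix z assume z: "z \<in> space Q"
        show "norm ((w z * (dhyp (U z) * D\<phi> i z))\<^sup>2) \<le> norm (K\<^sup>2 * indicator {0<..<T} (fst z))"
        proof (cases "fst z \<in> {a..<b}")
          case True
          then have t: "fst z \<in> {0..b}" "fst z \<in> {0<..<T}" using ab by auto
          have "\<bar>dhyp (U z) * D\<phi> i z\<bar> \<le> 1 * K"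
            unfolding abs_mult using \<phi>b(3)[OF t(1) space_Q_snd[OF z], of i] by (intro mult_mono abs_dhyp_le) auto
          then have "\<bar>dhyp (U z) * D\<phi> i z\<bar>\<^sup>2 \<le> (1 * K)\<^sup>2" by (rule power_mono) simp
          with True t show ?thesis by (simp add: w_def)
        qed (simp add: w_def)
      qed
    qed (use one_int_Q in simp_all)
  qed (use QH in auto)
  moreover have "?e z = (\<Sum>i\<in>UNIV. H z $ i * (w z * (dhyp (U z) * D\<phi> i z)))" for z
    by (simp add: sum_distrib_left mult_ac)
  ultimately show ie: "integrable Q ?e" by (simp add: Bochner_Integration.integrable_sum)
  have "AE r in lborel. (\<integral>x. ?e (r, x) - ?t (r, x) \<partial>N) = 0"
    using slice
  proof eventually_elim
    case (elim r)
    show ?case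
    proof (cases "r \<in> {a..<b}")
      case True
      then have r: "r \<in> {0..b}" "r \<in> {0<..<T}" using ab by auto
      with elim have H10: "H10_on \<Omega> (\<lambda>x. U (r, x)) (\<lambda>x. H (r, x))" by blast
      have sm: "smooth_Rn (\<lambda>x. D\<phi> i (r, x))" for i
        using smooth_Rn_partial[OF \<phi>s[OF r(1)], of i] unfolding \<phi>d[OF r(1)] .
      \<comment> \<open>The \<open>i\<close>-th partial derivative of
        \<open>D\<phi> i * hyp (U)\<close>, written out by the product and chain rules.\<close>
      let ?k = "\<lambda>i x. D\<phi> i (r, x) * dhyp (U (r, x)) * H (r, x) $ i + hyp (U (r, x)) * partial i (\<lambda>x. D\<phi> i (r, x)) x"
      have k: "integrable N (?k i)" "(\<integral>x. ?k i x \<partial>N) = 0" for i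
      proof -
        note M = H10_on_mult_compose[OF H10 sm hyp_0 smooth_Rn_hyp DERIV_hyp abs_dhyp_le continuous_on_dhyp, of i]
        show "(\<integral>x. ?k i x \<partial>N) = 0" using H10_on_integral_grad[OF M, of i] by simp
        have "Lp_on 2 \<Omega> (?k i)" using M unfolding H10_on_def H1_on_def by simp
        then show "integrable N (?k i)" unfolding Lp_on_2 using square_integrable_imp_integrable by blast
      qed
      have "?e (r, x) - ?t (r, x) = (\<Sum>i\<in>UNIV. ?k i x)" for x
      proof -
        have "?t (r, x) = - (\<Sum>i\<in>UNIV. partial i (\<lambda>x. D\<phi> i (r, x)) x) * hyp (U (r, x))"
          using True by (simp add: w_def \<phi>L[OF r(1)])
        with True show ?thesis
          by (simp add: w_def sum.distrib sum_distrib_left mult_ac)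
      qed
      then show ?thesis using k by (simp add: Bochner_Integration.integral_sum)
    qed (simp add: w_def)
  qed
  then have "(\<integral>r. (\<integral>x. ?e (r, x) - ?t (r, x) \<partial>N) \<partial>lborel) = 0"
    by (rule integral_eq_zero_AE)
  moreover have "(\<integral>r. (\<integral>x. ?e (r, x) - ?t (r, x) \<partial>N) \<partial>lborel) = (\<integral>z. ?e z - ?t z \<partial>Q)"
    by (rule QP.integral_fst') (use ie it in auto)
  ultimately show "(\<integral>z. ?e z \<partial>Q) = (\<integral>z. ?t z \<partial>Q)" using ie it by simp
qed

lemma source_integrable: "integrable Q (\<lambda>z. indicator {a..<b} (fst z) * ((C2 + \<bar>g (snd z)\<bar>) * \<phi> z))"
proof -
  have "integrable N (\<lambda>x. C2 + \<bar>g x\<bar>)" using g by simp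
  note ib = integrable_Q_product[OF ind_int(2) this]
  have "integrable Q (\<lambda>z. indicator {a..<b} (fst z) * (C2 + \<bar>g (snd z)\<bar>) * (w z * \<phi> z))"
  proof (rule integrable_mult_bounded[OF ib, where K=K])
    fix z assume z: "z \<in> space Q"
    show "\<bar>w z * \<phi> z\<bar> \<le> K"
      using \<phi>b(1)[of "fst z" "snd z"] K_nonneg[of "snd z"] space_Q_snd[OF z] ab by (auto simp: w_def indicator_def)
  qed simp
  moreover have "indicator {a..<b} (fst z) * (C2 + \<bar>g (snd z)\<bar>) * (w z * \<phi> z) = indicator {a..<b} (fst z) * ((C2 + \<bar>g (snd z)\<bar>) * \<phi> z)" for z
    by (auto simp: w_def indicator_def)
  ultimately show ?thesis by simp
qed

text \<open>Dividing the time step by \<open>h n\<close> leaves, in the limit, the increment of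
  \<open>m\<close>, the term with \<open>\<phi>t\<close>, and the pairing \<open>kk 0\<close>
  without delay. The part of \<open>kk 0\<close> that contains \<open>D\<phi>\<close> cancels the
  \<open>\<phi>t\<close> term by the integration by parts; what remains of \<open>kk 0\<close> is
  bounded below by minus the source.\<close>

theorem energy_inequality:
  "(\<integral>x. \<phi> (b, x) * hyp (u b x) \<partial>N) \<le> (\<integral>x. \<phi> (a, x) * hyp (u a x) \<partial>N)
    + (\<integral>z. indicator {a..<b} (fst z) * ((C2 + \<bar>g (snd z)\<bar>) * \<phi> z) \<partial>Q)"
proof -
  define h where "h n = min a (b - a) / real (n + 2)" for n
  have h: "0 < h n" "h n < a" "h n < b - a" for n
  proof -
    have mp: "min a (b - a) > 0" using ab by simp
    then show "0 < h n" by (simp add: h_def)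
    have "h n < min a (b - a)"
      unfolding h_def using divide_strict_left_mono[OF _ mp, of 1 "real (n + 2)"] by simp
    then show "h n < a" "h n < b - a" by auto
  qed
  have h0: "h \<longlonglongrightarrow> 0" unfolding h_def by real_asymp
  have hb: "h n < b" for n using h[of n] ab by simp
  let ?A = "\<lambda>c n. \<integral>z. indicator {c - h n..<c} (fst z) * (\<phi> z * hyp (U z)) \<partial>Q"
  let ?R = "\<lambda>n. \<integral>z. indicator {a - h n..<b - h n} (fst z) * ((\<phi> (fst z + h n, snd z) - \<phi> z) * hyp (U z)) \<partial>Q"
  let ?J = "\<lambda>n. \<integral>\<theta>. indicator {0..<1} \<theta> * (\<integral>z. kk (h n * \<theta>) z \<partial>Q) \<partial>lborel"
  let ?t = "\<integral>z. w z * (\<phi>t z * hyp (U z)) \<partial>Q"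
  have step: "?A b n / h n - ?A a n / h n - ?R n / h n \<le> - ?J n" for n
  proof -
    have S: "{b - h n..<b} \<subseteq> {0<..b}" "{a - h n..<a} \<subseteq> {0<..b}" "{a..<b} \<subseteq> {0<..b}" using h[of n] ab by auto
    have iw: "integrable Q (\<lambda>z. w z * (\<phi> z * hyp (U z)))"
      unfolding w_def by (rule integral_window(1)[OF _ S(3)]) simp
    have "(\<integral>z. w z * (\<phi> z * hyp (U z)) \<partial>Q) - (\<integral>z. indicator {a-h n..<b-h n} (fst z) * (\<phi> (fst z + h n, snd z) * hyp (U z)) \<partial>Q)
      = (\<integral>z. w z * (\<phi> z * hyp (U z)) - indicator {a-h n..<b-h n} (fst z) * (\<phi> (fst z + h n, snd z) * hyp (U z)) \<partial>Q)"
      using iw time_step(1)[OF h] by simp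
    also have "\<dots> = (\<integral>z. indicator {b - h n..<b} (fst z) * (\<phi> z * hyp (U z)) - indicator {a - h n..<a} (fst z) * (\<phi> z * hyp (U z))
       - indicator {a - h n..<b - h n} (fst z) * ((\<phi> (fst z + h n, snd z) - \<phi> z) * hyp (U z)) \<partial>Q)"
    proof (rule Bochner_Integration.integral_cong[OF refl])
      fix z
      \<comment> \<open>The two long windows differ only by a short one at each end; divided by
        \<open>h n\<close>, the short ones become the averages that tend to \<open>m b\<close> and
        \<open>m a\<close>.\<close>
      have "w z - indicator {a-h n..<b-h n} (fst z) = indicator {b - h n..<b} (fst z) - (indicator {a - h n..<a} (fst z) :: real)"
        using h[of n] by (auto simp: w_def indicator_def)
      then have wz: "w z = indicator {a-h n..<b-h n} (fst z) + indicator {b - h n..<b} (fst z) - indicator {a - h n..<a} (fst z)" by simp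
      show "w z * (\<phi> z * hyp (U z)) - indicator {a-h n..<b-h n} (fst z) * (\<phi> (fst z + h n, snd z) * hyp (U z)) =
        indicator {b - h n..<b} (fst z) * (\<phi> z * hyp (U z)) - indicator {a - h n..<a} (fst z) * (\<phi> z * hyp (U z))
       - indicator {a - h n..<b - h n} (fst z) * ((\<phi> (fst z + h n, snd z) - \<phi> z) * hyp (U z))"
        unfolding wz by (simp add: algebra_simps)
    qed
    also have "\<dots> = ?A b n - ?A a n - ?R n"
      using integral_window(1)[OF _ S(1)] integral_window(1)[OF _ S(2)] difference_quotient_limit(1)[OF h(1) h0 h(2,3), of n]
      by simp
    finally have "?A b n - ?A a n - ?R n \<le> - (h n * ?J n)" using time_step(2)[OF h, of n] by simp
    then have "(?A b n - ?A a n - ?R n) / h n \<le> - (h n * ?J n) / h n"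
      by (rule divide_right_mono) (use h(1)[of n] in simp)
    then show ?thesis using h(1)[of n] by (simp add: diff_divide_distrib)
  qed
  have "(\<lambda>n. ?A b n / h n - ?A a n / h n - ?R n / h n) \<longlonglongrightarrow> m b - m a - ?t"
    by (intro tendsto_diff window_average difference_quotient_limit(2) h h0 hb) (use ab in auto)
  moreover have "(\<lambda>n. - ?J n) \<longlonglongrightarrow> - (\<integral>z. kk 0 z \<partial>Q)"
    by (intro tendsto_minus kk_facts(4) h0)
  ultimately have 1: "m b - m a - ?t \<le> - (\<integral>z. kk 0 z \<partial>Q)"
    by (rule LIMSEQ_le) (use step in auto)
  let ?e = "\<lambda>z. w z * (\<Sum>i\<in>UNIV. dhyp (U z) * H z $ i * D\<phi> i z)"
  let ?g = "\<lambda>z. indicator {a..<b} (fst z) * ((C2 + \<bar>g (snd z)\<bar>) * \<phi> z)"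
  note ig = source_integrable
  have "(\<integral>z. ?e z - ?g z \<partial>Q) \<le> (\<integral>z. kk 0 z \<partial>Q)"
  proof (rule integral_mono)
    fix z assume z: "z \<in> space Q"
    show "?e z - ?g z \<le> kk 0 z"
    proof (cases "fst z \<in> {a..<b}")
      case True
      then have t: "fst z \<in> {0..b}" "fst z \<in> {0<..<T}" using ab by auto
      have p0: "0 \<le> \<phi> z" using \<phi>0[OF t(1), of "snd z"] by simp
      have "kk 0 z = (\<Sum>i\<in>UNIV. H z $ i * DV z $ i) + f (U z) * V z - g (snd z) * V z"
        using True t by (simp add: kk_def w_def F_def)
      also have "(\<Sum>i\<in>UNIV. H z $ i * DV z $ i) = (\<Sum>i\<in>UNIV. \<phi> z * rsq (U z) ^ 3 * (H z $ i)\<^sup>2) + (\<Sum>i\<in>UNIV. dhyp (U z) * H z $ i * D\<phi> i z)"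
        by (simp add: DV_def sum.distrib[symmetric] algebra_simps power2_eq_square)
      finally have kk0: "kk 0 z = (\<Sum>i\<in>UNIV. \<phi> z * rsq (U z) ^ 3 * (H z $ i)\<^sup>2) + (\<Sum>i\<in>UNIV. dhyp (U z) * H z $ i * D\<phi> i z)
        + f (U z) * V z - g (snd z) * V z" .
      \<comment> \<open>The diffusion term has a sign because \<open>rsq u ^ 3\<close> is the second
        derivative of the convex function \<open>hyp\<close>; it can simply be discarded.\<close>
      have "0 \<le> (\<Sum>i\<in>UNIV. \<phi> z * rsq (U z) ^ 3 * (H z $ i)\<^sup>2)"
        using p0 rsq_pos[of "U z"] by (intro sum_nonneg) simp
      moreover have "- (C2 * \<phi> z) \<le> f (U z) * V z"
      proof -
        have "- C2 \<le> - C2 * rsq (U z)" using C2(1) rsq_le_1[of "U z"] by (simp add: mult_left_le)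
        also have "\<dots> \<le> f (U z) * U z * rsq (U z)" by (rule mult_right_mono[OF C2(2)]) (use rsq_pos[of "U z"] in simp)
        finally have "- C2 * \<phi> z \<le> f (U z) * U z * rsq (U z) * \<phi> z" by (rule mult_right_mono[OF _ p0])
        then show ?thesis by (simp add: V_def dhyp_def mult_ac)
      qed
      moreover have "g (snd z) * V z \<le> \<bar>g (snd z)\<bar> * \<phi> z"
      proof -
        have "g (snd z) * V z \<le> \<bar>g (snd z) * V z\<bar>" by (rule abs_ge_self)
        also have "\<dots> = \<bar>g (snd z)\<bar> * \<phi> z * \<bar>dhyp (U z)\<bar>" using p0 by (simp add: V_def abs_mult)
        also have "\<dots> \<le> \<bar>g (snd z)\<bar> * \<phi> z" using p0 abs_dhyp_le[of "U z"] by (intro mult_left_le) auto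
        finally show ?thesis .
      qed
      ultimately show ?thesis unfolding kk0 using True by (simp add: w_def distrib_right)
    next
      case False
      then show ?thesis by (simp add: kk_def w_def)
    qed
  qed (use ig integration_by_parts(1) kk_facts(1) in auto)
  then have "(\<integral>z. ?e z \<partial>Q) - (\<integral>z. ?g z \<partial>Q) \<le> (\<integral>z. kk 0 z \<partial>Q)"
    using ig integration_by_parts(1) by simp
  with 1 integration_by_parts(3) have "m b - m a \<le> (\<integral>z. ?g z \<partial>Q)" by simp
  then show ?thesis by (simp add: m_def)
qed

end

section \<open>The heat kernel\<close>

definition heat :: "real \<Rightarrow> real^'n::finite \<Rightarrow> real" where
  "heat t x = (4 * pi * t) powr (- (real CARD('n) / 2)) * exp (- (x \<bullet> x) / (4 * t))"

lemma heat_nonneg: "0 \<le> heat t x"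
  by (simp add: heat_def)

lemma heat_le: "t > 0 \<Longrightarrow> heat t (x::real^'n::finite) \<le> (4 * pi * t) powr (- (real CARD('n) / 2))"
  by (simp add: heat_def mult_left_le)

lemma heat_measurable [measurable]: "heat t \<in> borel_measurable borel"
  unfolding heat_def[abs_def] by measurable

lemma heat_minus: "heat t (x - y) = heat t (y - x)"
proof -
  have "(x - y) \<bullet> (x - y) = (y - x) \<bullet> (y - x)" by (simp add: inner_diff_left inner_diff_right inner_commute)
  then show ?thesis by (simp add: heat_def)
qed

text \<open>The kernel at time \<open>t\<close> is the centred Gaussian with variance
  \<open>2 * t\<close> in each coordinate, so its total mass reduces to the one-dimensional normal
  density.\<close>

lemma heat_eq_prod_normal_density:
  fixes x :: "real^'n::finite"
  assumes "t > 0"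
  shows "heat t x = (\<Prod>b\<in>Basis. normal_density 0 (sqrt (2 * t)) (x \<bullet> b))"
proof -
  have "(\<Prod>b\<in>Basis. normal_density 0 (sqrt (2 * t)) (x \<bullet> b)) =
     (\<Prod>b\<in>(Basis :: (real^'n) set). 1 / sqrt (4 * pi * t)) * (\<Prod>b\<in>Basis. exp (- (x \<bullet> b)\<^sup>2 / (4 * t)))"
    using assms unfolding prod.distrib[symmetric] by (intro prod.cong refl) (simp add: normal_density_def mult_ac)
  also have "(\<Prod>b\<in>(Basis :: (real^'n) set). 1 / sqrt (4 * pi * t)) = (4 * pi * t) powr (- (real CARD('n) / 2))"
  proof -
    have s: "4 * pi * t > 0" using assms by simp
    have "1 / sqrt (4 * pi * t) = (4 * pi * t) powr (- (1 / 2))"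
      using powr_half_sqrt[of "4 * pi * t"] s unfolding powr_minus inverse_eq_divide by simp
    then have "(\<Prod>b\<in>(Basis :: (real^'n) set). 1 / sqrt (4 * pi * t)) = ((4 * pi * t) powr (- (1 / 2))) ^ CARD('n)"
      by simp
    also have "\<dots> = ((4 * pi * t) powr (- (1 / 2))) powr real CARD('n)"
      by (rule powr_realpow[symmetric]) (use assms in simp)
    also have "\<dots> = (4 * pi * t) powr (- (real CARD('n) / 2))"
      by (simp add: powr_powr)
    finally show ?thesis .
  qed
  also have "(\<Prod>b\<in>Basis. exp (- (x \<bullet> b)\<^sup>2 / (4 * t))) = exp (\<Sum>b\<in>Basis. - (x \<bullet> b)\<^sup>2 / (4 * t))"
    by (rule exp_sum[symmetric]) simp
  also have "(\<Sum>b\<in>Basis. - (x \<bullet> b)\<^sup>2 / (4 * t)) = - (x \<bullet> x) / (4 * t)"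
    by (simp add: euclidean_inner[of x x] sum_divide_distrib sum_negf power2_eq_square)
  finally show ?thesis by (simp add: heat_def)
qed

lemma heat_integral:
  fixes y :: "real^'n::finite"
  assumes t: "t > 0"
  shows "integrable lborel (\<lambda>x. heat t (x - y))" "(\<integral>x. heat t (x - y) \<partial>lborel) = 1"
proof -
  have "(\<integral>\<^sup>+x. ennreal (heat t x) \<partial>(lborel :: (real^'n) measure)) =
    (\<integral>\<^sup>+x. (\<Prod>b\<in>Basis. ennreal (normal_density 0 (sqrt (2 * t)) (x \<bullet> b))) \<partial>(lborel :: (real^'n) measure))"
    by (simp add: heat_eq_prod_normal_density[OF t] prod_ennreal)
  also have "\<dots> = (\<Prod>b\<in>(Basis :: (real^'n) set). \<integral>\<^sup>+x. ennreal (normal_density 0 (sqrt (2 * t)) x) \<partial>lborel)"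
    by (rule nn_integral_lborel_prod) auto
  also have "(\<integral>\<^sup>+x. ennreal (normal_density 0 (sqrt (2 * t)) x) \<partial>lborel) = 1"
    using t by (subst nn_integral_eq_integral) auto
  finally have nn: "(\<integral>\<^sup>+x. ennreal (heat t x) \<partial>(lborel :: (real^'n) measure)) = 1" by simp
  have hb: "has_bochner_integral lborel (heat t :: real^'n \<Rightarrow> real) 1"
    by (rule has_bochner_integral_nn_integral) (use nn heat_nonneg in auto)
  have *: "distr lborel borel ((+) (- y)) = (lborel :: (real^'n) measure)" by (rule lborel_distr_plus)
  have "integrable (distr lborel borel ((+) (- y))) (heat t :: real^'n \<Rightarrow> real)"
    unfolding * using hb by (rule integrable.intros)
  then show "integrable lborel (\<lambda>x. heat t (x - y))" by (subst (asm) integrable_distr_eq) auto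
  have "(\<integral>x. heat t x \<partial>distr lborel borel ((+) (- y))) = (\<integral>x. heat t (- y + x) \<partial>lborel)"
    by (rule integral_distr) auto
  then show "(\<integral>x. heat t (x - y) \<partial>lborel) = 1"
    unfolding * using has_bochner_integral_integral_eq[OF hb] by simp
qed

text \<open>Half of the Gaussian exponent pays for the small factor, the other half is the exponent
  of the kernel at time \<open>2 * t\<close>; the power of 2 is the ratio of the two normalisations.
  As the wider kernel has mass 1, the mass outside a ball tends to 0.\<close>

lemma heat_tail:
  fixes z :: "real^'n::finite"
  assumes "t > 0" "r \<ge> 0" "norm z \<ge> r"
  shows "heat t z \<le> 2 powr (real CARD('n) / 2) * exp (- r\<^sup>2 / (8 * t)) * heat (2 * t) z"
proof -
  have q: "r\<^sup>2 \<le> z \<bullet> z" using assms power_mono[of r "norm z" 2] by (simp add: power2_norm_eq_inner)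
  have e: "exp (- (z \<bullet> z) / (4 * t)) \<le> exp (- r\<^sup>2 / (8 * t)) * exp (- (z \<bullet> z) / (4 * (2 * t)))"
    unfolding exp_add[symmetric] using assms q by (simp add: field_simps)
  have "(4 * pi * t) powr (- (real CARD('n) / 2)) = 2 powr (real CARD('n) / 2) * (2 powr (- (real CARD('n) / 2)) * (4 * pi * t) powr (- (real CARD('n) / 2)))"
    by (simp add: powr_add[symmetric])
  also have "2 powr (- (real CARD('n) / 2)) * (4 * pi * t) powr (- (real CARD('n) / 2)) = (4 * pi * (2 * t)) powr (- (real CARD('n) / 2))"
    using assms by (subst powr_mult[symmetric]) (auto simp: mult_ac)
  finally have c: "(4 * pi * t) powr (- (real CARD('n) / 2)) = 2 powr (real CARD('n) / 2) * (4 * pi * (2 * t)) powr (- (real CARD('n) / 2))" .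
  have "heat t z \<le> (4 * pi * t) powr (- (real CARD('n) / 2)) * (exp (- r\<^sup>2 / (8 * t)) * exp (- (z \<bullet> z) / (4 * (2 * t))))"
    unfolding heat_def by (rule mult_left_mono[OF e]) simp
  then show ?thesis unfolding c by (simp add: heat_def mult_ac)
qed

lemma heat_smoothing_tendsto:
  fixes x :: "real^'n::finite"
  assumes A: "open A" "x \<in> A" and t: "\<And>k. 0 < t k" "t \<longlonglongrightarrow> 0"
  shows "(\<lambda>k::nat. \<integral>y. indicator A y * heat (t k) (y - x) \<partial>lborel) \<longlonglongrightarrow> 1"
proof -
  obtain r where r: "r > 0" "ball x r \<subseteq> A" using A by (auto simp: open_contains_ball)
  have [measurable]: "A \<in> sets borel" using A by simp
  let ?c = "2 powr (real CARD('n) / 2)"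
  have ii: "integrable lborel (\<lambda>y. indicator A y * heat (t k) (y - x))" for k
    by (rule Bochner_Integration.integrable_bound[OF heat_integral(1)[OF t(1), of k x]])
      (auto simp: indicator_def)
  have up: "(\<integral>y. indicator A y * heat (t k) (y - x) \<partial>lborel) \<le> 1" for k
    unfolding heat_integral(2)[OF t(1), of k x, symmetric]
    by (rule integral_mono[OF ii heat_integral(1)[OF t(1)]]) (auto simp: indicator_def heat_nonneg)
  have lo: "1 - ?c * exp (- r\<^sup>2 / (8 * t k)) \<le> (\<integral>y. indicator A y * heat (t k) (y - x) \<partial>lborel)" for k
  proof -
    have t2: "0 < 2 * t k" using t(1)[of k] by simp
    have "1 = (\<integral>y. heat (t k) (y - x) \<partial>lborel)" using heat_integral(2)[OF t(1)] by simp
    also have "\<dots> \<le> (\<integral>y. indicator A y * heat (t k) (y - x) + ?c * exp (- r\<^sup>2 / (8 * t k)) * heat (2 * t k) (y - x) \<partial>lborel)"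
    proof (rule integral_mono)
      fix y
      show "heat (t k) (y - x) \<le> indicator A y * heat (t k) (y - x) + ?c * exp (- r\<^sup>2 / (8 * t k)) * heat (2 * t k) (y - x)"
      proof (cases "y \<in> A")
        case True then show ?thesis by (simp add: heat_nonneg)
      next
        case False
        then have "norm (y - x) \<ge> r" using r(2) by (metis dist_commute dist_norm in_mono mem_ball not_le)
        then show ?thesis using False heat_tail[OF t(1), of r "y - x" k] r(1) by simp
      qed
    next
      show "integrable lborel (\<lambda>y. indicator A y * heat (t k) (y - x) + ?c * exp (- r\<^sup>2 / (8 * t k)) * heat (2 * t k) (y - x))"
        by (intro Bochner_Integration.integrable_add integrable_mult_right ii heat_integral(1) t2)
    qed (rule heat_integral(1)[OF t(1)])
    also have "\<dots> = (\<integral>y. indicator A y * heat (t k) (y - x) \<partial>lborel) + ?c * exp (- r\<^sup>2 / (8 * t k))"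
      using ii[of k] heat_integral[OF t2, of x] by simp
    finally show ?thesis by simp
  qed
  have "filterlim (\<lambda>k. inverse (t k)) at_top sequentially"
    by (rule filterlim_compose[OF filterlim_inverse_at_top_right]) (use t in \<open>auto simp: filterlim_at less_imp_neq[OF t(1), symmetric]\<close>)
  then have "filterlim (\<lambda>k. - (r\<^sup>2 / 8) * inverse (t k)) at_bot sequentially"
    using r(1) by (intro filterlim_tendsto_neg_mult_at_bot[OF tendsto_const]) auto
  then have "(\<lambda>k. exp (- (r\<^sup>2 / 8) * inverse (t k))) \<longlonglongrightarrow> 0"
    by (rule filterlim_compose[OF exp_at_bot])
  then have "(\<lambda>k. exp (- r\<^sup>2 / (8 * t k))) \<longlonglongrightarrow> 0" by (simp add: field_simps)
  then have "(\<lambda>k. 1 - ?c * exp (- r\<^sup>2 / (8 * t k))) \<longlonglongrightarrow> 1 - ?c * 0" by (intro tendsto_intros)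
  then have l: "(\<lambda>k. 1 - ?c * exp (- r\<^sup>2 / (8 * t k))) \<longlonglongrightarrow> 1" by simp
  show ?thesis
    by (rule tendsto_sandwich[OF _ _ l tendsto_const]; intro always_eventually allI; rule lo up)
qed

section \<open>From bounds on heat averages to bounds almost everywhere\<close>

context bounded_open
begin

text \<open>Suppose \<open>W\<close> exceeds \<open>M + d\<close> on a set \<open>E\<close> of
  positive measure, and let \<open>A\<close> be an open superset of \<open>E\<close> with little
  excess. Integrating the averages over centres \<open>y\<close> in \<open>A\<close> gives at most
  \<open>M\<close> times the measure of \<open>A\<close>. After exchanging the integrals, the points
  of \<open>E\<close> alone contribute \<open>M + d\<close> times the integral over \<open>E\<close>
  of the heat smoothing \<open>p k\<close> of the indicator of \<open>A\<close>, and
  \<open>p k\<close> tends to 1 on \<open>A\<close>. In the limit this exceeds the upper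
  bound.\<close>

lemma AE_le_if_heat_averages_le:
  fixes W :: "real^'n \<Rightarrow> real"
  assumes W: "integrable N W" "\<And>x. 0 \<le> W x"
    and avg: "\<And>e y. e > 0 \<Longrightarrow> (\<integral>x. heat e (x - y) * W x \<partial>N) \<le> M"
  shows "AE x in N. W x \<le> M"
proof -
  have [measurable]: "W \<in> borel_measurable N" using W by simp
  have "0 \<le> (\<integral>x. heat 1 (x - 0) * W x \<partial>N)" by (intro integral_nonneg_AE always_eventually allI mult_nonneg_nonneg heat_nonneg W(2))
  then have M0: "0 \<le> M" using avg[of 1 0] by simp
  have null: "emeasure N {x \<in> \<Omega>. M + d < W x} = 0" if d: "d > 0" for d
  proof (rule ccontr)
    define E where "E = {x \<in> \<Omega>. M + d < W x}"
    assume "emeasure N {x \<in> \<Omega>. M + d < W x} \<noteq> 0"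
    moreover have EN [measurable]: "E \<in> sets N" unfolding E_def using borel_measurable_less[of "\<lambda>_. M + d" N W] by (simp add: space_N)
    ultimately have pos: "measure N E > 0"
      unfolding E_def using emeasure_eq_measure[of "{x \<in> \<Omega>. M + d < W x}"] by (simp add: zero_less_measure_iff)
    have EO: "E \<subseteq> \<Omega>" unfolding E_def by auto
    have EL: "E \<in> sets lebesgue" using EN by (simp add: sets_restrict_space_iff)
    have eE: "emeasure lebesgue E = ennreal (measure N E)"
      using EO EL emeasure_eq_measure[of E] by (simp add: emeasure_restrict_space)
    \<comment> \<open>The limit yields \<open>d * measure N E \<le> M * \<eta>\<close>; this excess
      makes the right side at most half of the left. The summand 1 covers
      \<open>M = 0\<close>.\<close>
    define \<eta> where "\<eta> = d * measure N E / (2 * (M + 1))"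
    have \<eta>: "\<eta> > 0" using d pos M0 by (simp add: \<eta>_def)
    obtain A where A: "open A" "E \<subseteq> A" "A - E \<in> lmeasurable" "emeasure lebesgue (A - E) < ennreal \<eta>"
      using sets_lebesgue_outer_open[OF EL \<eta>] by blast
    have [measurable]: "A \<in> sets borel" using A by simp
    have "emeasure lborel A = emeasure lebesgue (E \<union> (A - E))"
      using A by (simp add: Un_absorb1)
    also have "\<dots> \<le> emeasure lebesgue E + emeasure lebesgue (A - E)"
      by (rule emeasure_subadditive) (use EL A in auto)
    also have "\<dots> \<le> ennreal (measure N E) + ennreal \<eta>"
      unfolding eE using A(4) by (intro add_mono) auto
    finally have mA: "emeasure lborel A \<le> ennreal (measure N E + \<eta>)" using \<eta> by (simp add: measure_nonneg)
    define t where "t k = 1 / real (Suc k)" for k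
    have t: "0 < t k" "t \<longlonglongrightarrow> 0" for k unfolding t_def using LIMSEQ_Suc[OF lim_1_over_n] by auto
    define p where "p k x = (\<integral>y. indicator A y * heat (t k) (y - x) \<partial>lborel)" for k x
    have ip: "integrable lborel (\<lambda>y. indicator A y * heat (t k) (y - x))" for k x
      by (rule Bochner_Integration.integrable_bound[OF heat_integral(1)[OF t(1), of k x]])
        (auto simp: indicator_def)
    have p01: "0 \<le> p k x \<and> p k x \<le> 1" for k x
    proof
      show "0 \<le> p k x" unfolding p_def by (rule integral_nonneg_AE) (auto simp: heat_nonneg)
      show "p k x \<le> 1" unfolding p_def heat_integral(2)[OF t(1), of k x, symmetric]
        by (rule integral_mono[OF ip heat_integral(1)[OF t(1)]]) (auto simp: indicator_def heat_nonneg)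
    qed
    have [measurable]: "p k \<in> borel_measurable borel" for k
      unfolding p_def[abs_def] by measurable
    then have [measurable]: "p k \<in> borel_measurable N" for k by (rule borel_imp_measurable_N)
    interpret NL: pair_sigma_finite N "lborel :: (real^'n) measure" ..
    have idN [measurable]: "(\<lambda>x. x) \<in> N \<rightarrow>\<^sub>M borel" by (rule borel_imp_measurable_N[where f="\<lambda>x. x"]) simp
    have main: "(M + d) * (\<integral>x. indicator E x * p k x \<partial>N) \<le> M * (measure N E + \<eta>)" for k
    proof -
      have iEp: "integrable N (\<lambda>x. indicator E x * p k x)"
        by (rule integrable_bounded_N[of _ 1]) (use p01[of k] in \<open>auto simp: indicator_def\<close>)
      have Wh: "integrable N (\<lambda>x. W x * heat (t k) (y - x))" for y
      proof (rule integrable_mult_bounded[OF W(1), where K="(4 * pi * t k) powr (- (real CARD('n) / 2))"])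
        show "(\<lambda>x. heat (t k) (y - x)) \<in> borel_measurable N" by measurable
      qed (auto simp: abs_of_nonneg heat_nonneg intro!: heat_le t)
      have "ennreal ((M + d) * (\<integral>x. indicator E x * p k x \<partial>N)) = (\<integral>\<^sup>+x. ennreal ((M + d) * (indicator E x * p k x)) \<partial>N)"
        using iEp p01 d M0 by (subst nn_integral_eq_integral) auto
      also have "\<dots> \<le> (\<integral>\<^sup>+x. (\<integral>\<^sup>+y. ennreal (W x * (indicator A y * heat (t k) (y - x))) \<partial>lborel) \<partial>N)"
      proof (rule nn_integral_mono)
        fix x
        have "(\<integral>\<^sup>+y. ennreal (W x * (indicator A y * heat (t k) (y - x))) \<partial>lborel) = ennreal (W x * p k x)"
          unfolding p_def using ip[of k x] W(2)[of x] by (subst nn_integral_eq_integral) (auto simp: heat_nonneg)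
        moreover have "(M + d) * (indicator E x * p k x) \<le> W x * p k x"
          using p01[of k x] W(2)[of x] by (cases "x \<in> E") (auto simp: E_def intro!: mult_right_mono)
        ultimately show "ennreal ((M + d) * (indicator E x * p k x)) \<le> (\<integral>\<^sup>+y. ennreal (W x * (indicator A y * heat (t k) (y - x))) \<partial>lborel)"
          by (simp add: ennreal_leI)
      qed
      also have "\<dots> = (\<integral>\<^sup>+y. (\<integral>\<^sup>+x. ennreal (W x * (indicator A y * heat (t k) (y - x))) \<partial>N) \<partial>lborel)"
        by (rule NL.Fubini'[symmetric]) measurable
      also have "\<dots> \<le> (\<integral>\<^sup>+y. ennreal M * indicator A y \<partial>lborel)"
      proof (rule nn_integral_mono)
        fix y
        have "(\<integral>\<^sup>+x. ennreal (W x * heat (t k) (y - x)) \<partial>N) = ennreal (\<integral>x. W x * heat (t k) (y - x) \<partial>N)"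
          using Wh W(2) by (intro nn_integral_eq_integral) (auto simp: heat_nonneg)
        also have "\<dots> \<le> ennreal M"
          using avg[OF t(1), of k y] by (intro ennreal_leI) (simp add: heat_minus[of _ y] mult.commute)
        finally show "(\<integral>\<^sup>+x. ennreal (W x * (indicator A y * heat (t k) (y - x))) \<partial>N) \<le> ennreal M * indicator A y"
          by (cases "y \<in> A") auto
      qed
      also have "\<dots> = ennreal M * emeasure lborel A" by (simp add: nn_integral_cmult)
      also have "\<dots> \<le> ennreal M * ennreal (measure N E + \<eta>)" by (rule mult_left_mono[OF mA]) simp
      also have "\<dots> = ennreal (M * (measure N E + \<eta>))" using M0 \<eta> by (simp add: ennreal_mult'')
      finally show ?thesis using M0 \<eta> by (subst (asm) ennreal_le_iff) auto
    qed
    have lim: "(\<lambda>k. \<integral>x. indicator E x * p k x \<partial>N) \<longlonglongrightarrow> (\<integral>x. indicator E x \<partial>N)"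
    proof (rule integral_dominated_convergence[where w="\<lambda>_. 1"])
      show "AE x in N. (\<lambda>k. indicator E x * p k x) \<longlonglongrightarrow> indicator E x"
      proof (rule AE_I2)
        fix x
        show "(\<lambda>k. indicator E x * p k x) \<longlonglongrightarrow> indicator E x"
        proof (cases "x \<in> E")
          case True
          then have "(\<lambda>k. p k x) \<longlonglongrightarrow> 1" unfolding p_def using A(2) by (intro heat_smoothing_tendsto A t) auto
          then show ?thesis using True by simp
        qed simp
      qed
      show "AE x in N. norm (indicator E x * p k x) \<le> 1" for k
        using p01[of k] by (intro AE_I2) (auto simp: indicator_def)
    qed auto
    have "(\<lambda>k. (M + d) * (\<integral>x. indicator E x * p k x \<partial>N)) \<longlonglongrightarrow> (M + d) * (\<integral>x. indicator E x \<partial>N)"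
      by (intro tendsto_intros lim)
    then have "(M + d) * (\<integral>x. indicator E x \<partial>N) \<le> M * (measure N E + \<eta>)"
      by (rule LIMSEQ_le_const2) (use main in auto)
    moreover have "(\<integral>x. indicator E x \<partial>N) = measure N E"
      using EO by (simp add: Int_absorb2)
    ultimately have "d * measure N E \<le> M * \<eta>" by (simp add: algebra_simps)
    also have "\<dots> \<le> (M + 1) * \<eta>" using \<eta> by simp
    also have "\<dots> = d * measure N E / 2"
    proof -
      have "M + 1 \<noteq> 0" using M0 by simp
      then show ?thesis unfolding \<eta>_def by (metis nonzero_mult_divide_mult_cancel_left mult.commute times_divide_eq_right)
    qed
    finally show False using d pos by simp
  qed
  have "AE x in N. W x \<le> M + 1 / real (Suc k)" for k
  proof (rule AE_I[of _ _ "{x \<in> \<Omega>. M + 1 / real (Suc k) < W x}"])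
    show "{x \<in> \<Omega>. M + 1 / real (Suc k) < W x} \<in> sets N"
      using borel_measurable_less[of "\<lambda>_. M + 1 / real (Suc k)" N W] by (simp add: space_N)
  qed (use null[of "1 / real (Suc k)"] in auto)
  then have "AE x in N. \<forall>k. W x \<le> M + 1 / real (Suc k)" by (simp add: AE_all_countable)
  then show ?thesis
  proof eventually_elim
    case (elim x)
    have "(\<lambda>k. M + 1 / real (Suc k)) \<longlonglongrightarrow> M + 0" using LIMSEQ_Suc[OF lim_1_over_n] by (intro tendsto_intros) simp
    then show ?case using elim by (intro LIMSEQ_le_const[of "\<lambda>k. M + 1 / real (Suc k)" M]) auto
  qed
qed

end

section \<open>Derivatives of the heat kernel\<close>

lemma has_derivative_sq_dist:
  fixes x y :: "real^'n::finite"
  shows "((\<lambda>x. (x - y) \<bullet> (x - y)) has_derivative (\<lambda>h. 2 * ((x - y) \<bullet> h))) (at x)"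
  by (auto intro!: derivative_eq_intros simp: inner_commute)

lemma partial_heat:
  fixes x y :: "real^'n::finite"
  assumes "t > 0"
  shows "partial i (\<lambda>x. heat t (x - y)) x = - ((x - y) $ i / (2 * t)) * heat t (x - y)"
    and "(\<lambda>x. heat t (x - y)) differentiable (at x)"
proof -
  let ?c = "(4 * pi * t) powr (- (real CARD('n) / 2))"
  have h: "heat t (x - y) = ?c * exp ((- 1 / (4 * t)) * ((x - y) \<bullet> (x - y)))" for x
    by (simp add: heat_def)
  have *: "((\<lambda>x. heat t (x - y)) has_derivative (\<lambda>h. ?c * ((- 1 / (4 * t)) * (2 * ((x - y) \<bullet> h)) * exp ((- 1 / (4 * t)) * ((x - y) \<bullet> (x - y)))))) (at x)"
    unfolding h by (rule has_derivative_mult_right[OF has_derivative_exp[OF has_derivative_mult_right[OF has_derivative_sq_dist]]])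
  then show "(\<lambda>x. heat t (x - y)) differentiable (at x)" by (auto simp: differentiable_def)
  show "partial i (\<lambda>x. heat t (x - y)) x = - ((x - y) $ i / (2 * t)) * heat t (x - y)"
  proof -
    have ax: "(x - y) \<bullet> axis i 1 = (x - y) $ i" by (simp add: inner_axis)
    have "c * ((- 1 / (4 * t)) * (2 * d) * E) = - (d / (2 * t)) * (c * E)" for c d E
      using assms by (simp add: field_simps)
    then show ?thesis using partial_eqI[OF *, of i] unfolding ax h[of x] by metis
  qed
qed

lemma smooth_term_sum: "finite S \<Longrightarrow> (\<And>i. i \<in> S \<Longrightarrow> smooth_term (f i)) \<Longrightarrow> smooth_term (\<lambda>x. \<Sum>i\<in>S. f i x)"
  by (induction S rule: finite_induct) (auto intro: smooth_term.const smooth_term.add)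

lemma smooth_heat: "smooth_Rn (\<lambda>x. heat t (x - y))"
proof (rule smooth_term_smooth)
  have "heat t (x - y) = (4 * pi * t) powr (- (real CARD('a) / 2)) *
      exp ((- 1 / (4 * t)) * (\<Sum>i\<in>UNIV. (x $ i + - y $ i) * (x $ i + - y $ i)))" for x
    by (simp add: heat_def inner_vec_def)
  moreover have "smooth_term (\<lambda>x. (4 * pi * t) powr (- (real CARD('a) / 2)) *
      exp ((- 1 / (4 * t)) * (\<Sum>i\<in>UNIV. (x $ i + - y $ i) * (x $ i + - y $ i))))"
    by (intro smooth_term.mult smooth_term.exp smooth_term.const smooth_term_sum smooth_term.add smooth_term.nth) auto
  ultimately show "smooth_term (\<lambda>x. heat t (x - y))" by simp
qed

text \<open>Summed over \<open>i\<close>, the coefficient is the squared distance over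
  \<open>4 * t\<^sup>2\<close> minus the dimension over \<open>2 * t\<close>: the negative of the
  coefficient in the reversed-time derivative \<open>DERIV_heat_time\<close>, which is the backward
  heat equation.\<close>

lemma partial_partial_heat:
  fixes x y :: "real^'n::finite"
  assumes t: "t > 0"
  shows "partial i (\<lambda>x. - ((x - y) $ i / (2 * t)) * heat t (x - y)) x =
    (((x - y) $ i)\<^sup>2 / (4 * t\<^sup>2) - 1 / (2 * t)) * heat t (x - y)"
proof -
  let ?l = "\<lambda>x::real^'n. (- 1 / (2 * t)) * x $ i + y $ i / (2 * t)"
  have d: "(?l has_derivative (\<lambda>h. (- 1 / (2 * t)) * h $ i)) (at x)"
    using t by (auto intro!: derivative_eq_intros bounded_linear_imp_has_derivative[OF bounded_linear_vec_nth])
  have eq: "(\<lambda>x. - ((x - y) $ i / (2 * t)) * heat t (x - y)) = (\<lambda>x. ?l x * heat t (x - y))"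
    by (rule ext) (simp add: diff_divide_distrib algebra_simps)
  have "partial i (\<lambda>x. ?l x * heat t (x - y)) x = ?l x * partial i (\<lambda>x. heat t (x - y)) x + partial i ?l x * heat t (x - y)"
    by (rule partial_mult) (use d partial_heat(2)[OF t] in \<open>auto simp: differentiable_def\<close>)
  also have "partial i ?l x = - 1 / (2 * t)" using partial_eqI[OF d, of i] by simp
  also have "?l x * partial i (\<lambda>x. heat t (x - y)) x = ((x - y) $ i)\<^sup>2 / (4 * t\<^sup>2) * heat t (x - y)"
    unfolding partial_heat(1)[OF t] using t by (simp add: field_simps power2_eq_square)
  finally show ?thesis unfolding eq by (simp add: algebra_simps)
qed

lemma DERIV_heat_time:
  fixes x :: "real^'n::finite"
  assumes t: "t < S"
  shows "((\<lambda>t. heat (S - t) x) has_real_derivative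
    (real CARD('n) / (2 * (S - t)) - (x \<bullet> x) / (4 * (S - t)\<^sup>2)) * heat (S - t) x) (at t)"
proof -
  let ?c = "- (real CARD('n) / 2)" and ?s = "S - t"
  have s: "?s > 0" using t by simp
  have 1: "((\<lambda>t. (4 * pi * (S - t)) powr ?c) has_real_derivative (4 * pi * ?s) powr ?c * (real CARD('n) / (2 * ?s))) (at t)"
  proof -
    have "((\<lambda>t. 4 * pi * (S - t)) has_real_derivative - (4 * pi)) (at t)" by (auto intro!: derivative_eq_intros)
    from DERIV_fun_powr[OF this, of ?c] s
    have "((\<lambda>t. (4 * pi * (S - t)) powr ?c) has_real_derivative ?c * (4 * pi * ?s) powr (?c - 1) * - (4 * pi)) (at t)" by simp
    moreover have "(4 * pi * ?s) powr (?c - 1) = (4 * pi * ?s) powr ?c / (4 * pi * ?s)"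
      using s by (subst powr_diff) simp
    moreover have "?c * (P / (4 * pi * ?s)) * - (4 * pi) = P * (real CARD('n) / (2 * ?s))" for P
      using s by (simp add: field_simps)
    ultimately show ?thesis by simp
  qed
  have 2: "((\<lambda>t. exp (- (x \<bullet> x) / (4 * (S - t)))) has_real_derivative exp (- (x \<bullet> x) / (4 * ?s)) * (- ((x \<bullet> x) / (4 * ?s\<^sup>2)))) (at t)"
  proof -
    have "((\<lambda>t. - (x \<bullet> x) / (4 * (S - t))) has_real_derivative - ((x \<bullet> x) / (4 * ?s\<^sup>2))) (at t)"
    proof -
      have "((\<lambda>t. S - t) has_real_derivative - 1) (at t)" by (auto intro!: derivative_eq_intros)
      from DERIV_cmult[OF DERIV_inverse'[OF this], of "- (x \<bullet> x) / 4"] s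
      have "((\<lambda>t. - (x \<bullet> x) / 4 * inverse (S - t)) has_real_derivative - (x \<bullet> x) / 4 * - (inverse ?s * - 1 * inverse ?s)) (at t)" by simp
      moreover have "(\<lambda>t. - (x \<bullet> x) / 4 * inverse (S - t)) = (\<lambda>t. - (x \<bullet> x) / (4 * (S - t)))"
        by (rule ext) (simp add: inverse_eq_divide)
      moreover have "- (x \<bullet> x) / 4 * - (inverse ?s * - 1 * inverse ?s) = - ((x \<bullet> x) / (4 * ?s\<^sup>2))"
        by (simp add: inverse_eq_divide power2_eq_square)
      ultimately show ?thesis by (simp only:)
    qed
    then show ?thesis by (rule DERIV_fun_exp)
  qed
  show ?thesis
    using DERIV_mult[OF 1 2] unfolding heat_def by (simp add: algebra_simps)
qed

section \<open>The energy inequality tested with the heat kernel\<close>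

context bounded_open
begin

lemma heat_energy:
  fixes u :: "real \<Rightarrow> real^'n \<Rightarrow> real"
  assumes W: "weak_solution \<Omega> p f g u" and uc: "continuous_L2 \<Omega> u" and p: "p \<ge> 2"
    and f: "continuous_on UNIV f" and growth: "\<And>s. \<bar>f s\<bar> \<le> C1 * (1 + \<bar>s\<bar> powr (p - 1))"
    and C2: "0 \<le> C2" "\<And>s. - C2 \<le> f s * s"
    and g: "integrable N g" and ab: "0 < a" "a < b" and e: "e > 0"
  shows "(\<integral>x. heat e (x - y) * hyp (u b x) \<partial>N) \<le> (\<integral>x. heat (b + e - a) (x - y) * hyp (u a x) \<partial>N)
    + (\<integral>t. indicator {a..<b} t * (\<integral>x. (C2 + \<bar>g x\<bar>) * heat (b + e - t) (x - y) \<partial>N) \<partial>lborel)"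
    and "integrable lborel (\<lambda>t. indicator {a..<b} t * (\<integral>x. (C2 + \<bar>g x\<bar>) * heat (b + e - t) (x - y) \<partial>N))"
proof -
  have T: "b + 1 > 0" using ab by simp
  obtain U :: "real \<times> (real^'n) \<Rightarrow> real" and H :: "real \<times> (real^'n) \<Rightarrow> real^'n" where UH:
    "U \<in> borel_measurable borel" "\<And>i. (\<lambda>z. H z $ i) \<in> borel_measurable borel"
    "integrable Q (\<lambda>z. (U z)\<^sup>2)" "\<And>i. integrable Q (\<lambda>z. (H z $ i)\<^sup>2)"
    "integrable Q (\<lambda>z. indicator {0<..<b + 1} (fst z) * f (U z))"
    "AE t in lborel. t \<in> {0<..<b + 1} \<longrightarrow> (AE x in N. U (t, x) = u t x) \<and> H10_on \<Omega> (\<lambda>x. U (t, x)) (\<lambda>x. H (t, x))"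
    "\<And>v Gv C s t. H10_on \<Omega> v Gv \<Longrightarrow> (\<And>x. x \<in> \<Omega> \<Longrightarrow> \<bar>v x\<bar> \<le> C) \<Longrightarrow> 0 < s \<Longrightarrow> s < t \<Longrightarrow> t < b + 1 \<Longrightarrow>
      (\<integral>x. u t x * v x \<partial>N) - (\<integral>x. u s x * v x \<partial>N) =
      - (\<integral>r. indicator {s<..t} r * (\<integral>x. H (r, x) \<bullet> Gv x + f (U (r, x)) * v x - g x * v x \<partial>N) \<partial>lborel)"
    by (fact weak_solution_borel[OF W uc T p f growth g])
  \<comment> \<open>The singular time of the reversed kernel lies \<open>e\<close> beyond
    \<open>b\<close>, so on \<open>[0, b]\<close> the remaining time is at least \<open>e\<close>
    and all bounds on the kernel and its derivatives are uniform.\<close>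
  define S where "S = b + e"
  define \<phi> where "\<phi> z = heat (S - fst z) (snd z - y)" for z
  define \<phi>t where "\<phi>t z = (real CARD('n) / (2 * (S - fst z)) - ((snd z - y) \<bullet> (snd z - y)) / (4 * (S - fst z)\<^sup>2)) * \<phi> z" for z
  define D\<phi> where "D\<phi> i z = - ((snd z - y) $ i / (2 * (S - fst z))) * \<phi> z" for i and z :: "real \<times> (real^'n)"
  have [measurable]: "(fst :: real \<times> (real^'n) \<Rightarrow> real) \<in> borel_measurable borel" "(snd :: real \<times> (real^'n) \<Rightarrow> real^'n) \<in> borel_measurable borel"
    by (intro borel_measurable_continuous_onI continuous_intros)+
  have m1 [measurable]: "\<phi> \<in> borel_measurable borel" unfolding \<phi>_def[abs_def] heat_def by measurable
  have m2: "\<phi>t \<in> borel_measurable borel" unfolding \<phi>t_def[abs_def] by measurable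
  have [measurable]: "(\<lambda>z :: real \<times> (real^'n). (snd z - y) $ i) \<in> borel_measurable borel" for i
    by (intro borel_measurable_continuous_onI continuous_intros)
  have m3: "D\<phi> i \<in> borel_measurable borel" for i unfolding D\<phi>_def[abs_def] by measurable
  obtain R where R: "R > 0" "\<And>x. x \<in> \<Omega> \<Longrightarrow> norm (x - y) \<le> R"
  proof -
    obtain R0 where R0: "\<And>x. x \<in> \<Omega> \<Longrightarrow> norm x \<le> R0" using bounded_dom by (auto simp: bounded_iff)
    have "norm (x - y) \<le> \<bar>R0\<bar> + norm y + 1" if "x \<in> \<Omega>" for x
      using norm_triangle_ineq4[of x y] R0[OF that] by linarith
    moreover have "0 < \<bar>R0\<bar> + norm y + 1" using norm_ge_zero[of y] by linarith
    ultimately show ?thesis using that[of "\<bar>R0\<bar> + norm y + 1"] by blast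
  qed
  define A where "A = (4 * pi * e) powr (- (real CARD('n) / 2))"
  \<comment> \<open>One summand each for \<open>\<phi>\<close>, \<open>\<phi>t\<close> and
    \<open>D\<phi>\<close>: \<open>A\<close> bounds the kernel at remaining time at least
    \<open>e\<close>, and \<open>R\<close> bounds the distance from \<open>y\<close> to the domain
    points. \<open>K\<close> blows up as \<open>e\<close> tends to 0 but does not enter the
    resulting inequality.\<close>
  define K where "K = A + (real CARD('n) / (2 * e) + R\<^sup>2 / (4 * e\<^sup>2)) * A + R / (2 * e) * A"
  have A0: "A \<ge> 0" by (simp add: A_def)
  have K1: "A \<le> K" "(real CARD('n) / (2 * e) + R\<^sup>2 / (4 * e\<^sup>2)) * A \<le> K" "R / (2 * e) * A \<le> K"
    unfolding K_def using A0 e R(1) by (auto simp: add_nonneg_nonneg)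
  have Se: "e \<le> S - t" "0 < S - t" if "t \<in> {0..b}" for t using that e by (auto simp: S_def)
  have pb: "0 \<le> \<phi> (t, x)" "\<phi> (t, x) \<le> A" if "t \<in> {0..b}" for t x
  proof -
    show "0 \<le> \<phi> (t, x)" by (simp add: \<phi>_def heat_nonneg)
    have "\<phi> (t, x) \<le> (4 * pi * (S - t)) powr (- (real CARD('n) / 2))"
      unfolding \<phi>_def using heat_le[OF Se(2)[OF that]] by simp
    also have "\<dots> \<le> A" unfolding A_def using Se[OF that] e by (intro powr_mono2') auto
    finally show "\<phi> (t, x) \<le> A" .
  qed
  interpret E: energy_setting \<Omega> "b + 1" a b K C2 f g u U H \<phi> \<phi>t D\<phi>
  proof (unfold_locales; (intro UH | rule ab uc C2 g m1 m2 m3)?)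
    show "b < b + 1" by simp
    show "f \<in> borel_measurable borel" using f by (rule borel_measurable_continuous_onI)
    fix t x assume t: "t \<in> {0..b}"
    show "0 \<le> \<phi> (t, x)" by (rule pb(1)[OF t])
    show "(\<Sum>i\<in>UNIV. partial i (\<lambda>x. D\<phi> i (t, x)) x) = - \<phi>t (t, x)"
    proof -
      have "(\<Sum>i\<in>UNIV. partial i (\<lambda>x. D\<phi> i (t, x)) x) = (\<Sum>i\<in>UNIV. ((((x - y) $ i)\<^sup>2 / (4 * (S - t)\<^sup>2) - 1 / (2 * (S - t))) * heat (S - t) (x - y)))"
        unfolding D\<phi>_def \<phi>_def fst_conv snd_conv by (intro sum.cong refl partial_partial_heat Se t)
      also have "\<dots> = ((\<Sum>i\<in>UNIV. ((x - y) $ i)\<^sup>2) / (4 * (S - t)\<^sup>2) - real CARD('n) * (1 / (2 * (S - t)))) * heat (S - t) (x - y)"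
        by (simp add: sum_distrib_right[symmetric] sum_subtractf sum_divide_distrib)
      also have "(\<Sum>i\<in>UNIV. ((x - y) $ i)\<^sup>2) = (x - y) \<bullet> (x - y)" by (simp add: inner_vec_def power2_eq_square)
      finally show ?thesis by (simp add: \<phi>t_def \<phi>_def algebra_simps)
    qed
    assume x: "x \<in> \<Omega>"
    have q: "0 \<le> (x - y) \<bullet> (x - y)" "(x - y) \<bullet> (x - y) \<le> R\<^sup>2"
      using R(2)[OF x] power_mono[of "norm (x - y)" R 2] by (auto simp: power2_norm_eq_inner)
    show "\<bar>\<phi> (t, x)\<bar> \<le> K" using pb[OF t, of x] K1 by simp
    have d2: "1 / (2 * (S - t)) \<le> 1 / (2 * e)" "1 / (4 * (S - t)\<^sup>2) \<le> 1 / (4 * e\<^sup>2)"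
      using Se[OF t] e by (auto intro!: divide_left_mono power_mono mult_pos_pos)
    show "\<bar>\<phi>t (t, x)\<bar> \<le> K"
    proof -
      have "\<bar>real CARD('n) / (2 * (S - t)) - ((x - y) \<bullet> (x - y)) / (4 * (S - t)\<^sup>2)\<bar> \<le> real CARD('n) * (1 / (2 * (S - t))) + ((x - y) \<bullet> (x - y)) * (1 / (4 * (S - t)\<^sup>2))"
      proof -
        have "0 \<le> real CARD('n) / (2 * (S - t))" "0 \<le> ((x - y) \<bullet> (x - y)) / (4 * (S - t)\<^sup>2)" using q Se[OF t] by auto
        then show ?thesis unfolding times_divide_eq_right mult_1_right by linarith
      qed
      also have "\<dots> \<le> real CARD('n) * (1 / (2 * e)) + R\<^sup>2 * (1 / (4 * e\<^sup>2))"
        using d2 q by (intro add_mono mult_left_mono mult_mono) auto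
      finally have "\<bar>real CARD('n) / (2 * (S - t)) - ((x - y) \<bullet> (x - y)) / (4 * (S - t)\<^sup>2)\<bar> \<le> real CARD('n) / (2 * e) + R\<^sup>2 / (4 * e\<^sup>2)" by simp
      then have "\<bar>\<phi>t (t, x)\<bar> \<le> (real CARD('n) / (2 * e) + R\<^sup>2 / (4 * e\<^sup>2)) * A"
        unfolding \<phi>t_def abs_mult fst_conv snd_conv using pb[OF t, of x] by (intro mult_mono) (auto simp: R e less_imp_le)
      with K1 show ?thesis by simp
    qed
    show "\<bar>D\<phi> i (t, x)\<bar> \<le> K" for i
    proof -
      have "\<bar>(x - y) $ i\<bar> \<le> R" using component_le_norm_cart[of "x - y" i] R(2)[OF x] by linarith
      then have "\<bar>(x - y) $ i\<bar> * (1 / (2 * (S - t))) \<le> R * (1 / (2 * e))"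
        using d2 R(1) Se[OF t] by (intro mult_mono) auto
      then have "\<bar>(x - y) $ i / (2 * (S - t))\<bar> \<le> R / (2 * e)" using Se[OF t] by (simp add: abs_mult)
      then have "\<bar>D\<phi> i (t, x)\<bar> \<le> R / (2 * e) * A"
        unfolding D\<phi>_def abs_mult abs_minus_cancel fst_conv snd_conv using pb[OF t, of x] R e by (intro mult_mono) auto
      with K1 show ?thesis by simp
    qed
    show "((\<lambda>t. \<phi> (t, x)) has_real_derivative \<phi>t (t, x)) (at t)"
      unfolding \<phi>t_def \<phi>_def fst_conv snd_conv by (rule DERIV_heat_time) (use Se[OF t] in simp)
  next
    fix t i assume t: "t \<in> {0..b}"
    show "smooth_Rn (\<lambda>x. \<phi> (t, x))" unfolding \<phi>_def fst_conv snd_conv by (rule smooth_heat)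
    show "partial i (\<lambda>x. \<phi> (t, x)) = (\<lambda>x. D\<phi> i (t, x))"
      unfolding \<phi>_def D\<phi>_def fst_conv snd_conv using partial_heat(1)[OF Se(2)[OF t]] by (intro ext)
  qed
  have "integrable lborel (\<lambda>t. \<integral>x. indicator {a..<b} t * ((C2 + \<bar>g x\<bar>) * \<phi> (t, x)) \<partial>N)"
    using QP.integrable_fst'[OF E.source_integrable] by simp
  then show "integrable lborel (\<lambda>t. indicator {a..<b} t * (\<integral>x. (C2 + \<bar>g x\<bar>) * heat (b + e - t) (x - y) \<partial>N))"
    by (simp add: \<phi>_def S_def)
  have "(\<integral>z. indicator {a..<b} (fst z) * ((C2 + \<bar>g (snd z)\<bar>) * \<phi> z) \<partial>Q) = (\<integral>t. indicator {a..<b} t * (\<integral>x. (C2 + \<bar>g x\<bar>) * heat (b + e - t) (x - y) \<partial>N) \<partial>lborel)"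
    using QP.integral_fst'[OF E.source_integrable] by (simp add: \<phi>_def S_def)
  then show "(\<integral>x. heat e (x - y) * hyp (u b x) \<partial>N) \<le> (\<integral>x. heat (b + e - a) (x - y) * hyp (u a x) \<partial>N)
    + (\<integral>t. indicator {a..<b} t * (\<integral>x. (C2 + \<bar>g x\<bar>) * heat (b + e - t) (x - y) \<partial>N) \<partial>lborel)"
    using E.energy_inequality by (simp add: \<phi>_def S_def)
qed

end

section \<open>The supremum bound\<close>

text \<open>Above the level \<open>1 / \<mu>\<close> the product \<open>a * \<mu>\<close> is at
  least 1, so multiplying \<open>a\<close> by its power of exponent \<open>q - 1\<close> can only
  increase it.\<close>

lemma young_split:
  fixes a \<mu> q :: real
  assumes "0 \<le> a" "0 < \<mu>" "1 \<le> q"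
  shows "a \<le> \<mu> powr (q - 1) * a powr q + 1 / \<mu>"
proof (cases "a \<le> 1 / \<mu>")
  case True
  then show ?thesis by (simp add: add_increasing)
next
  case False
  then have a: "a > 0" "1 \<le> a * \<mu>" using assms by (auto simp: field_simps not_le intro: less_trans[OF _ False[unfolded not_le]])
  have "a * 1 \<le> a * (a * \<mu>) powr (q - 1)"
    using a assms by (intro mult_left_mono ge_one_powr_ge_zero) auto
  also have "\<dots> = \<mu> powr (q - 1) * (a powr 1 * a powr (q - 1))"
    using a assms by (simp add: powr_mult mult_ac)
  also have "\<dots> = \<mu> powr (q - 1) * a powr q"
    unfolding powr_add[symmetric] by simp
  finally show ?thesis using assms by (simp add: add_increasing2)
qed

lemma integrable_powr_singularity:
  fixes \<theta> c :: real
  assumes "\<theta> < 1" "0 < c"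
  shows "integrable lborel (\<lambda>s. indicator {0<..c} s * s powr (- \<theta>))"
proof -
  have "set_integrable lebesgue {0<..c} (\<lambda>s. s powr (- \<theta>))"
    using assms by (intro nonnegative_absolutely_integrable_1 integrable_on_powr_from_0') auto
  then have "integrable lebesgue (\<lambda>s. indicator {0<..c} s * s powr (- \<theta>))"
    by (simp add: set_integrable_def)
  then show ?thesis by (subst (asm) integrable_completion) auto
qed

section \<open>Bounds for the initial term, the source term and the solution\<close>

context bounded_open
begin

lemma integral_N_heat_le:
  assumes "t > 0"
  shows "integrable N (\<lambda>x. heat t (x - y))" "(\<integral>x. heat t (x - y) \<partial>N) \<le> 1"
proof -
  have i: "integrable lborel (\<lambda>x. indicator \<Omega> x * heat t (x - y))"
    by (rule Bochner_Integration.integrable_bound[OF heat_integral(1)[OF assms, of y]]) (auto simp: indicator_def)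
  have e: "(\<integral>x. heat t (x - y) \<partial>N) = (\<integral>x. indicator \<Omega> x * heat t (x - y) \<partial>lborel)"
    "integrable N (\<lambda>x. heat t (x - y)) = integrable lborel (\<lambda>x. indicator \<Omega> x * heat t (x - y))"
    by (rule integral_lebesgue_on_AE_eq; simp)+
  show "integrable N (\<lambda>x. heat t (x - y))" unfolding e(2) by (rule i)
  show "(\<integral>x. heat t (x - y) \<partial>N) \<le> 1"
    unfolding e(1) heat_integral(2)[OF assms, of y, symmetric]
    by (rule integral_mono[OF i heat_integral(1)[OF assms]]) (auto simp: indicator_def heat_nonneg)
qed

text \<open>The modulus of \<open>v\<close> is at most
  \<open>(v x)\<^sup>2 / \<kappa> + \<kappa>\<close>. The first part is integrated against the
  supremum of the kernel, the second against its mass; the choice of \<open>\<kappa>\<close> as the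
  bound on the norm makes the result linear in the norm.\<close>

lemma initial_bound:
  fixes v :: "real^'n \<Rightarrow> real"
  assumes v: "v \<in> borel_measurable N" "integrable N (\<lambda>x. (v x)\<^sup>2)" "(\<integral>x. (v x)\<^sup>2 \<partial>N) \<le> \<kappa>\<^sup>2" and \<kappa>: "\<kappa> > 0"
    and c: "0 < c" "c \<le> \<sigma>"
  shows "(\<integral>x. heat \<sigma> (x - y) * hyp (v x) \<partial>N) \<le> ((4 * pi * c) powr (- (real CARD('n) / 2)) + 1) * \<kappa>"
proof -
  let ?A = "(4 * pi * c) powr (- (real CARD('n) / 2))"
  have \<sigma>: "\<sigma> > 0" using c by simp
  note h = integral_N_heat_le[OF \<sigma>, of y]
  have hA: "heat \<sigma> z \<le> ?A" for z :: "real^'n"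
    using heat_le[OF \<sigma>, of z] powr_mono2'[of "- (real CARD('n) / 2)" "4 * pi * c" "4 * pi * \<sigma>"] c by simp
  have "(\<integral>x. heat \<sigma> (x - y) * hyp (v x) \<partial>N) \<le> (\<integral>x. ?A / \<kappa> * (v x)\<^sup>2 + \<kappa> * heat \<sigma> (x - y) \<partial>N)"
  proof (rule integral_mono_AE')
    show "integrable N (\<lambda>x. ?A / \<kappa> * (v x)\<^sup>2 + \<kappa> * heat \<sigma> (x - y))" using v h by simp
    show "AE x in N. heat \<sigma> (x - y) * hyp (v x) \<le> ?A / \<kappa> * (v x)\<^sup>2 + \<kappa> * heat \<sigma> (x - y)"
    proof (rule always_eventually, rule allI)
      fix x
      have "\<bar>v x\<bar> * \<kappa> \<le> (v x)\<^sup>2 + \<kappa>\<^sup>2"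
        using abs_mult_le_sum_squares[of "v x" \<kappa>] \<kappa> by (simp add: abs_mult)
      then have "\<bar>v x\<bar> \<le> (v x)\<^sup>2 / \<kappa> + \<kappa>" using \<kappa> by (simp add: field_simps power2_eq_square)
      then have "hyp (v x) \<le> (v x)\<^sup>2 / \<kappa> + \<kappa>" using hyp_le_abs[of "v x"] by linarith
      then have "heat \<sigma> (x - y) * hyp (v x) \<le> heat \<sigma> (x - y) * ((v x)\<^sup>2 / \<kappa>) + heat \<sigma> (x - y) * \<kappa>"
        using mult_left_mono[OF _ heat_nonneg] by (metis distrib_left)
      also have "heat \<sigma> (x - y) * ((v x)\<^sup>2 / \<kappa>) \<le> ?A * ((v x)\<^sup>2 / \<kappa>)"
        using hA \<kappa> by (intro mult_right_mono) auto
      finally show "heat \<sigma> (x - y) * hyp (v x) \<le> ?A / \<kappa> * (v x)\<^sup>2 + \<kappa> * heat \<sigma> (x - y)" by (simp add: mult_ac)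
    qed
    show "AE x in N. 0 \<le> ?A / \<kappa> * (v x)\<^sup>2 + \<kappa> * heat \<sigma> (x - y)"
      using \<kappa> by (intro always_eventually allI add_nonneg_nonneg mult_nonneg_nonneg heat_nonneg) auto
  qed
  also have "\<dots> = ?A / \<kappa> * (\<integral>x. (v x)\<^sup>2 \<partial>N) + \<kappa> * (\<integral>x. heat \<sigma> (x - y) \<partial>N)" using v h by simp
  also have "\<dots> \<le> ?A / \<kappa> * \<kappa>\<^sup>2 + \<kappa> * 1"
    using v(3) h(2) \<kappa> by (intro add_mono mult_left_mono) auto
  also have "\<dots> = (?A + 1) * \<kappa>" using \<kappa> by (simp add: power2_eq_square algebra_simps)
  finally show ?thesis .
qed

lemma Lp_imp_integrable:
  fixes g :: "real^'n \<Rightarrow> real"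
  assumes "1 \<le> q" and g: "Lp_on q \<Omega> g"
  shows "integrable N g"
proof (rule Bochner_Integration.integrable_bound)
  show "integrable N (\<lambda>x. \<bar>g x\<bar> powr q + 1)" using g by (simp add: Lp_on_def)
  show "AE x in N. norm (g x) \<le> norm (\<bar>g x\<bar> powr q + 1)"
  proof (rule always_eventually, rule allI)
    fix x show "norm (g x) \<le> norm (\<bar>g x\<bar> powr q + 1)"
      using young_split[of "\<bar>g x\<bar>" 1 q] assms(1) by simp
  qed
qed (use g in \<open>simp add: Lp_on_def\<close>)

lemma source_bound:
  fixes g :: "real^'n \<Rightarrow> real"
  assumes q: "1 \<le> q" and g: "Lp_on q \<Omega> g" and C2: "0 \<le> C2" and s: "0 < s" "s \<le> \<sigma>"
  shows "(\<integral>x. (C2 + \<bar>g x\<bar>) * heat \<sigma> (x - y) \<partial>N)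
    \<le> C2 + ((\<integral>x. \<bar>g x\<bar> powr q \<partial>N) + 1) * s powr (- (real CARD('n) / (2 * q)))"
proof -
  let ?\<theta> = "real CARD('n) / (2 * q)" and ?G = "\<integral>x. \<bar>g x\<bar> powr q \<partial>N"
  let ?A = "(4 * pi * \<sigma>) powr (- (real CARD('n) / 2))"
  have \<sigma>: "\<sigma> > 0" using s by simp
  note h = integral_N_heat_le[OF \<sigma>, of y]
  have gq: "integrable N (\<lambda>x. \<bar>g x\<bar> powr q)" using g by (simp add: Lp_on_def)
  define \<mu> where "\<mu> = \<sigma> powr ?\<theta>"
  have \<mu>: "\<mu> > 0" using \<sigma> by (simp add: \<mu>_def)
  \<comment> \<open>Since \<open>?\<theta> * q\<close> is half the dimension, both parts of the
    splitting carry the same power of \<open>\<sigma>\<close>; this is what the choice of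
    \<open>\<mu>\<close> balances. The factor with \<open>4 * pi\<close> is at most 1 and is
    dropped.\<close>
  have \<mu>A: "\<mu> powr (q - 1) * ?A \<le> \<sigma> powr (- ?\<theta>)"
  proof -
    have "?A = (4 * pi) powr (- (real CARD('n) / 2)) * \<sigma> powr (- (real CARD('n) / 2))"
      using \<sigma> by (simp add: powr_mult)
    also have "\<dots> \<le> 1 * \<sigma> powr (- (real CARD('n) / 2))"
    proof (rule mult_right_mono)
      have "1 \<le> (4 * pi) powr (real CARD('n) / 2)" using pi_gt3 by (intro ge_one_powr_ge_zero) auto
      then show "(4 * pi) powr (- (real CARD('n) / 2)) \<le> 1" by (simp add: powr_minus inverse_le_1_iff)
    qed simp
    finally have "\<mu> powr (q - 1) * ?A \<le> \<mu> powr (q - 1) * \<sigma> powr (- (real CARD('n) / 2))"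
      by (intro mult_left_mono) auto
    also have "\<dots> = \<sigma> powr (?\<theta> * (q - 1) + - (real CARD('n) / 2))"
      unfolding \<mu>_def powr_powr powr_add ..
    also have "?\<theta> * (q - 1) + - (real CARD('n) / 2) = - ?\<theta>"
      using q by (simp add: field_simps)
    finally show ?thesis .
  qed
  have \<mu>i: "1 / \<mu> = \<sigma> powr (- ?\<theta>)" by (simp add: \<mu>_def powr_minus inverse_eq_divide)
  have "(\<integral>x. (C2 + \<bar>g x\<bar>) * heat \<sigma> (x - y) \<partial>N) \<le> (\<integral>x. (C2 + 1 / \<mu>) * heat \<sigma> (x - y) + \<mu> powr (q - 1) * ?A * \<bar>g x\<bar> powr q \<partial>N)"
  proof (rule integral_mono_AE')
    show "integrable N (\<lambda>x. (C2 + 1 / \<mu>) * heat \<sigma> (x - y) + \<mu> powr (q - 1) * ?A * \<bar>g x\<bar> powr q)"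
      by (intro Bochner_Integration.integrable_add integrable_mult_right h gq)
    show "AE x in N. (C2 + \<bar>g x\<bar>) * heat \<sigma> (x - y) \<le> (C2 + 1 / \<mu>) * heat \<sigma> (x - y) + \<mu> powr (q - 1) * ?A * \<bar>g x\<bar> powr q"
    proof (rule always_eventually, rule allI)
      fix x
      have "(C2 + \<bar>g x\<bar>) * heat \<sigma> (x - y) \<le> (C2 + (\<mu> powr (q - 1) * \<bar>g x\<bar> powr q + 1 / \<mu>)) * heat \<sigma> (x - y)"
        using young_split[of "\<bar>g x\<bar>" \<mu> q] \<mu> q by (intro mult_right_mono heat_nonneg) auto
      also have "\<dots> = (C2 + 1 / \<mu>) * heat \<sigma> (x - y) + (\<mu> powr (q - 1) * \<bar>g x\<bar> powr q) * heat \<sigma> (x - y)" by (simp add: algebra_simps)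
      also have "(\<mu> powr (q - 1) * \<bar>g x\<bar> powr q) * heat \<sigma> (x - y) \<le> (\<mu> powr (q - 1) * \<bar>g x\<bar> powr q) * ?A"
        by (intro mult_left_mono heat_le \<sigma>) auto
      finally show "(C2 + \<bar>g x\<bar>) * heat \<sigma> (x - y) \<le> (C2 + 1 / \<mu>) * heat \<sigma> (x - y) + \<mu> powr (q - 1) * ?A * \<bar>g x\<bar> powr q"
        by (simp add: mult_ac)
    qed
    show "AE x in N. 0 \<le> (C2 + 1 / \<mu>) * heat \<sigma> (x - y) + \<mu> powr (q - 1) * ?A * \<bar>g x\<bar> powr q"
      using C2 \<mu> by (intro always_eventually allI add_nonneg_nonneg mult_nonneg_nonneg heat_nonneg) auto
  qed
  also have "\<dots> = (C2 + 1 / \<mu>) * (\<integral>x. heat \<sigma> (x - y) \<partial>N) + \<mu> powr (q - 1) * ?A * ?G"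
    using h gq by simp
  also have "\<dots> \<le> (C2 + 1 / \<mu>) * 1 + \<sigma> powr (- ?\<theta>) * ?G"
    using h(2) C2 \<mu> \<mu>A by (intro add_mono mult_left_mono mult_right_mono integral_nonneg_AE) auto
  also have "\<dots> = C2 + (?G + 1) * \<sigma> powr (- ?\<theta>)" unfolding \<mu>i by (simp add: algebra_simps)
  \<comment> \<open>In the application \<open>\<sigma>\<close> exceeds \<open>s\<close> by the width
    of the peak; going down to \<open>s\<close> makes the bound independent of that width.\<close>
  also have "\<dots> \<le> C2 + (?G + 1) * s powr (- ?\<theta>)"
  proof -
    have "\<sigma> powr (- ?\<theta>) \<le> s powr (- ?\<theta>)" using s q by (intro powr_mono2') auto
    moreover have "0 \<le> ?G" by (intro integral_nonneg_AE) auto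
    ultimately show ?thesis by (intro add_left_mono mult_left_mono) auto
  qed
  finally show ?thesis .
qed

text \<open>The energy inequality from time \<open>b - c\<close> to \<open>b\<close>, with both
  terms bounded independently of the centre \<open>y\<close> and the width \<open>e\<close> of the
  kernel, so that averages can be turned into an almost everywhere bound.\<close>

lemma sup_bound:
  fixes u :: "real \<Rightarrow> real^'n \<Rightarrow> real"
  assumes W: "weak_solution \<Omega> p f g u" and uc: "continuous_L2 \<Omega> u" and p: "p \<ge> 2"
    and f: "continuous_on UNIV f" and growth: "\<And>s. \<bar>f s\<bar> \<le> C1 * (1 + \<bar>s\<bar> powr (p - 1))"
    and C2: "0 \<le> C2" "\<And>s. - C2 \<le> f s * s"
    and q: "1 \<le> q" "real CARD('n) / (2 * q) < 1" and g: "Lp_on q \<Omega> g"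
    and c: "0 < c" "c < b" and \<kappa>: "1 \<le> \<kappa>" "(\<integral>x. (u (b - c) x)\<^sup>2 \<partial>N) \<le> \<kappa>\<^sup>2"
  shows "AE x in N. \<bar>u b x\<bar> \<le> ((4 * pi * c) powr (- (real CARD('n) / 2)) + 2 + C2 * c
    + ((\<integral>x. \<bar>g x\<bar> powr q \<partial>N) + 1) * (\<integral>s. indicator {0<..c} s * s powr (- (real CARD('n) / (2 * q))) \<partial>lborel)) * \<kappa>"
proof -
  let ?\<theta> = "real CARD('n) / (2 * q)" and ?G = "\<integral>x. \<bar>g x\<bar> powr q \<partial>N"
  let ?A = "(4 * pi * c) powr (- (real CARD('n) / 2))"
  define k where "k s = indicator {0<..c} s * s powr (- ?\<theta>)" for s :: real
  have ki: "integrable lborel k" unfolding k_def using integrable_powr_singularity[OF q(2) c(1)] by simp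
  let ?I = "\<integral>s. k s \<partial>lborel"
  have G0: "0 \<le> ?G" by (intro integral_nonneg_AE) auto
  have I0: "0 \<le> ?I" by (intro integral_nonneg_AE) (auto simp: k_def)
  note gi = Lp_imp_integrable[OF q(1) g]
  let ?a = "b - c"
  have a: "0 < ?a" "?a < b" using c by auto
  let ?M = "(?A + 1) * \<kappa> + (C2 * c + (?G + 1) * ?I)"
  have u2: "u t \<in> borel_measurable N" "integrable N (\<lambda>x. (u t x)\<^sup>2)" if "t \<ge> 0" for t
    using continuous_L2_sq[OF uc] that by auto
  have avg: "(\<integral>x. heat e (x - y) * hyp (u b x) \<partial>N) \<le> ?M" if e: "e > 0" for e y
  proof -
    note E = heat_energy[OF W uc p f growth C2 gi a e, of y]
    have 1: "(\<integral>x. heat (b + e - ?a) (x - y) * hyp (u ?a x) \<partial>N) \<le> (?A + 1) * \<kappa>"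
      by (rule initial_bound) (use u2[of ?a] a \<kappa> c e in auto)
    \<comment> \<open>The singularity of the source term sits at the final time; reflecting time
      about \<open>b\<close> moves it to 0.\<close>
    have kb: "integrable lborel (\<lambda>t. k (b - t))" "(\<integral>t. k (b - t) \<partial>lborel) = ?I"
      using lborel_integrable_real_affine[OF ki, of "-1" b] lborel_integral_real_affine[of "-1" k b] by auto
    have ii: "integrable lborel (indicator {?a..<b} :: real \<Rightarrow> real)" using a by (intro integrable_real_indicator) auto
    have "(\<integral>t. indicator {?a..<b} t * (\<integral>x. (C2 + \<bar>g x\<bar>) * heat (b + e - t) (x - y) \<partial>N) \<partial>lborel)
      \<le> (\<integral>t. C2 * indicator {?a..<b} t + (?G + 1) * k (b - t) \<partial>lborel)"
    proof (rule integral_mono[OF E(2)])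
      show "integrable lborel (\<lambda>t. C2 * indicator {?a..<b} t + (?G + 1) * k (b - t))" using ii kb by simp
      fix t
      show "indicator {?a..<b} t * (\<integral>x. (C2 + \<bar>g x\<bar>) * heat (b + e - t) (x - y) \<partial>N) \<le> C2 * indicator {?a..<b} t + (?G + 1) * k (b - t)"
      proof (cases "t \<in> {?a..<b}")
        case True
        then have "k (b - t) = (b - t) powr (- ?\<theta>)" by (simp add: k_def)
        with True source_bound[OF q(1) g C2(1), of "b - t" "b + e - t" y] e show ?thesis by simp
      next
        case False
        then show ?thesis using G0 by (simp add: k_def)
      qed
    qed
    also have "\<dots> = C2 * c + (?G + 1) * ?I" using ii kb a by simp
    finally show ?thesis using E(1) 1 by linarith
  qed
  have "integrable N (u b)" using u2[of b] a square_integrable_imp_integrable by auto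
  then have hi: "integrable N (\<lambda>x. hyp (u b x))"
  proof (rule Bochner_Integration.integrable_bound)
    show "(\<lambda>x. hyp (u b x)) \<in> borel_measurable N" using u2(1)[of b] a by auto
  qed (auto simp: hyp_nonneg hyp_le_abs)
  have "AE x in N. hyp (u b x) \<le> ?M"
    by (rule AE_le_if_heat_averages_le[OF hi hyp_nonneg avg])
  then show ?thesis
  proof eventually_elim
    case (elim x)
    have "\<bar>u b x\<bar> \<le> ?M + 1" using elim abs_le_hyp[of "u b x"] by linarith
    \<comment> \<open>Here \<open>1 \<le> \<kappa>\<close> makes all terms proportional to
      \<open>\<kappa>\<close>: the source contribution and the 1 lost between \<open>hyp\<close> and
      the absolute value.\<close>
    also have "\<dots> \<le> (?A + 1) * \<kappa> + (C2 * c + (?G + 1) * ?I) * \<kappa> + \<kappa>"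
      using \<kappa> C2 c G0 I0 mult_left_mono[OF \<kappa>(1), of "C2 * c + (?G + 1) * ?I"] by simp
    also have "\<dots> = (?A + 2 + C2 * c + (?G + 1) * ?I) * \<kappa>" by (simp add: algebra_simps)
    finally show ?case unfolding k_def .
  qed
qed

text \<open>The infimum is meaningful only if the set of essential bounds is bounded below. It is
  bounded by 0, because a negative bound would force the nonempty open domain to be a null
  set.\<close>

lemma Linf_norm_le:
  assumes "\<Omega> \<noteq> {}" and "AE x in N. \<bar>v x\<bar> \<le> C"
  shows "Linf_norm \<Omega> v \<le> C"
proof -
  have nn: "0 \<le> c" if "AE x in N. \<bar>v x\<bar> \<le> c" for c
  proof (rule ccontr)
    assume "\<not> 0 \<le> c"
    have "AE x in N. False" using that by eventually_elim (use \<open>\<not> 0 \<le> c\<close> in linarith)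
    then have "emeasure N (space N) = 0" by (simp add: AE_iff_measurable[OF _ refl])
    then have "\<Omega> \<in> null_sets lebesgue" by (simp add: emeasure_restrict_space null_sets_def)
    then have "negligible \<Omega>" by (simp add: negligible_iff_null_sets)
    then show False using open_not_negligible[OF open_dom assms(1)] by blast
  qed
  have "bdd_below {c. AE x in N. \<bar>v x\<bar> \<le> c}"
    by (rule bdd_belowI[of _ 0]) (rule nn, simp)
  then show ?thesis unfolding Linf_norm_def by (rule cInf_lower[rotated]) (use assms(2) in simp)
qed

end

theorem mainTheorem1:
  fixes \<Omega> :: "(real^'n::finite) set" and p :: real and f :: "real \<Rightarrow> real"
    and g :: "real^'n \<Rightarrow> real" and \<tau> :: real
  assumes dom: "bounded_lipschitz_domain \<Omega>"
    and p: "p \<ge> 2"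
    and f_cont: "continuous_on UNIV f"
    and f_growth: "\<exists>C1 C2 \<alpha>. C1 > 0 \<and> C2 > 0 \<and> \<alpha> > 0 \<and>
        (\<forall>s. \<bar>f s\<bar> \<le> C1 * (1 + \<bar>s\<bar> powr (p - 1)) \<and> f s * s \<ge> \<alpha> * \<bar>s\<bar> powr p - C2)"
    and g: "(CARD('n) \<ge> 2 \<and> (\<exists>s. s > real CARD('n) / 2 \<and> Lp_on s \<Omega> g))
          \<or> (CARD('n) = 1 \<and> Lp_on 1 \<Omega> g)"
    and tau: "\<tau> > 0"
  shows "\<exists>D>0. \<forall>u t1. weak_solution \<Omega> p f g u \<and> continuous_L2 \<Omega> u \<and> t1 \<ge> 0 \<and>
            bdd_above ((\<lambda>s. Lp_norm 2 \<Omega> (u s)) ` {t1..}) \<longrightarrow>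
            (\<forall>t\<ge>t1 + \<tau>. Linf_on \<Omega> (u t) \<and>
               Linf_norm \<Omega> (u t) \<le> D * ((SUP s\<in>{t1..}. Lp_norm 2 \<Omega> (u s)) + 1))"
proof -
  interpret bounded_open \<Omega>
    using dom by unfold_locales (auto simp: bounded_lipschitz_domain_def)
  have ne: "\<Omega> \<noteq> {}" using dom by (simp add: bounded_lipschitz_domain_def)
  obtain C1 C2 \<alpha> where C: "C2 > 0" "\<alpha> > 0" "\<And>s. \<bar>f s\<bar> \<le> C1 * (1 + \<bar>s\<bar> powr (p - 1))"
    "\<And>s. f s * s \<ge> \<alpha> * \<bar>s\<bar> powr p - C2" using f_growth by blast
  have C2: "0 \<le> C2" "- C2 \<le> f s * s" for s
  proof -
    have "0 \<le> \<alpha> * \<bar>s\<bar> powr p" using C(2) by simp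
    with C(4)[of s] show "- C2 \<le> f s * s" by linarith
  qed (use C in simp)
  \<comment> \<open>Unifies the two cases for \<open>g\<close>: in dimension one
    \<open>q = 1\<close> gives the exponent 1/2, in higher dimension the given exponent exceeds half
    the dimension and therefore 1.\<close>
  obtain q where q: "1 \<le> q" "real CARD('n) / (2 * q) < 1" "Lp_on q \<Omega> g"
  proof (cases "CARD('n) = 1")
    case True
    with g show ?thesis by (intro that[of 1]) auto
  next
    case False
    with g obtain s where s: "s > real CARD('n) / 2" "Lp_on s \<Omega> g" "CARD('n) \<ge> 2" by auto
    then have "1 \<le> s" by linarith
    with s show ?thesis by (intro that[of s]) (auto simp: divide_less_eq)
  qed
  \<comment> \<open>The starting time \<open>t - c\<close> is at least
    \<open>t1 + \<tau> / 2\<close>: strictly positive even for \<open>t1 = 0\<close>, and inside the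
    range of the supremum.\<close>
  define c where "c = \<tau> / 2"
  have c: "0 < c" using tau by (simp add: c_def)
  define D where "D = (4 * pi * c) powr (- (real CARD('n) / 2)) + 2 + C2 * c
    + ((\<integral>x. \<bar>g x\<bar> powr q \<partial>N) + 1) * (\<integral>s. indicator {0<..c} s * s powr (- (real CARD('n) / (2 * q))) \<partial>lborel)"
  have "0 \<le> (\<integral>x. \<bar>g x\<bar> powr q \<partial>N)" "0 \<le> (\<integral>s. indicator {0<..c} s * s powr (- (real CARD('n) / (2 * q))) \<partial>(lborel :: real measure))"
    by (intro integral_nonneg_AE; simp)+
  then have D0: "D > 0" unfolding D_def using C2(1) c by (intro add_pos_nonneg add_nonneg_pos) auto
  show ?thesis
  proof (intro exI[of _ D] conjI D0 allI impI; (elim conjE)?)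
    fix u t1 t
    assume W: "weak_solution \<Omega> p f g u" and uc: "continuous_L2 \<Omega> u" and t1: "0 \<le> t1"
      and bdd: "bdd_above ((\<lambda>s. Lp_norm 2 \<Omega> (u s)) ` {t1..})" and t: "t1 + \<tau> \<le> t"
    let ?S = "SUP s\<in>{t1..}. Lp_norm 2 \<Omega> (u s)"
    have le: "Lp_norm 2 \<Omega> (u (t - c)) \<le> ?S"
      by (rule cSUP_upper[OF _ bdd]) (use t tau in \<open>simp add: c_def\<close>)
    have n0: "0 \<le> Lp_norm 2 \<Omega> (u (t - c))" by (simp add: Lp_norm_2 integral_nonneg_AE)
    have "(\<integral>x. (u (t - c) x)\<^sup>2 \<partial>N) = (Lp_norm 2 \<Omega> (u (t - c)))\<^sup>2" by (simp add: Lp_norm_2 integral_nonneg_AE)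
    \<comment> \<open>\<open>?S + 1\<close> plays the part of \<open>\<kappa>\<close>, which must be
      at least 1; this is the source of the \<open>+ 1\<close> in the claim.\<close>
    also have "\<dots> \<le> (?S + 1)\<^sup>2" using le n0 by (intro power_mono) auto
    finally have k: "(\<integral>x. (u (t - c) x)\<^sup>2 \<partial>N) \<le> (?S + 1)\<^sup>2" .
    have "c < t" using t t1 tau by (simp add: c_def)
    have ae: "AE x in N. \<bar>u t x\<bar> \<le> D * (?S + 1)"
      unfolding D_def using le n0
      by (intro sup_bound[OF W uc p f_cont C(3) C2 q c \<open>c < t\<close> _ k]) simp
    have "u t \<in> borel_measurable N" using continuous_L2_sq(1)[OF uc] t t1 tau by simp
    with ae show "Linf_on \<Omega> (u t)" by (auto simp: Linf_on_def)
    show "Linf_norm \<Omega> (u t) \<le> D * (?S + 1)" by (rule Linf_norm_le[OF ne ae])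
  qed
qed

end
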